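(* Let $\gamma\in(0,1]$ and let $f\in C^{1,\gamma}([0,\infty))$ satisfy $f(0)=f(1)=0$, $f>0$ on $(0,1)$, $f'(0)>0$, $f'(1)<0$, and $f<0$ on $(1,\infty)$. For $\varrho\in[0,1]$ let $$\mu_\varrho=\lambda\bigl(-\partial_y^2-f'(\phi_\varrho),\mathbb R_+,\varrho\bigr),$$ with $\phi_\varrho$ and $\lambda$ as in the context. Then the map $\varrho\mapsto\mu_\varrho$ is continuous on $[0,1]$ and $$\mu_*:=\min_{\varrho\in[0,1]}\mu_\varrho>0.$$ The same lower bound holds on the half-space: for every $d\ge1$ and $\varrho\in[0,1]$, $\lambda\bigl(-\Delta-f'(\phi_\varrho(y)),\mathbb H^d,\varrho\bigr)\ge\mu_*$, where $\mathbb H^d=\mathbb R^{d-1}\times\mathbb R_+$ and $y$ is the last coordinate.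
   Context: $\mathbb R_+=(0,\infty)$. For $\varrho\in(0,1]$ let $\beta_\varrho=(1-\varrho)/\varrho$. For a domain $D$ and real $V\in L^\infty(D)$, $\lambda(-\Delta+V,D,\varrho)$ is the infimum over nonzero $\psi$ in the form domain of $\mathfrak q_{V,\varrho}[\psi]/\|\psi\|_{L^2(D)}^2$, where for $\varrho>0$: $\mathfrak q_{V,\varrho}[\psi]=\int_D(|\nabla\psi|^2+V\psi^2)+\beta_\varrho\int_{\partial D}\psi^2$ with form domain $H^1(D)$; for $\varrho=0$ the same expression without boundary term on $H^1_0(D)$. On $D=\mathbb R_+$ the boundary term is $\beta_\varrho|\psi(0)|^2$. For $\varrho\in[0,1)$, $\phi_\varrho$ is the unique solution on $[0,\infty)$ of $-\phi_\varrho''=f(\phi_\varrho)$ for $y>0$, $-\varrho\phi_\varrho'(0)+(1-\varrho)\phi_\varrho(0)=0$, $\phi_\varrho(+\infty)=1$, with $0\le\phi_\varrho<1$ and $\phi_\varrho'>0$; $\phi_1\equiv1$. *)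

theory Defs
  imports "HOL-Analysis.Analysis" "HOL-Probability.Giry_Monad"
begin

fun C_k :: "nat \<Rightarrow> ('a::euclidean_space \<Rightarrow> real) \<Rightarrow> bool" where
  "C_k 0 \<psi> \<longleftrightarrow> continuous_on UNIV \<psi>"
| "C_k (Suc k) \<psi> \<longleftrightarrow> (\<forall>x. \<psi> differentiable (at x)) \<and>
     (\<forall>b\<in>Basis. C_k k (\<lambda>x. frechet_derivative \<psi> (at x) b))"

definition test_functions :: "'a::euclidean_space set \<Rightarrow> ('a \<Rightarrow> real) set" where
  "test_functions D = {\<psi>. (\<forall>k. C_k k \<psi>) \<and>
     compact (closure {x. \<psi> x \<noteq> 0}) \<and> closure {x. \<psi> x \<noteq> 0} \<subseteq> D}"

text \<open>Elements of $L^2$ and $H^1$ are represented by Borel functions; values outside the domain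
  are irrelevant.\<close>

abbreviation leb :: "'a::euclidean_space set \<Rightarrow> 'a measure" where
  "leb D \<equiv> restrict_space lborel D"

definition L2 :: "'a measure \<Rightarrow> ('a \<Rightarrow> 'b::real_normed_vector) set" where
  "L2 M = {u \<in> borel_measurable M. integrable M (\<lambda>x. (norm (u x))\<^sup>2)}"

definition is_weak_gradient ::
    "'a::euclidean_space set \<Rightarrow> ('a \<Rightarrow> real) \<Rightarrow> ('a \<Rightarrow> 'a) \<Rightarrow> bool" where
  "is_weak_gradient D \<psi> G \<longleftrightarrow> (\<forall>\<eta>\<in>test_functions D. \<forall>b\<in>Basis.
     (\<integral>x. \<psi> x * frechet_derivative \<eta> (at x) b \<partial>leb D) = - (\<integral>x. (G x \<bullet> b) * \<eta> x \<partial>leb D))"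

definition H1 :: "'a::euclidean_space set \<Rightarrow> ('a \<Rightarrow> real) set" where
  "H1 D = {\<psi> \<in> L2 (leb D). \<exists>G\<in>L2 (leb D). is_weak_gradient D \<psi> G}"

text \<open>For \<open>\<psi> \<in> H1 D\<close> with \<open>D\<close> open, the choice below is unique up to null sets.\<close>

definition weak_gradient :: "'a::euclidean_space set \<Rightarrow> ('a \<Rightarrow> real) \<Rightarrow> 'a \<Rightarrow> 'a" where
  "weak_gradient D \<psi> = (SOME G. G \<in> L2 (leb D) \<and> is_weak_gradient D \<psi> G)"

definition L2_norm :: "'a measure \<Rightarrow> ('a \<Rightarrow> 'b::real_normed_vector) \<Rightarrow> real" where
  "L2_norm M u = sqrt (\<integral>x. (norm (u x))\<^sup>2 \<partial>M)"

definition H1_norm :: "'a::euclidean_space set \<Rightarrow> ('a \<Rightarrow> real) \<Rightarrow> real" where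
  "H1_norm D \<psi> = sqrt ((L2_norm (leb D) \<psi>)\<^sup>2 + (L2_norm (leb D) (weak_gradient D \<psi>))\<^sup>2)"

definition H1_0 :: "'a::euclidean_space set \<Rightarrow> ('a \<Rightarrow> real) set" where
  "H1_0 D = {\<psi> \<in> H1 D. \<exists>\<eta>. (\<forall>n. \<eta> n \<in> test_functions D) \<and>
     (\<lambda>n::nat. H1_norm D (\<lambda>x. \<eta> n x - \<psi> x)) \<longlonglongrightarrow> 0}"

text \<open>The trace is the continuous extension to \<open>H1 D\<close> of the restriction to the boundary of
  smooth functions with compact support in the whole space. The measure \<open>\<sigma>\<close> is the surface
  measure of the boundary of \<open>D\<close>; the choice is unique up to \<open>\<sigma>\<close>-null sets.\<close>

definition is_trace ::
    "'a::euclidean_space set \<Rightarrow> 'a measure \<Rightarrow> ('a \<Rightarrow> real) \<Rightarrow> ('a \<Rightarrow> real) \<Rightarrow> bool" where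
  "is_trace D \<sigma> \<psi> g \<longleftrightarrow> g \<in> L2 \<sigma> \<and> (\<exists>\<eta>. (\<forall>n. \<eta> n \<in> test_functions UNIV) \<and>
     (\<lambda>n::nat. H1_norm D (\<lambda>x. \<eta> n x - \<psi> x)) \<longlonglongrightarrow> 0 \<and>
     (\<lambda>n. L2_norm \<sigma> (\<lambda>x. \<eta> n x - g x)) \<longlonglongrightarrow> 0)"

definition trace_on ::
    "'a::euclidean_space set \<Rightarrow> 'a measure \<Rightarrow> ('a \<Rightarrow> real) \<Rightarrow> 'a \<Rightarrow> real" where
  "trace_on D \<sigma> \<psi> = (SOME g. is_trace D \<sigma> \<psi> g)"

definition robin_coeff :: "real \<Rightarrow> real" where
  "robin_coeff \<rho> = (1 - \<rho>) / \<rho>"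

definition form_domain :: "'a::euclidean_space set \<Rightarrow> real \<Rightarrow> ('a \<Rightarrow> real) set" where
  "form_domain D \<rho> = (if \<rho> = 0 then H1_0 D else H1 D)"

definition quad_form ::
    "'a::euclidean_space set \<Rightarrow> 'a measure \<Rightarrow> ('a \<Rightarrow> real) \<Rightarrow> real \<Rightarrow> ('a \<Rightarrow> real) \<Rightarrow> real" where
  "quad_form D \<sigma> V \<rho> \<psi> =
     (\<integral>x. (norm (weak_gradient D \<psi> x))\<^sup>2 + V x * (\<psi> x)\<^sup>2 \<partial>leb D) +
     (if \<rho> = 0 then 0 else robin_coeff \<rho> * (\<integral>x. (trace_on D \<sigma> \<psi> x)\<^sup>2 \<partial>\<sigma>))"

text \<open>The infimum is a real one: for essentially bounded \<open>V\<close> and \<open>0 \<le> \<rho> \<le> 1\<close> the set of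
  quotients is nonempty and bounded below. Nonzero \<open>\<psi>\<close> means nonzero as an element of $L^2$.\<close>

definition principal_eigenvalue ::
    "'a::euclidean_space set \<Rightarrow> 'a measure \<Rightarrow> ('a \<Rightarrow> real) \<Rightarrow> real \<Rightarrow> real" where
  "principal_eigenvalue D \<sigma> V \<rho> =
     (INF \<psi> \<in> {\<psi> \<in> form_domain D \<rho>. L2_norm (leb D) \<psi> \<noteq> 0}.
        quad_form D \<sigma> V \<rho> \<psi> / (L2_norm (leb D) \<psi>)\<^sup>2)"

definition half_space :: "'a::euclidean_space \<Rightarrow> 'a set" where
  "half_space e = {x. 0 < x \<bullet> e}"

text \<open>Lebesgue measure on the hyperplane \<open>x \<bullet> e = 0\<close> for \<open>e \<in> Basis\<close>, built as
  \<open>lborel\<close> is but omitting the coordinate \<open>e\<close>.\<close>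

definition hyperplane_measure :: "'a::euclidean_space \<Rightarrow> 'a measure" where
  "hyperplane_measure e =
     distr (\<Pi>\<^sub>M b\<in>Basis - {e}. lborel) borel (\<lambda>z. \<Sum>b\<in>Basis - {e}. z b *\<^sub>R b)"

lemma half_space_real: "half_space (1::real) = {0<..}"
  by (auto simp: half_space_def)

lemma hyperplane_measure_real: "hyperplane_measure (1::real) = return borel 0"
proof (rule measure_eqI)
  fix A :: "real set" assume "A \<in> sets (hyperplane_measure 1)"
  then have [measurable]: "A \<in> sets borel" by (simp add: hyperplane_measure_def)
  show "emeasure (hyperplane_measure 1) A = emeasure (return borel 0) A"
    by (simp add: hyperplane_measure_def emeasure_distr PiM_empty space_PiM_empty
        emeasure_count_space vimage_def indicator_def)
qed (simp add: hyperplane_measure_def)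

text \<open>The derivative \<open>f'\<close> is one-sided at \<open>0\<close>, and Hoelder continuity is required on bounded
  subsets of \<open>[0,\<infinity>)\<close> only.\<close>

definition C1_hoelder :: "real \<Rightarrow> (real \<Rightarrow> real) \<Rightarrow> (real \<Rightarrow> real) \<Rightarrow> bool" where
  "C1_hoelder \<gamma> f f' \<longleftrightarrow>
     (\<forall>u\<ge>0. (f has_real_derivative f' u) (at u within {0..})) \<and>
     (\<forall>R>0. \<exists>C. \<forall>u\<in>{0..R}. \<forall>v\<in>{0..R}. \<bar>f' u - f' v\<bar> \<le> C * \<bar>u - v\<bar> powr \<gamma>)"

definition robin_steady_state :: "(real \<Rightarrow> real) \<Rightarrow> real \<Rightarrow> (real \<Rightarrow> real) \<Rightarrow> bool" where
  "robin_steady_state f \<rho> \<phi> \<longleftrightarrow> (\<exists>\<phi>'.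
     (\<forall>y\<ge>0. (\<phi> has_real_derivative \<phi>' y) (at y within {0..})) \<and>
     continuous_on {0..} \<phi>' \<and>
     (\<forall>y>0. (\<phi>' has_real_derivative - f (\<phi> y)) (at y)) \<and>
     - \<rho> * \<phi>' 0 + (1 - \<rho>) * \<phi> 0 = 0 \<and>
     (\<phi> \<longlongrightarrow> 1) at_top \<and>
     (\<forall>y\<ge>0. 0 \<le> \<phi> y \<and> \<phi> y < 1) \<and>
     (\<forall>y\<ge>0. \<phi>' y > 0))"

end

theory Submission
  imports Defs
begin

text \<open>Write \<open>\<beta> = (1 - \<rho>) / \<rho>\<close> and \<open>V = - f' \<circ> \<phi> \<rho>\<close>. On the half-line, \<open>\<mu> \<rho>\<close> is the best constant in
\<open>\<mu> \<integral> s\<^sup>2 \<le> \<integral> (s'\<^sup>2 + V s\<^sup>2) + \<beta> (s 0)\<^sup>2\<close>, where \<open>s\<close> ranges over smooth compactly supported functions, which have to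
vanish near \<open>0\<close> if \<open>\<rho> = 0\<close>.

Positivity. The slope \<open>w = \<phi>'\<close> of the steady state is positive and solves \<open>- w'' + V w = 0\<close>, so
\<open>p = w' / w\<close> solves the Riccati equation \<open>p' + p\<^sup>2 = V\<close>. Expanding \<open>(s' - p s)\<^sup>2 \<ge> 0\<close> and integrating by
parts gives, for any differentiable \<open>p\<close> with \<open>p 0 \<le> \<beta>\<close> or any \<open>s\<close> with \<open>s 0 = 0\<close>, the lower bound
\<open>\<integral> (V - p' - p\<^sup>2) s\<^sup>2\<close> for the form (\<open>riccati_bound\<close>). The exact solution only yields \<open>0\<close>, but it satisfies
\<open>p \<le> - c \<phi>\<close> with \<open>c > 0\<close> (\<open>riccati_solution\<close>), and adding a small positive function to it makes
\<open>V - p' - p\<^sup>2\<close> uniformly positive (\<open>potential_positive\<close>). For \<open>\<rho> = 1\<close> the potential is the positive constant \<open>- f' 1\<close>.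

Continuity. By conservation of energy all profiles solve one autonomous equation \<open>\<phi>' = h(\<phi>)\<close> with the
same decreasing \<open>h\<close>, so two profiles are never further apart than they are at \<open>0\<close>
(\<open>profile_contraction\<close>), and the initial value depends continuously on \<open>\<rho>\<close>. Hence \<open>V\<close> depends on \<open>\<rho>\<close>
continuously in the supremum norm. For \<open>\<rho> > 0\<close> the boundary value is controlled by the form
itself, which absorbs a small change of \<open>\<beta>\<close> (\<open>mu_compare\<close>). As \<open>\<rho> \<rightarrow> 0\<close> the weight \<open>\<beta>\<close> blows up; a large
\<open>\<beta>\<close> pays for subtracting from \<open>s\<close> a fixed bump with the same value at \<open>0\<close>, which leads to a function
that vanishes at the boundary (\<open>mu_dirichlet_lower\<close>).

Half-space. On each line orthogonal to the boundary the restriction of a test function is a test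
function of the half-line, and the tangential derivatives only increase the form. Fubini's theorem
therefore transports every nonnegative lower bound from the half-line to the half-space (\<open>half_space_form_ge\<close>).

All this happens at the level of test functions. The passage to Sobolev functions, weak gradients
and traces rests on a one-sided mollification that only looks into the half-space
(\<open>pd_mollify\<close>): it yields uniqueness of weak gradients (\<open>fundamental_lemma\<close>) and density of test functions
(\<open>H1_density\<close>). Traces come from the formula
\<open>s 0 = \<integral>\<^sub>0\<^sup>1 (s t - (1 - t) s' t) dt\<close> (\<open>trace_estimate\<close>).\<close>

section \<open>Smooth functions and bump functions\<close>

definition smooth :: "('a::euclidean_space \<Rightarrow> real) \<Rightarrow> bool" where
  "smooth \<psi> \<longleftrightarrow> (\<forall>k. C_k k \<psi>)"

abbreviation pd :: "('a::euclidean_space \<Rightarrow> real) \<Rightarrow> 'a \<Rightarrow> 'a \<Rightarrow> real" where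
  "pd \<psi> b x \<equiv> frechet_derivative \<psi> (at x) b"

lemma frechet_derivative_eqI: "(f has_derivative f') (at x) \<Longrightarrow> frechet_derivative f (at x) = f'"
  by (metis frechet_derivative_at)

lemma C_k_SucI:
  assumes "\<And>x. (\<psi> has_derivative F x) (at x)" "\<And>b. b \<in> Basis \<Longrightarrow> C_k k (\<lambda>x. F x b)"
  shows "C_k (Suc k) \<psi>"
  using assms by (auto simp: differentiable_def frechet_derivative_eqI[OF assms(1)])

lemma C_k_SucD: "C_k (Suc k) \<psi> \<Longrightarrow> (\<psi> has_derivative frechet_derivative \<psi> (at x)) (at x)"
  by (simp add: frechet_derivative_works[symmetric])

lemma C_k_continuous: "C_k k \<psi> \<Longrightarrow> continuous_on UNIV \<psi>"
  by (cases k) (auto intro!: continuous_at_imp_continuous_on differentiable_imp_continuous_within)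

lemma C_k_Suc_imp: "C_k (Suc k) \<psi> \<Longrightarrow> C_k k \<psi>"
proof (induction k arbitrary: \<psi>)
  case 0 then show ?case using C_k_continuous[of "Suc 0"] by simp
next
  case (Suc k)
  have "\<And>b. b \<in> Basis \<Longrightarrow> C_k (Suc k) (pd \<psi> b)" "\<And>x. \<psi> differentiable (at x)"
    using Suc.prems by auto
  then show ?case using Suc.IH by auto
qed

lemma C_k_const: "C_k k (\<lambda>x. c)"
  by (induction k arbitrary: c) (auto intro!: continuous_intros)

lemma C_k_add:
  assumes "C_k k f" "C_k k g" shows "C_k k (\<lambda>x. f x + g x)"
  using assms
proof (induction k arbitrary: f g)
  case 0 then show ?case by (auto intro!: continuous_intros)
next
  case (Suc k)
  show ?case
    by (rule C_k_SucI[OF has_derivative_add[OF C_k_SucD[OF Suc.prems(1)] C_k_SucD[OF Suc.prems(2)]]])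
       (use Suc in auto)
qed

lemma C_k_mult:
  assumes "C_k k f" "C_k k g" shows "C_k k (\<lambda>x. f x * g x)"
  using assms
proof (induction k arbitrary: f g)
  case 0 then show ?case by (auto intro!: continuous_intros)
next
  case (Suc k)
  show ?case
    by (rule C_k_SucI[OF has_derivative_mult[OF C_k_SucD[OF Suc.prems(1)] C_k_SucD[OF Suc.prems(2)]]])
       (use Suc in \<open>auto intro!: C_k_add Suc.IH simp: C_k_Suc_imp simp del: C_k.simps(2); simp\<close>)
qed

lemma C_k_sum: "(\<And>i. i \<in> I \<Longrightarrow> C_k k (f i)) \<Longrightarrow> C_k k (\<lambda>x. \<Sum>i\<in>I. f i x)"
  by (induction I rule: infinite_finite_induct) (auto intro!: C_k_add C_k_const)

lemma C_k_prod: "(\<And>i. i \<in> I \<Longrightarrow> C_k k (f i)) \<Longrightarrow> C_k k (\<lambda>x. \<Prod>i\<in>I. f i x)"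
  by (induction I rule: infinite_finite_induct) (auto intro!: C_k_mult C_k_const)

lemma frechet_derivative_Basis:
  fixes h :: "'a::euclidean_space"
  assumes "\<psi> differentiable (at x)"
  shows "frechet_derivative \<psi> (at x) h = (\<Sum>b\<in>Basis. (h \<bullet> b) * pd \<psi> b x)"
proof -
  interpret linear "frechet_derivative \<psi> (at x)"
    using assms by (rule linear_frechet_derivative)
  have "frechet_derivative \<psi> (at x) (\<Sum>b\<in>Basis. (h \<bullet> b) *\<^sub>R b) = (\<Sum>b\<in>Basis. (h \<bullet> b) * pd \<psi> b x)"
    by (simp add: sum scale)
  then show ?thesis by (simp add: euclidean_representation)
qed

lemma has_derivative_affine_comp:
  assumes "\<psi> differentiable (at (A x + a))" "bounded_linear A"
  shows "((\<lambda>x. \<psi> (A x + a)) has_derivative (\<lambda>h. frechet_derivative \<psi> (at (A x + a)) (A h))) (at x)"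
proof -
  have "((\<lambda>x. A x + a) has_derivative (\<lambda>h. A h + 0)) (at x)"
    using assms(2) by (intro has_derivative_add bounded_linear_imp_has_derivative) auto
  moreover have "(\<psi> has_derivative frechet_derivative \<psi> (at (A x + a))) (at (A x + a))"
    using assms(1) by (simp add: frechet_derivative_works[symmetric])
  ultimately show ?thesis
    using diff_chain_at[of "\<lambda>x. A x + a" "\<lambda>h. A h + 0" x \<psi>] by (auto simp: o_def)
qed

text \<open>The chain rule expresses the partial derivatives of the composition as fixed linear
combinations of compositions of the same kind, so the induction closes. Slices, dilations, translations and
coordinate functions are all instances.\<close>

lemma C_k_affine:
  fixes A :: "'b::euclidean_space \<Rightarrow> 'a::euclidean_space"
  assumes "bounded_linear A" "C_k k \<psi>"
  shows "C_k k (\<lambda>x. \<psi> (A x + a))"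
  using assms(2)
proof (induction k arbitrary: \<psi>)
  case 0
  have "continuous_on UNIV (\<lambda>x. A x + a)"
    by (intro continuous_on_add linear_continuous_on assms(1) continuous_on_const)
  then show ?case using 0 by (auto intro: continuous_on_compose2)
next
  case (Suc k)
  have d: "\<psi> differentiable (at x)" for x using Suc.prems by auto
  show ?case
    by (rule C_k_SucI[OF has_derivative_affine_comp[OF d assms(1)]])
       (subst frechet_derivative_Basis[OF d], use Suc in \<open>auto intro!: C_k_sum C_k_mult C_k_const Suc.IH\<close>)
qed

lemma C_k_inverse:
  assumes "C_k k f" "\<And>x. f x \<noteq> 0" shows "C_k k (\<lambda>x. inverse (f x))"
  using assms
proof (induction k arbitrary: f)
  case 0 then show ?case by (auto intro!: continuous_intros)
next
  case (Suc k)
  show ?case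
  proof (rule C_k_SucI[OF Deriv.has_derivative_inverse[OF Suc.prems(2) C_k_SucD[OF Suc.prems(1)]]])
    fix b :: 'a assume b: "b \<in> Basis"
    have "C_k k (\<lambda>x. - 1 * (inverse (f x) * pd f b x * inverse (f x)))"
      using b Suc C_k_Suc_imp[OF Suc.prems(1)]
      by (intro C_k_mult C_k_const Suc.IH) auto
    then show "C_k k (\<lambda>x. - (inverse (f x) * pd f b x * inverse (f x)))" by simp
  qed
qed

lemma smooth_has_derivative: "smooth \<psi> \<Longrightarrow> (\<psi> has_derivative frechet_derivative \<psi> (at x)) (at x)"
  unfolding smooth_def using C_k_SucD by blast

lemma smooth_differentiable: "smooth \<psi> \<Longrightarrow> \<psi> differentiable (at x)"
  using smooth_has_derivative differentiable_def by blast

lemma smooth_pd: "smooth \<psi> \<Longrightarrow> b \<in> Basis \<Longrightarrow> smooth (pd \<psi> b)"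
  unfolding smooth_def using C_k.simps(2) by blast

lemma smooth_continuous: "smooth \<psi> \<Longrightarrow> continuous_on S \<psi>"
  unfolding smooth_def using C_k_continuous continuous_on_subset by blast

lemma smooth_const: "smooth (\<lambda>x. c)" and smooth_add: "smooth f \<Longrightarrow> smooth g \<Longrightarrow> smooth (\<lambda>x. f x + g x)"
  and smooth_mult: "smooth f \<Longrightarrow> smooth g \<Longrightarrow> smooth (\<lambda>x. f x * g x)"
  and smooth_prod: "(\<And>i. i \<in> I \<Longrightarrow> smooth (h i)) \<Longrightarrow> smooth (\<lambda>x. \<Prod>i\<in>I. h i x)"
  and smooth_inverse: "smooth f \<Longrightarrow> (\<And>x. f x \<noteq> 0) \<Longrightarrow> smooth (\<lambda>x. inverse (f x))"
  unfolding smooth_def by (simp_all add: C_k_const C_k_add C_k_mult C_k_prod C_k_inverse)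

lemma smooth_affine: "bounded_linear A \<Longrightarrow> smooth \<psi> \<Longrightarrow> smooth (\<lambda>x. \<psi> (A x + a))"
  unfolding smooth_def by (simp add: C_k_affine)

lemma smooth_diff: "smooth f \<Longrightarrow> smooth g \<Longrightarrow> smooth (\<lambda>x. f x - g x)"
  using smooth_add[of f "\<lambda>x. - 1 * g x"] smooth_mult[OF smooth_const[of "-1"], of g] by simp

text \<open>The polynomial makes the family stable: differentiation only replaces \<open>p\<close> by
\<open>X\<^sup>2 (p - p')\<close>, so smoothness of all members follows by one induction on the order.\<close>

definition flat :: "real poly \<Rightarrow> real \<Rightarrow> real" where
  "flat p x = (if x > 0 then poly p (1 / x) * exp (- (1 / x)) else 0)"

text \<open>In the variable \<open>t = 1 / x\<close> this is the fact that the exponential beats every polynomial.\<close>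

lemma flat_tendsto_0: "(flat p \<longlongrightarrow> 0) (at 0)"
proof -
  have 1: "((\<lambda>t. poly p t * exp (- t)) \<longlongrightarrow> 0) at_top"
  proof -
    have "((\<lambda>t::real. \<Sum>i\<le>degree p. coeff p i * (t ^ i / exp t)) \<longlongrightarrow> (\<Sum>i\<le>degree p. coeff p i * 0)) at_top"
      by (intro tendsto_sum tendsto_mult tendsto_const tendsto_power_div_exp_0)
    then show ?thesis
      by (simp add: poly_altdef sum_distrib_right exp_minus divide_inverse mult.assoc)
  qed
  have "filterlim (\<lambda>x::real. 1 / x) at_top (at_right 0)"
    using filterlim_inverse_at_top_right by (simp add: inverse_eq_divide)
  from filterlim_compose[OF 1 this]
  have "(flat p \<longlongrightarrow> 0) (at_right 0)"
    by (rule Lim_transform_eventually) (auto simp: flat_def eventually_at_filter)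
  moreover have "(flat p \<longlongrightarrow> 0) (at_left 0)"
    by (rule Lim_transform_eventually[OF tendsto_const]) (auto simp: flat_def eventually_at_filter)
  ultimately show ?thesis by (simp add: filterlim_split_at)
qed

lemma flat_DERIV: "(flat p has_real_derivative flat ([:0,0,1:] * (p - pderiv p)) x) (at x)"
proof -
  consider "x > 0" | "x < 0" | "x = 0" by linarith
  then show ?thesis
  proof cases
    case 1
    have "((\<lambda>x. poly p (1 / x) * exp (- (1 / x))) has_real_derivative
        flat ([:0,0,1:] * (p - pderiv p)) x) (at x)"
      using 1 by (auto intro!: derivative_eq_intros DERIV_chain'[OF _ poly_DERIV] simp: flat_def)
        (auto simp: field_simps power2_eq_square)
    then show ?thesis
      by (rule has_field_derivative_transform_within_open[where S="{0<..}"])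
         (use 1 in \<open>auto simp: flat_def\<close>)
  next
    case 2
    have "((\<lambda>x. 0) has_real_derivative 0) (at x)" by auto
    then have "(flat p has_real_derivative 0) (at x)"
      by (rule has_field_derivative_transform_within_open[where S="{..<0}"])
         (use 2 in \<open>auto simp: flat_def\<close>)
    then show ?thesis using 2 by (simp add: flat_def)
  next
    case 3
    have "((\<lambda>h. (flat p h - flat p 0) / (h - 0)) \<longlongrightarrow> 0) (at 0)"
      by (rule Lim_transform_eventually[OF flat_tendsto_0[of "pCons 0 p"]])
         (auto simp: flat_def eventually_at_filter field_simps)
    then have "(flat p has_real_derivative 0) (at 0)"
      by (simp add: has_field_derivative_iff)
    then show ?thesis using 3 by (simp add: flat_def)
  qed
qed

lemma smooth_flat: "smooth (flat p)"
  unfolding smooth_def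
proof
  fix k show "C_k k (flat p)"
  proof (induction k arbitrary: p)
    case 0 show ?case
      using flat_DERIV by (auto intro!: continuous_at_imp_continuous_on DERIV_isCont)
  next
    case (Suc k) show ?case
      by (rule C_k_SucI[OF flat_DERIV[unfolded has_field_derivative_def]]) (use Suc in auto)
  qed
qed

definition flat_exp :: "real \<Rightarrow> real" where "flat_exp = flat [:1:]"

lemma flat_exp: "smooth flat_exp" "flat_exp x \<ge> 0" "flat_exp x > 0 \<longleftrightarrow> x > 0" "x \<le> 0 \<Longrightarrow> flat_exp x = 0"
  by (auto simp: flat_exp_def smooth_flat) (auto simp: flat_def split: if_splits)

lemma smooth_real_affine: "smooth (g :: real \<Rightarrow> real) \<Longrightarrow> smooth (\<lambda>x. g (c * x + a))"
  using smooth_affine[OF bounded_linear_mult_right[of c]] by blast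

definition smooth_step :: "real \<Rightarrow> real" where
  "smooth_step t = flat_exp t * inverse (flat_exp t + flat_exp (1 - t))"

lemma smooth_step: "smooth smooth_step" "t \<le> 0 \<Longrightarrow> smooth_step t = 0" "t \<ge> 1 \<Longrightarrow> smooth_step t = 1" "0 \<le> smooth_step t" "smooth_step t \<le> 1"
proof -
  have pos: "flat_exp t + flat_exp (1 - t) > 0" for t
    using flat_exp(2)[of t] flat_exp(2)[of "1-t"] flat_exp(3)[of t] flat_exp(3)[of "1-t"] by (cases "t > 0") linarith+
  have "smooth (\<lambda>t. flat_exp (1 - t))" using smooth_real_affine[OF flat_exp(1), of "-1" 1] by simp
  then show "smooth smooth_step" unfolding smooth_step_def using pos
    by (intro smooth_mult smooth_inverse smooth_add flat_exp) (auto simp: less_imp_neq[THEN not_sym])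
  show "t \<le> 0 \<Longrightarrow> smooth_step t = 0" by (simp add: smooth_step_def flat_exp(4))
  show "t \<ge> 1 \<Longrightarrow> smooth_step t = 1"
    using pos[of t] flat_exp(4)[of "1 - t"] by (simp add: smooth_step_def)
  show "0 \<le> smooth_step t" using pos[of t] flat_exp(2)[of t] by (simp add: smooth_step_def)
  show "smooth_step t \<le> 1" using pos[of t] flat_exp(2)[of "1-t"] by (simp add: smooth_step_def field_simps)
qed

definition box_bump :: "'a::euclidean_space \<Rightarrow> real" where
  "box_bump z = (\<Prod>b\<in>Basis. flat_exp (z \<bullet> b) * flat_exp (1 - z \<bullet> b))"

lemma smooth_box_bump: "smooth box_bump"
proof -
  have "smooth (\<lambda>z::'a. flat_exp (z \<bullet> b + 0))" "smooth (\<lambda>z::'a. flat_exp (- (z \<bullet> b) + 1))" for b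
    by (intro smooth_affine[where A="\<lambda>z. z \<bullet> b"] smooth_affine[where A="\<lambda>z. - (z \<bullet> b)"] flat_exp
        bounded_linear_inner_left bounded_linear_minus)+
  then show ?thesis unfolding box_bump_def by (intro smooth_prod smooth_mult) (auto simp: algebra_simps)
qed

lemma box_bump_nonneg: "box_bump z \<ge> 0"
  unfolding box_bump_def by (intro prod_nonneg) (simp add: flat_exp)

lemma box_bump_pos: "z \<in> box 0 One \<Longrightarrow> box_bump z > 0"
  unfolding box_bump_def by (intro prod_pos mult_pos_pos) (auto simp: flat_exp mem_box)

lemma box_bump_zero: "z \<notin> cbox 0 One \<Longrightarrow> box_bump z = 0"
  unfolding box_bump_def mem_box by (auto intro!: prod_zero flat_exp bexI)

lemma test_functionsI:
  assumes "smooth \<psi>" "compact S" "S \<subseteq> D" "\<And>x. x \<notin> S \<Longrightarrow> \<psi> x = 0"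
  shows "\<psi> \<in> test_functions D"
proof -
  have "closure {x. \<psi> x \<noteq> 0} \<subseteq> S"
    using assms by (intro closure_minimal compact_imp_closed) auto
  moreover have "compact (closure {x. \<psi> x \<noteq> 0})"
    using compact_Int_closed[OF assms(2) closed_closure[of "{x. \<psi> x \<noteq> 0}"]] calculation
    by (simp add: inf.absorb2)
  ultimately show ?thesis using assms by (auto simp: test_functions_def smooth_def)
qed

text \<open>Most arguments need the support only through some compact set outside of which the function and its
derivatives vanish.\<close>

lemma test_functionsE:
  assumes "\<psi> \<in> test_functions D"
  obtains S where "smooth \<psi>" "compact S" "S \<subseteq> D" "\<And>x. x \<notin> S \<Longrightarrow> \<psi> x = 0"
    "\<And>x b. x \<notin> S \<Longrightarrow> pd \<psi> b x = 0"
proof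
  define S where "S = closure {x. \<psi> x \<noteq> 0}"
  show "smooth \<psi>" "compact S" "S \<subseteq> D" 
    using assms by (auto simp: test_functions_def smooth_def S_def)
  show z: "\<psi> x = 0" if "x \<notin> S" for x using that closure_subset[of "{x. \<psi> x \<noteq> 0}"] by (auto simp: S_def)
  fix x b assume x: "x \<notin> S"
  have "open (- S)" by (auto simp: S_def)
  have "((\<lambda>_. 0) has_derivative (\<lambda>_. 0)) (at x)" by simp
  from has_derivative_transform_within_open[OF this \<open>open (-S)\<close>, of \<psi>] x z
  have "(\<psi> has_derivative (\<lambda>_. 0)) (at x)" by auto
  then show "pd \<psi> b x = 0" by (simp add: frechet_derivative_eqI)
qed

lemma test_functions_mono: "D \<subseteq> E \<Longrightarrow> \<psi> \<in> test_functions D \<Longrightarrow> \<psi> \<in> test_functions E"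
  by (auto simp: test_functions_def)

lemma test_functions_diff:
  assumes "f \<in> test_functions D" "g \<in> test_functions D" shows "(\<lambda>x. f x - g x) \<in> test_functions D"
proof -
  obtain S T where "smooth f" "compact S" "S \<subseteq> D" "\<And>x. x \<notin> S \<Longrightarrow> f x = 0"
    "smooth g" "compact T" "T \<subseteq> D" "\<And>x. x \<notin> T \<Longrightarrow> g x = 0"
    using assms by (metis test_functionsE)
  then show ?thesis by (intro test_functionsI[of _ "S \<union> T"] smooth_diff compact_Un) auto
qed

lemma test_functions_mult:
  assumes "f \<in> test_functions D" "smooth g" shows "(\<lambda>x. f x * g x) \<in> test_functions D"
proof -
  obtain S where "smooth f" "compact S" "S \<subseteq> D" "\<And>x. x \<notin> S \<Longrightarrow> f x = 0"
    using assms by (metis test_functionsE)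
  then show ?thesis using assms(2) by (intro test_functionsI[of _ S] smooth_mult) auto
qed

lemma test_functions_pd:
  assumes "f \<in> test_functions D" "b \<in> Basis" shows "pd f b \<in> test_functions D"
proof -
  obtain S where "smooth f" "compact S" "S \<subseteq> D" "\<And>x. x \<notin> S \<Longrightarrow> f x = 0" "\<And>x b. x \<notin> S \<Longrightarrow> pd f b x = 0"
    using assms by (metis test_functionsE)
  then show ?thesis using assms(2) by (intro test_functionsI[of _ S] smooth_pd) auto
qed

section \<open>Square-integrable functions\<close>

lemma L2_norm_nonneg: "L2_norm M u \<ge> 0"
  by (simp add: L2_norm_def)

lemma L2_norm_power2: "(L2_norm M u)\<^sup>2 = (\<integral>x. (norm (u x))\<^sup>2 \<partial>M)"
  by (simp add: L2_norm_def)

lemma L2_norm_cong: "(\<And>x. x \<in> space M \<Longrightarrow> norm (u x) = norm (v x)) \<Longrightarrow> L2_norm M u = L2_norm M v"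
  unfolding L2_norm_def by (auto intro!: Bochner_Integration.integral_cong)

lemma L2_norm_cong_AE:
  fixes u v :: "'a \<Rightarrow> 'b::euclidean_space"
  assumes [measurable]: "u \<in> borel_measurable M" "v \<in> borel_measurable M" and "AE x in M. u x = v x"
  shows "L2_norm M u = L2_norm M v"
  unfolding L2_norm_def using assms(3) by (auto intro!: arg_cong[where f=sqrt] integral_cong_AE)

lemma L2_measurable: "u \<in> L2 M \<Longrightarrow> u \<in> borel_measurable M"
  and L2_integrable: "u \<in> L2 M \<Longrightarrow> integrable M (\<lambda>x. (norm (u x))\<^sup>2)"
  by (auto simp: L2_def)

text \<open>The pointwise bound is asked on the space only, because functions on a domain carry arbitrary values
outside of it.\<close>

lemma L2_mono:
  fixes u :: "'a \<Rightarrow> 'b::euclidean_space" and w :: "'a \<Rightarrow> 'c::euclidean_space"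
  assumes "u \<in> L2 M" and [measurable]: "w \<in> borel_measurable M" and le: "\<And>x. x \<in> space M \<Longrightarrow> norm (w x) \<le> C * norm (u x)"
  shows "w \<in> L2 M" "0 \<le> C \<Longrightarrow> L2_norm M w \<le> C * L2_norm M u"
proof -
  have i: "integrable M (\<lambda>x. C\<^sup>2 * (norm (u x))\<^sup>2)" using L2_integrable[OF assms(1)] by simp
  have le2: "(norm (w x))\<^sup>2 \<le> C\<^sup>2 * (norm (u x))\<^sup>2" if "x \<in> space M" for x
    using power_mono[OF le[OF that], of 2] by (simp add: power_mult_distrib)
  have iw: "integrable M (\<lambda>x. (norm (w x))\<^sup>2)"
    by (rule Bochner_Integration.integrable_bound[OF i]) (use le2 in \<open>auto simp: abs_mult intro!: AE_I2\<close>)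
  then show "w \<in> L2 M" by (simp add: L2_def)
  assume "0 \<le> C"
  have "(\<integral>x. (norm (w x))\<^sup>2 \<partial>M) \<le> (\<integral>x. C\<^sup>2 * (norm (u x))\<^sup>2 \<partial>M)"
    using iw i le2 by (rule integral_mono)
  then show "L2_norm M w \<le> C * L2_norm M u"
    using real_sqrt_le_mono[of "(\<integral>x. (norm (w x))\<^sup>2 \<partial>M)" "C\<^sup>2 * (\<integral>x. (norm (u x))\<^sup>2 \<partial>M)"] \<open>0 \<le> C\<close>
    by (simp add: L2_norm_def real_sqrt_mult)
qed

text \<open>The defect is the square \<open>(B a - A b)\<^sup>2 / (A B)\<close>.\<close>

lemma young_square:
  fixes a b :: real assumes "0 < A" "0 < B"
  shows "(a + b)\<^sup>2 \<le> (1 + B / A) * a\<^sup>2 + (1 + A / B) * b\<^sup>2"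
proof -
  have "(1 + B / A) * a\<^sup>2 + (1 + A / B) * b\<^sup>2 - (a + b)\<^sup>2 = (B * a - A * b)\<^sup>2 / (A * B)"
    using assms by (simp add: field_simps power2_eq_square)
  moreover have "(B * a - A * b)\<^sup>2 / (A * B) \<ge> 0" using assms by simp
  ultimately show ?thesis by linarith
qed

text \<open>Integrating Young's inequality with the weights \<open>A = \<parallel>u\<parallel>\<close>, \<open>B = \<parallel>v\<parallel>\<close> gives \<open>(A + B)\<^sup>2\<close> on the
right-hand side. The weights are increased by \<open>\<epsilon> / 2\<close> so that they may be divided by.\<close>

lemma L2_triangle:
  fixes u v w :: "'a \<Rightarrow> 'b::euclidean_space"
  assumes u: "u \<in> L2 M" and v: "v \<in> L2 M" and [measurable]: "w \<in> borel_measurable M"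
    and le: "\<And>x. x \<in> space M \<Longrightarrow> norm (w x) \<le> norm (u x) + norm (v x)"
  shows "w \<in> L2 M" "L2_norm M w \<le> L2_norm M u + L2_norm M v"
proof -
  define U V where "U = (\<integral>x. (norm (u x))\<^sup>2 \<partial>M)" and "V = (\<integral>x. (norm (v x))\<^sup>2 \<partial>M)"
  note i = L2_integrable[OF u] L2_integrable[OF v]
  have le2: "(norm (w x))\<^sup>2 \<le> (1 + B / A) * (norm (u x))\<^sup>2 + (1 + A / B) * (norm (v x))\<^sup>2"
    if "x \<in> space M" "0 < A" "0 < B" for x A B
    using order_trans[OF power_mono[OF le[OF that(1)], of 2] young_square[OF that(2,3)]] by simp
  have iw: "integrable M (\<lambda>x. (norm (w x))\<^sup>2)"
    by (rule Bochner_Integration.integrable_bound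
        [where f="\<lambda>x. (1 + 1/1) * (norm (u x))\<^sup>2 + (1 + 1/1) * (norm (v x))\<^sup>2"])
      (use le2[of _ 1 1] i in \<open>auto intro!: AE_I2\<close>)
  then show "w \<in> L2 M" by (simp add: L2_def)
  define A B where "A = L2_norm M u" and "B = L2_norm M v"
  have AB: "A \<ge> 0" "B \<ge> 0" "A\<^sup>2 = U" "B\<^sup>2 = V"
    by (simp_all add: A_def B_def L2_norm_nonneg L2_norm_power2 U_def V_def)
  show "L2_norm M w \<le> L2_norm M u + L2_norm M v"
  proof (rule field_le_epsilon)
    fix \<epsilon> :: real assume "\<epsilon> > 0"
    define A' B' where "A' = A + \<epsilon>/2" and "B' = B + \<epsilon>/2"
    have p: "A' > 0" "B' > 0" using AB \<open>\<epsilon> > 0\<close> by (auto simp: A'_def B'_def)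
    have "(L2_norm M w)\<^sup>2 \<le> (\<integral>x. (1 + B' / A') * (norm (u x))\<^sup>2 + (1 + A' / B') * (norm (v x))\<^sup>2 \<partial>M)"
      unfolding L2_norm_power2 using i iw le2[OF _ p] by (intro integral_mono) auto
    also have "\<dots> = (1 + B' / A') * A\<^sup>2 + (1 + A' / B') * B\<^sup>2"
      using i by (simp add: AB U_def V_def)
    also have "\<dots> \<le> (1 + B' / A') * A'\<^sup>2 + (1 + A' / B') * B'\<^sup>2"
      using AB p \<open>\<epsilon> > 0\<close> by (intro add_mono mult_left_mono power_mono) (auto simp: A'_def B'_def)
    also have "\<dots> = (A' + B')\<^sup>2" using p by (simp add: field_simps power2_eq_square)
    finally show "L2_norm M w \<le> L2_norm M u + L2_norm M v + \<epsilon>"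
      using p power2_le_imp_le[of "L2_norm M w" "A' + B'"] by (simp add: A'_def B'_def A_def B_def)
  qed
qed

lemma L2_add: 
  fixes u v :: "'a \<Rightarrow> 'b::euclidean_space"
  assumes "u \<in> L2 M" "v \<in> L2 M" 
  shows "(\<lambda>x. u x + v x) \<in> L2 M" "L2_norm M (\<lambda>x. u x + v x) \<le> L2_norm M u + L2_norm M v"
  using L2_triangle[OF assms, of "\<lambda>x. u x + v x"] L2_measurable[OF assms(1)] L2_measurable[OF assms(2)]
  by (auto simp: norm_triangle_ineq)

lemma L2_diff: 
  fixes u v :: "'a \<Rightarrow> 'b::euclidean_space"
  assumes "u \<in> L2 M" "v \<in> L2 M" 
  shows "(\<lambda>x. u x - v x) \<in> L2 M" "L2_norm M (\<lambda>x. u x - v x) \<le> L2_norm M u + L2_norm M v"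
  using L2_triangle[OF assms, of "\<lambda>x. u x - v x"] L2_measurable[OF assms(1)] L2_measurable[OF assms(2)]
  by (auto simp: norm_triangle_ineq4)

lemma L2_norm_minus: "L2_norm M (\<lambda>x. u x - v x) = L2_norm M (\<lambda>x. v x - u x)"
  by (rule L2_norm_cong) (simp add: norm_minus_commute)

lemma L2_norm_diff_le:
  fixes u v :: "'a \<Rightarrow> 'b::euclidean_space"
  assumes "u \<in> L2 M" "v \<in> L2 M" 
  shows "\<bar>L2_norm M u - L2_norm M v\<bar> \<le> L2_norm M (\<lambda>x. u x - v x)"
  using L2_add(2)[OF L2_diff(1)[OF assms] assms(2)] L2_add(2)[OF L2_diff(1)[OF assms(2,1)] assms(1)]
   L2_norm_minus[of M u v] by simp

lemma L2_norm_tendsto: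
  fixes u :: "'a \<Rightarrow> 'b::euclidean_space"
  assumes "u \<in> L2 M" "\<And>n. v n \<in> L2 M" "(\<lambda>n. L2_norm M (\<lambda>x. v n x - u x)) \<longlonglongrightarrow> 0"
  shows "(\<lambda>n. L2_norm M (v n)) \<longlonglongrightarrow> L2_norm M u"
proof (rule Lim_transform[OF tendsto_const])
  show "(\<lambda>n. L2_norm M (v n) - L2_norm M u) \<longlonglongrightarrow> 0"
    by (rule Lim_null_comparison[OF always_eventually assms(3)])
       (use L2_norm_diff_le[OF assms(2,1)] in auto)
qed

text \<open>Integrals over a domain become integrals over the whole space of the extension by zero, where translations
and Fubini's theorem are available.\<close>

lemma restrict_lborel_simps:
  fixes f :: "'a::euclidean_space \<Rightarrow> 'b::euclidean_space"
  assumes "open D"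
  shows "integrable (leb D) f \<longleftrightarrow> integrable lborel (\<lambda>x. indicator D x *\<^sub>R f x)"
    "integral\<^sup>L (leb D) f = integral\<^sup>L lborel (\<lambda>x. indicator D x *\<^sub>R f x)"
    "f \<in> borel_measurable (leb D) \<longleftrightarrow> (\<lambda>x. indicator D x *\<^sub>R f x) \<in> borel_measurable borel"
  using assms by (simp_all add: integrable_restrict_space integral_restrict_space borel_measurable_restrict_space_iff)

lemma L2_leb:
  fixes f :: "'a::euclidean_space \<Rightarrow> 'b::euclidean_space"
  assumes "open D"
  shows "f \<in> L2 (leb D) \<longleftrightarrow> (\<lambda>x. indicator D x *\<^sub>R f x) \<in> L2 lborel"
    "L2_norm (leb D) f = L2_norm lborel (\<lambda>x. indicator D x *\<^sub>R f x)"
proof -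
  have e: "(\<lambda>x. (norm (indicator D x *\<^sub>R f x))\<^sup>2) = (\<lambda>x. indicator D x *\<^sub>R (norm (f x))\<^sup>2)"
    by (auto simp: indicator_def)
  show "f \<in> L2 (leb D) \<longleftrightarrow> (\<lambda>x. indicator D x *\<^sub>R f x) \<in> L2 lborel"
    unfolding L2_def mem_Collect_eq e using assms by (simp add: restrict_lborel_simps)
  show "L2_norm (leb D) f = L2_norm lborel (\<lambda>x. indicator D x *\<^sub>R f x)"
    unfolding L2_norm_def e using assms by (simp add: restrict_lborel_simps)
qed

lemma integrable_compact_support:
  fixes f :: "'a::euclidean_space \<Rightarrow> real"
  assumes "compact S" "continuous_on UNIV f" "\<And>x. x \<notin> S \<Longrightarrow> f x = 0"
  shows "integrable lborel f"
proof -
  have "(\<lambda>x. indicator S x *\<^sub>R f x) = f" using assms(3) by (force simp: indicator_def)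
  then show ?thesis
    using borel_integrable_compact[OF assms(1) continuous_on_subset[OF assms(2)]] by simp
qed

lemma continuous_imp_borel: "continuous_on UNIV (f :: 'a::topological_space \<Rightarrow> 'b::topological_space) \<Longrightarrow> f \<in> borel_measurable borel"
  by (rule borel_measurable_continuous_onI)

lemma smooth_borel: "smooth f \<Longrightarrow> f \<in> borel_measurable borel"
  by (intro continuous_imp_borel smooth_continuous)

lemma test_functions_integrable: 
  assumes "f \<in> test_functions UNIV" shows "integrable lborel f"
  using assms by (metis test_functionsE integrable_compact_support smooth_continuous)

lemma test_functions_L2:
  assumes "f \<in> test_functions UNIV" shows "f \<in> L2 lborel"
proof -
  have "(\<lambda>x. f x * f x) \<in> test_functions UNIV"
    using assms by (metis test_functions_mult test_functionsE)
  from test_functions_integrable[OF this] show ?thesis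
    using assms unfolding L2_def by (auto elim!: test_functionsE intro: smooth_borel simp: power2_eq_square[symmetric])
qed

lemma L2_restrict:
  fixes f :: "'a::euclidean_space \<Rightarrow> 'b::euclidean_space"
  assumes "open D" "f \<in> L2 lborel" shows "f \<in> L2 (leb D)" "L2_norm (leb D) f \<le> L2_norm lborel f"
proof -
  have "f \<in> borel_measurable borel" using L2_measurable[OF assms(2)] by simp
  moreover have "D \<in> sets borel" using assms(1) by auto
  ultimately have [measurable]: "(\<lambda>x. indicator D x *\<^sub>R f x) \<in> borel_measurable borel"
    by (intro borel_measurable_scaleR borel_measurable_indicator)
  have m: "(\<lambda>x. indicator D x *\<^sub>R f x) \<in> borel_measurable lborel" by simp
  show "f \<in> L2 (leb D)" "L2_norm (leb D) f \<le> L2_norm lborel f"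
    unfolding L2_leb[OF assms(1)]
    using L2_mono[OF assms(2) m, of 1] by (auto simp: indicator_le_1 mult_left_le_one_le)
qed

lemma test_functions_bounded:
  assumes "f \<in> test_functions UNIV" shows "\<exists>B\<ge>0. \<forall>x. \<bar>f x\<bar> \<le> B"
proof -
  obtain S where S: "smooth f" "compact S" "\<And>x. x \<notin> S \<Longrightarrow> f x = 0" using assms by (metis test_functionsE)
  have "bounded (f ` S)" using S by (intro compact_imp_bounded compact_continuous_image smooth_continuous)
  then obtain B where B: "\<And>x. x \<in> S \<Longrightarrow> \<bar>f x\<bar> \<le> B" by (auto simp: bounded_iff)
  then have "\<bar>f x\<bar> \<le> max 0 B" for x using S(3)[of x] by (cases "x \<in> S") (auto simp: max.coboundedI2)
  then show ?thesis by (intro exI[of _ "max 0 B"]) auto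
qed

lemma L2_times_test_integrable:
  fixes u \<eta> :: "'a::euclidean_space \<Rightarrow> real"
  assumes "u \<in> L2 lborel" "\<eta> \<in> test_functions UNIV"
  shows "integrable lborel (\<lambda>x. u x * \<eta> x)"
proof (rule Bochner_Integration.integrable_bound)
  show "integrable lborel (\<lambda>x. (norm (u x))\<^sup>2 + (norm (\<eta> x))\<^sup>2)"
    using L2_integrable[OF assms(1)] L2_integrable[OF test_functions_L2[OF assms(2)]] by simp
  show "(\<lambda>x. u x * \<eta> x) \<in> borel_measurable lborel"
    using L2_measurable[OF assms(1)] L2_measurable[OF test_functions_L2[OF assms(2)]] by simp
  show "AE x in lborel. norm (u x * \<eta> x) \<le> norm ((norm (u x))\<^sup>2 + (norm (\<eta> x))\<^sup>2)"
  proof (rule AE_I2)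
    fix x
    have "2 * (\<bar>u x\<bar> * \<bar>\<eta> x\<bar>) \<le> \<bar>u x\<bar>\<^sup>2 + \<bar>\<eta> x\<bar>\<^sup>2"
      using sum_squares_bound[of "\<bar>u x\<bar>" "\<bar>\<eta> x\<bar>"] by simp
    moreover have "0 \<le> \<bar>u x\<bar> * \<bar>\<eta> x\<bar>" by simp
    ultimately have "\<bar>u x\<bar> * \<bar>\<eta> x\<bar> \<le> \<bar>u x\<bar>\<^sup>2 + \<bar>\<eta> x\<bar>\<^sup>2" by linarith
    then show "norm (u x * \<eta> x) \<le> norm ((norm (u x))\<^sup>2 + (norm (\<eta> x))\<^sup>2)"
      by (simp add: abs_mult)
  qed
qed

section \<open>Continuity of translations and mollification\<close>

lemma integrable_translate:
  fixes f :: "'a::euclidean_space \<Rightarrow> real"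
  assumes "integrable lborel f" 
  shows "integrable lborel (\<lambda>x. f (x + h))" "(\<integral>x. f (x + h) \<partial>lborel) = (\<integral>x. f x \<partial>lborel)"
proof -
  have [measurable]: "f \<in> borel_measurable borel" using assms by auto
  have "integrable (distr lborel borel ((+) h)) f" using assms by (simp add: lborel_distr_plus)
  then show "integrable lborel (\<lambda>x. f (x + h))" by (simp add: integrable_distr_eq add.commute)
  have "(\<integral>x. f x \<partial>lborel) = (\<integral>x. f x \<partial>distr lborel borel ((+) h))" by (simp add: lborel_distr_plus)
  also have "\<dots> = (\<integral>x. f (x + h) \<partial>lborel)" by (subst integral_distr) (simp_all add: add.commute)
  finally show "(\<integral>x. f (x + h) \<partial>lborel) = (\<integral>x. f x \<partial>lborel)" by simp
qed

text \<open>Continuity of translations in the \<open>L\<^sup>1\<close> mean.\<close>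

definition translation_continuous :: "('a::euclidean_space \<Rightarrow> real) \<Rightarrow> bool" where
  "translation_continuous f \<longleftrightarrow> (\<forall>\<epsilon>>0. \<exists>d>0. \<forall>h. norm h < d \<longrightarrow> (\<integral>x. \<bar>f (x + h) - f x\<bar> \<partial>lborel) < \<epsilon>)"

lemma translation_continuousE:
  assumes "translation_continuous f" "\<epsilon> > 0"
  obtains d where "d > 0" "\<And>h. norm h < d \<Longrightarrow> (\<integral>x. \<bar>f (x + h) - f x\<bar> \<partial>lborel) < \<epsilon>"
  using assms unfolding translation_continuous_def by metis

text \<open>Squeeze the set between a compact set \<open>K\<close> and an open set \<open>U\<close> of almost the same measure. A
translation shorter than the distance of \<open>K\<close> from the complement of \<open>U\<close> moves points of \<open>K\<close> inside \<open>U\<close>, so the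
indicator changes only at points which lie, before or after the translation, in \<open>U - K\<close>.\<close>

lemma translation_continuous_indicator:
  fixes A :: "'a::euclidean_space set"
  assumes A: "A \<in> sets borel" "emeasure lborel A < \<infinity>"
  shows "translation_continuous (\<lambda>x. indicator A x * c)"
  unfolding translation_continuous_def
proof (intro allI impI)
  fix \<epsilon> :: real assume "\<epsilon> > 0"
  define r where "r = \<epsilon> / (4 * (\<bar>c\<bar> + 1))"
  have r: "r > 0" using \<open>\<epsilon> > 0\<close> by (simp add: r_def)
  define N :: "'a measure" where "N = density lborel (indicator A)"
  have N: "emeasure N B = emeasure lborel (A \<inter> B)" if "B \<in> sets borel" for B
    using that A(1) by (simp add: N_def emeasure_density indicator_inter_arith[symmetric] nn_integral_set_ennreal)
  have "emeasure N A = (SUP K \<in> {K. K \<subseteq> A \<and> compact K}. emeasure N K)"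
    using A N[of UNIV] by (intro inner_regular) (auto simp: N_def)
  moreover have "emeasure lborel A - ennreal r < emeasure lborel A" if "emeasure lborel A > 0"
    using A(2) r that by (intro ennreal_between) auto
  ultimately have "\<exists>K\<in>{K. K \<subseteq> A \<and> compact K}. emeasure lborel A - ennreal r < emeasure N K" if "emeasure lborel A > 0"
    using that A(1) N[of A] less_SUP_iff[of "emeasure lborel A - ennreal r" "emeasure N" "{K. K \<subseteq> A \<and> compact K}"]
    by auto
  then have "\<exists>K. K \<subseteq> A \<and> compact K \<and> emeasure lborel A \<le> emeasure lborel K + r"
  proof (cases "emeasure lborel A > 0")
    case True
    then obtain K where K: "K \<subseteq> A" "compact K" "emeasure lborel A - ennreal r < emeasure N K"
      using \<open>_ \<Longrightarrow> \<exists>K\<in>_. _\<close> by auto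
    have "emeasure N K = emeasure lborel K" using K by (subst N) (auto simp: borel_compact inf.absorb2)
    then show ?thesis using K 
      by (intro exI[of _ K]) (metis ennreal_minus_le_iff less_imp_le add.commute)
  next
    case False
    then show ?thesis by (intro exI[of _ "{}"]) auto
  qed
  then obtain K where K: "K \<subseteq> A" "compact K" "emeasure lborel A \<le> emeasure lborel K + r" by blast
  obtain U where U: "open U" "A \<subseteq> U" "emeasure lborel (U - A) < r"
    using outer_regular_lborel[OF A(1) r] by metis
  have [measurable]: "K \<in> sets borel" "U \<in> sets borel" "A \<in> sets borel"
    using K U A by (auto simp: borel_compact)
  have Kf: "emeasure lborel K < \<infinity>" using K(2) by (rule emeasure_compact_finite)
  have "emeasure lborel (U - K) = emeasure lborel ((U - A) \<union> (A - K))"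
    using U K by (intro arg_cong[where f="emeasure lborel"]) auto
  also have "\<dots> \<le> emeasure lborel (U - A) + emeasure lborel (A - K)"
    by (rule emeasure_subadditive) auto
  also have "\<dots> \<le> ennreal r + ennreal r"
  proof (intro add_mono)
    show "emeasure lborel (U - A) \<le> ennreal r" using U(3) by (rule less_imp_le)
    have "emeasure lborel (A - K) = emeasure lborel A - emeasure lborel K"
      using K Kf by (intro emeasure_Diff) auto
    also have "\<dots> \<le> ennreal r"
      by (rule iffD2[OF ennreal_minus_le_iff]) (use K(3) Kf in auto)
    finally show "emeasure lborel (A - K) \<le> ennreal r" .
  qed
  also have "\<dots> = ennreal (2 * r)" using r by (simp add: ennreal_plus[symmetric] del: ennreal_plus)
  finally have UK: "emeasure lborel (U - K) \<le> ennreal (2 * r)" .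
  then have UKf: "emeasure lborel (U - K) < \<infinity>" by (metis ennreal_less_top infinity_ennreal_def le_less_trans)
  have UKm: "measure lborel (U - K) \<le> 2 * r"
    using UK r by (simp add: measure_def enn2real_leI)
  obtain d where d: "d > 0" "\<forall>x\<in>K. \<forall>y\<in>-U. d \<le> dist x y"
    using separate_compact_closed[of K "-U"] K U by auto
  define i :: "'a \<Rightarrow> real" where "i = indicator (U - K)"
  have ii: "integrable lborel i" "(\<integral>x. i x \<partial>lborel) \<le> 2 * r"
    using UKf UKm by (auto simp: i_def)
  show "\<exists>d>0. \<forall>h. norm h < d \<longrightarrow> (\<integral>x. \<bar>indicator A (x + h) * c - indicator A x * c\<bar> \<partial>lborel) < \<epsilon>"
  proof (intro exI conjI allI impI)
    show "d > 0" by fact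
    fix h :: 'a assume h: "norm h < d"
    have nb: "x + h \<in> U" if "x \<in> K" for x
    proof (rule ccontr)
      assume "x + h \<notin> U"
      then have "d \<le> dist x (x + h)" using d(2) that by blast
      then show False using h by (simp add: dist_norm)
    qed
    have nb2: "x \<in> U" if "x + h \<in> K" for x
    proof (rule ccontr)
      assume "x \<notin> U"
      then have "d \<le> dist (x + h) x" using d(2) that by blast
      then show False using h by (simp add: dist_norm)
    qed
    have "(\<integral>x. \<bar>indicator A (x + h) * c - indicator A x * c\<bar> \<partial>lborel) \<le> (\<integral>x. \<bar>c\<bar> * (i (x + h) + i x) \<partial>lborel)"
    proof (rule integral_mono')
      show "integrable lborel (\<lambda>x. \<bar>c\<bar> * (i (x + h) + i x))" using integrable_translate[OF ii(1)] ii by simp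
      fix x
      have "\<bar>indicator A (x + h) - indicator A x :: real\<bar> \<le> i (x + h) + i x"
        using nb[of x] nb2[of x] K U by (auto simp: i_def indicator_def)
      then have "\<bar>c\<bar> * \<bar>indicator A (x + h) - indicator A x :: real\<bar> \<le> \<bar>c\<bar> * (i (x + h) + i x)"
        by (rule mult_left_mono) simp
      then show "\<bar>indicator A (x + h) * c - indicator A x * c\<bar> \<le> \<bar>c\<bar> * (i (x + h) + i x)"
        by (simp add: abs_mult[symmetric] right_diff_distrib mult.commute)
    qed (simp add: i_def)
    also have "\<dots> = \<bar>c\<bar> * (2 * (\<integral>x. i x \<partial>lborel))"
      using ii integrable_translate[OF ii(1)] by simp
    also have "\<dots> \<le> \<bar>c\<bar> * (4 * r)" using ii(2) by (intro mult_left_mono) auto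
    also have "\<dots> < (\<bar>c\<bar> + 1) * (4 * r)" using r by simp
    also have "\<dots> = \<epsilon>" by (simp add: r_def field_simps)
    finally show "(\<integral>x. \<bar>indicator A (x + h) * c - indicator A x * c\<bar> \<partial>lborel) < \<epsilon>" .
  qed
qed

lemma translation_continuous_integrable:
  fixes f :: "'a::euclidean_space \<Rightarrow> real"
  assumes "integrable lborel f" shows "translation_continuous f"
  using assms
proof (induction rule: integrable_induct)
  case (base A c)
  then show ?case using translation_continuous_indicator[of A c] by simp
next
  case (add f g)
  show ?case unfolding translation_continuous_def
  proof (intro allI impI)
    fix \<epsilon> :: real assume "\<epsilon> > 0"
    then have "\<epsilon>/2 > 0" by simp
    obtain d1 where d1: "d1 > 0" "\<And>h. norm h < d1 \<Longrightarrow> (\<integral>x. \<bar>f (x + h) - f x\<bar> \<partial>lborel) < \<epsilon>/2"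
      using translation_continuousE[OF add.IH(1) \<open>\<epsilon>/2 > 0\<close>] by metis
    obtain d2 where d2: "d2 > 0" "\<And>h. norm h < d2 \<Longrightarrow> (\<integral>x. \<bar>g (x + h) - g x\<bar> \<partial>lborel) < \<epsilon>/2"
      using translation_continuousE[OF add.IH(2) \<open>\<epsilon>/2 > 0\<close>] by metis
    show "\<exists>d>0. \<forall>h. norm h < d \<longrightarrow> (\<integral>x. \<bar>f (x + h) + g (x + h) - (f x + g x)\<bar> \<partial>lborel) < \<epsilon>"
    proof (intro exI[of _ "min d1 d2"] conjI allI impI)
      fix h :: 'a assume h: "norm h < min d1 d2"
      have "(\<integral>x. \<bar>f (x + h) + g (x + h) - (f x + g x)\<bar> \<partial>lborel)
        \<le> (\<integral>x. \<bar>f (x + h) - f x\<bar> + \<bar>g (x + h) - g x\<bar> \<partial>lborel)"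
        using add.hyps integrable_translate[OF add.hyps(1)] integrable_translate[OF add.hyps(2)]
        by (intro integral_mono') auto
      also have "\<dots> = (\<integral>x. \<bar>f (x + h) - f x\<bar> \<partial>lborel) + (\<integral>x. \<bar>g (x + h) - g x\<bar> \<partial>lborel)"
        using add.hyps integrable_translate[OF add.hyps(1)] integrable_translate[OF add.hyps(2)] by simp
      finally show "(\<integral>x. \<bar>f (x + h) + g (x + h) - (f x + g x)\<bar> \<partial>lborel) < \<epsilon>"
        using d1(2)[of h] d2(2)[of h] h by simp
    qed (use d1 d2 in auto)
  qed
next
  case (lim f s)
  have "(\<lambda>i. \<integral>x. \<bar>s i x - f x\<bar> \<partial>lborel) \<longlonglongrightarrow> (\<integral>x. 0 \<partial>(lborel :: 'a measure))"
  proof (rule integral_dominated_convergence[where w="\<lambda>x. 3 * \<bar>f x\<bar>"])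
    have [measurable]: "f \<in> borel_measurable borel" "\<And>i. s i \<in> borel_measurable borel" 
      using lim.hyps(1,4) by (auto dest: borel_measurable_integrable)
    show "(\<lambda>x. \<bar>s i x - f x\<bar>) \<in> borel_measurable lborel" for i by measurable
    show "AE x in lborel. (\<lambda>i. \<bar>s i x - f x\<bar>) \<longlonglongrightarrow> 0"
    proof (rule AE_I2)
      fix x :: 'a 
      have "(\<lambda>i. \<bar>s i x - f x\<bar>) \<longlonglongrightarrow> \<bar>f x - f x\<bar>" using lim.hyps(2)[of x] by (intro tendsto_intros) auto
      then show "(\<lambda>i. \<bar>s i x - f x\<bar>) \<longlonglongrightarrow> 0" by simp
    qed
    show "AE x in lborel. norm \<bar>s i x - f x\<bar> \<le> 3 * \<bar>f x\<bar>" for i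
    proof (rule AE_I2)
      fix x :: 'a show "norm \<bar>s i x - f x\<bar> \<le> 3 * \<bar>f x\<bar>"
        using lim.hyps(3)[of x i] by simp
    qed
  qed (use lim.hyps(4) in simp_all)
  then have conv: "(\<lambda>i. \<integral>x. \<bar>s i x - f x\<bar> \<partial>lborel) \<longlonglongrightarrow> 0" by simp
  show ?case unfolding translation_continuous_def
  proof (intro allI impI)
    fix \<epsilon> :: real assume "\<epsilon> > 0"
    then have "\<epsilon>/3 > 0" by simp
    obtain i where i: "(\<integral>x. \<bar>s i x - f x\<bar> \<partial>lborel) < \<epsilon>/3"
      using order_tendstoD(2)[OF conv \<open>\<epsilon>/3 > 0\<close>] by (auto simp: eventually_sequentially)
    obtain d where d: "d > 0" "\<And>h. norm h < d \<Longrightarrow> (\<integral>x. \<bar>s i (x + h) - s i x\<bar> \<partial>lborel) < \<epsilon>/3"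
      using translation_continuousE[OF lim.IH[of i] \<open>\<epsilon>/3 > 0\<close>] by metis
    have j: "integrable lborel (\<lambda>x. \<bar>s i x - f x\<bar>)" using lim.hyps(1,4) by simp
    show "\<exists>d>0. \<forall>h. norm h < d \<longrightarrow> (\<integral>x. \<bar>f (x + h) - f x\<bar> \<partial>lborel) < \<epsilon>"
    proof (intro exI[of _ d] conjI allI impI)
      fix h :: 'a assume h: "norm h < d"
      note k = integrable_translate[OF lim.hyps(1)[of i], of h] integrable_translate[OF lim.hyps(4), of h]
      have "(\<integral>x. \<bar>f (x + h) - f x\<bar> \<partial>lborel) \<le>
        (\<integral>x. \<bar>s i (x + h) - f (x + h)\<bar> + \<bar>s i (x + h) - s i x\<bar> + \<bar>s i x - f x\<bar> \<partial>lborel)"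
        using lim.hyps(1,4) k by (intro integral_mono') auto
      also have "\<dots> = (\<integral>x. \<bar>s i (x + h) - f (x + h)\<bar> \<partial>lborel) + (\<integral>x. \<bar>s i (x + h) - s i x\<bar> \<partial>lborel) + (\<integral>x. \<bar>s i x - f x\<bar> \<partial>lborel)"
        using lim.hyps(1,4) k by simp
      finally show "(\<integral>x. \<bar>f (x + h) - f x\<bar> \<partial>lborel) < \<epsilon>"
        using d(2)[OF h] i integrable_translate(2)[OF j, of h] by simp
    qed fact
  qed
qed

text \<open>Square-integrable functions are reduced to integrable ones: if \<open>u\<close> is in \<open>L\<^sup>2\<close>, then
\<open>v = u \<bar>u\<bar>\<close> is in \<open>L\<^sup>1\<close>, and the squared distance of translates of \<open>u\<close> is at most twice the distance of those
of \<open>v\<close>.\<close>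

lemma diff_square_le: "(a - b :: real)\<^sup>2 \<le> 2 * \<bar>a * \<bar>a\<bar> - b * \<bar>b\<bar>\<bar>"
proof -
  have key: "(a - b)\<^sup>2 \<le> 2 * \<bar>a * \<bar>a\<bar> - b * \<bar>b\<bar>\<bar>" if "b \<le> a" "0 \<le> a" for a b :: real
  proof (cases "0 \<le> b")
    case True
    have "(a - b) * (a - b) \<le> (a - b) * (a + b)" using that True by (intro mult_left_mono) auto
    moreover have "(a - b) * (a + b) = a * a - b * b" by (simp add: algebra_simps)
    moreover have "0 \<le> (a - b) * (a + b)" using that True by simp
    ultimately show ?thesis using True that by (simp add: power2_eq_square)
  next
    case False
    have "(a - b)\<^sup>2 + (a + b)\<^sup>2 = 2 * (a * a + b * b)" by (simp add: power2_eq_square algebra_simps)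
    moreover have "0 \<le> (a + b)\<^sup>2" by simp
    ultimately have "(a - b)\<^sup>2 \<le> 2 * (a * a + b * b)" by linarith
    then show ?thesis using False that by (simp add: abs_of_neg)
  qed
  consider "b \<le> a" "0 \<le> a" | "a \<le> b" "0 \<le> b" | "b \<le> a" "a \<le> 0" | "a \<le> b" "b \<le> 0" by linarith
  then show ?thesis
  proof cases
    case 2
    then show ?thesis using key[of a b] by (metis power2_commute abs_minus_commute)
  next
    case 3
    then have "(- b - - a)\<^sup>2 \<le> 2 * \<bar>(- b) * \<bar>- b\<bar> - (- a) * \<bar>- a\<bar>\<bar>" by (intro key) auto
    moreover have "(- b - - a)\<^sup>2 = (a - b)\<^sup>2" by (simp add: power2_eq_square algebra_simps)
    ultimately show ?thesis by (simp add: algebra_simps)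
  next
    case 4
    then have "(- a - - b)\<^sup>2 \<le> 2 * \<bar>(- a) * \<bar>- a\<bar> - (- b) * \<bar>- b\<bar>\<bar>" by (intro key) auto
    moreover have "(- a - - b)\<^sup>2 = (a - b)\<^sup>2" by (simp add: power2_eq_square algebra_simps)
    moreover have "(- a) * \<bar>- a\<bar> - (- b) * \<bar>- b\<bar> = - (a * \<bar>a\<bar> - b * \<bar>b\<bar>)" by simp
    ultimately show ?thesis by (simp only: abs_minus_cancel)
  qed (rule key)
qed

definition mollifier_mass :: "'a::euclidean_space itself \<Rightarrow> real" where
  "mollifier_mass _ = (\<integral>z. box_bump (z::'a) \<partial>lborel)"

text \<open>The support lies in the cube with all coordinates in \<open>[1, 2]\<close>. Averaging \<open>u (x + \<epsilon> z)\<close> with this weight only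
uses points strictly further inside the half-space than \<open>x\<close>, for every coordinate direction at once.\<close>

definition mollifier :: "'a::euclidean_space \<Rightarrow> real" where
  "mollifier z = box_bump (z - One) / mollifier_mass TYPE('a)"

lemma box_bump_test: "(box_bump :: 'a::euclidean_space \<Rightarrow> real) \<in> test_functions UNIV"
  by (rule test_functionsI[OF smooth_box_bump, of "cbox 0 One"]) (auto simp: box_bump_zero)

lemma mollifier_mass_pos: "mollifier_mass TYPE('a::euclidean_space) > 0"
proof -
  have i: "integrable lborel (box_bump :: 'a \<Rightarrow> real)" by (rule test_functions_integrable[OF box_bump_test])
  have "mollifier_mass TYPE('a) \<noteq> 0"
  proof
    assume "mollifier_mass TYPE('a) = 0"
    then have "AE z in lborel. box_bump (z::'a) = 0"
      using integral_nonneg_eq_0_iff_AE[OF i] by (simp add: mollifier_mass_def box_bump_nonneg)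
    then have "AE z in lborel. (z::'a) \<notin> box 0 One"
      by (rule AE_mp) (auto intro!: AE_I2 dest: box_bump_pos)
    then have "emeasure lborel (box 0 (One::'a)) = 0"
      by (subst (asm) AE_iff_measurable[of "box 0 One"]) auto
    then show False by (simp add: emeasure_lborel_box_eq)
  qed
  moreover have "mollifier_mass TYPE('a) \<ge> 0" by (simp add: mollifier_mass_def box_bump_nonneg)
  ultimately show ?thesis by simp
qed

lemma mollifier_nonneg: "mollifier (z :: 'a::euclidean_space) \<ge> 0"
  using mollifier_mass_pos[where 'a='a] by (simp add: mollifier_def box_bump_nonneg)

lemma smooth_mollifier: "smooth (mollifier :: 'a::euclidean_space \<Rightarrow> real)"
proof -
  have "smooth (\<lambda>z::'a. (1 / mollifier_mass TYPE('a)) * box_bump (z + - One))"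
    by (intro smooth_mult smooth_const smooth_affine[where A="\<lambda>z. z"] smooth_box_bump bounded_linear_ident)
  then show ?thesis by (simp add: mollifier_def[abs_def])
qed

lemma mollifier_zero: "z \<notin> cbox One (2 *\<^sub>R One) \<Longrightarrow> mollifier z = 0"
  unfolding mollifier_def by (subst box_bump_zero) (auto simp: mem_box inner_diff_left)

lemma mollifier_test: "mollifier \<in> test_functions (UNIV :: 'a::euclidean_space set)"
  by (rule test_functionsI[OF smooth_mollifier, of "cbox One (2 *\<^sub>R One)"]) (auto simp: mollifier_zero)

lemma mollifier_integrable: "integrable lborel (mollifier :: 'a::euclidean_space \<Rightarrow> real)"
  by (rule test_functions_integrable[OF mollifier_test])

lemma mollifier_integral: "(\<integral>z. mollifier (z::'a::euclidean_space) \<partial>lborel) = 1"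
proof -
  have "(\<integral>z. mollifier (z::'a) \<partial>lborel) = (\<integral>z. box_bump (z + - One::'a) \<partial>lborel) / mollifier_mass TYPE('a)"
    by (simp add: mollifier_def)
  also have "\<dots> = 1" using mollifier_mass_pos[where 'a='a]
    by (subst integrable_translate) (auto simp: mollifier_mass_def test_functions_integrable[OF box_bump_test])
  finally show ?thesis .
qed

lemma mollifier_support_bounded: "\<exists>R>0. \<forall>z::'a::euclidean_space. mollifier z \<noteq> 0 \<longrightarrow> norm z \<le> R"
proof -
  obtain R where "\<forall>z \<in> cbox One (2 *\<^sub>R (One::'a)). norm z \<le> R"
    using bounded_cbox bounded_iff by blast
  then show ?thesis using mollifier_zero by (intro exI[of _ "max R 1"]) (force simp: max.coboundedI1)
qed

definition mollify :: "real \<Rightarrow> ('a::euclidean_space \<Rightarrow> real) \<Rightarrow> 'a \<Rightarrow> real" where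
  "mollify \<epsilon> u x = (\<integral>z. mollifier z * u (x + \<epsilon> *\<^sub>R z) \<partial>lborel)"

text \<open>Jensen's inequality for a probability density \<open>k\<close>, from the variance
\<open>\<integral> k (w - m)\<^sup>2 \<ge> 0\<close>, where \<open>m = \<integral> k w\<close>.\<close>

lemma jensen_square:
  fixes k w :: "'a \<Rightarrow> real"
  assumes k: "integrable M k" "\<And>x. 0 \<le> k x" "(\<integral>x. k x \<partial>M) = 1"
    and w: "integrable M (\<lambda>x. k x * (w x)\<^sup>2)" "w \<in> borel_measurable M"
  shows "integrable M (\<lambda>x. k x * w x)" "(\<integral>x. k x * w x \<partial>M)\<^sup>2 \<le> (\<integral>x. k x * (w x)\<^sup>2 \<partial>M)"
proof -
  show i: "integrable M (\<lambda>x. k x * w x)"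
  proof (rule Bochner_Integration.integrable_bound)
    show "integrable M (\<lambda>x. k x + k x * (w x)\<^sup>2)" using k w by simp
    show "(\<lambda>x. k x * w x) \<in> borel_measurable M" using k w by simp
    have "\<bar>k x * w x\<bar> \<le> k x + k x * (w x)\<^sup>2" for x
    proof -
      have "2 * (1 * \<bar>w x\<bar>) \<le> 1 + (w x)\<^sup>2" using sum_squares_bound[of 1 "\<bar>w x\<bar>"] by simp
      then have "\<bar>w x\<bar> \<le> 1 + (w x)\<^sup>2" by linarith
      from mult_left_mono[OF this k(2)[of x]] show ?thesis using k(2)[of x] by (simp add: abs_mult distrib_left)
    qed
    then show "AE x in M. norm (k x * w x) \<le> norm (k x + k x * (w x)\<^sup>2)"
      by (auto intro!: AE_I2 order_trans[OF _ abs_ge_self])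
  qed
  define m where "m = (\<integral>x. k x * w x \<partial>M)"
  have "0 \<le> (\<integral>x. k x * (w x - m)\<^sup>2 \<partial>M)" using k(2) by (intro Bochner_Integration.integral_nonneg) auto
  also have "\<dots> = (\<integral>x. k x * (w x)\<^sup>2 - 2 * m * (k x * w x) + m\<^sup>2 * k x \<partial>M)"
    by (rule Bochner_Integration.integral_cong) (auto simp: power2_eq_square algebra_simps)
  also have "\<dots> = (\<integral>x. k x * (w x)\<^sup>2 \<partial>M) - m\<^sup>2"
    using k w i by (simp add: m_def[symmetric] power2_eq_square)
  finally show "(\<integral>x. k x * w x \<partial>M)\<^sup>2 \<le> (\<integral>x. k x * (w x)\<^sup>2 \<partial>M)" by (simp add: m_def)
qed

text \<open>Jensen's inequality bounds the squared error at \<open>x\<close> by an average of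
\<open>(u (x + \<epsilon> z) - u x)\<^sup>2\<close> over \<open>z\<close>. After exchanging the integrals, \<open>diff_square_le\<close> bounds the inner
integral over \<open>x\<close> by the mean distance of two translates.\<close>

lemma mollify_L2_le:
  fixes u :: "'a::euclidean_space \<Rightarrow> real"
  assumes u: "u \<in> L2 lborel" and "\<delta> \<ge> 0" 
    and small: "\<And>z. mollifier (z::'a) \<noteq> 0 \<Longrightarrow> (\<integral>x. \<bar>u (x + \<epsilon> *\<^sub>R z) * \<bar>u (x + \<epsilon> *\<^sub>R z)\<bar> - u x * \<bar>u x\<bar>\<bar> \<partial>lborel) \<le> \<delta>"
  shows "(\<lambda>x. mollify \<epsilon> u x - u x) \<in> L2 lborel" "(L2_norm lborel (\<lambda>x. mollify \<epsilon> u x - u x))\<^sup>2 \<le> 2 * \<delta>"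
proof -
  have [measurable]: "u \<in> borel_measurable borel" using L2_measurable[OF u] by simp
  have [measurable]: "(mollifier :: 'a \<Rightarrow> real) \<in> borel_measurable borel" by (intro smooth_borel smooth_mollifier)
  define v where "v x = u x * \<bar>u x\<bar>" for x
  have [measurable]: "v \<in> borel_measurable borel" unfolding v_def by measurable
  have v: "integrable lborel v"
    by (rule Bochner_Integration.integrable_bound[OF L2_integrable[OF u]]) (auto simp: v_def abs_mult power2_eq_square)
  have m: "mollify \<epsilon> u \<in> borel_measurable borel"
    unfolding mollify_def by measurable
  have pt: "ennreal ((mollify \<epsilon> u x - u x)\<^sup>2) \<le> (\<integral>\<^sup>+z. ennreal (mollifier z * (u (x + \<epsilon> *\<^sub>R z) - u x)\<^sup>2) \<partial>lborel)" for x
  proof (cases "(\<integral>\<^sup>+z. ennreal (mollifier z * (u (x + \<epsilon> *\<^sub>R z) - u x)\<^sup>2) \<partial>lborel) < \<infinity>")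
    case True
    have i: "integrable lborel (\<lambda>z. mollifier z * (u (x + \<epsilon> *\<^sub>R z) - u x)\<^sup>2)"
      using True by (intro integrableI_nonneg) (auto simp: mollifier_nonneg)
    note J = jensen_square[OF mollifier_integrable mollifier_nonneg mollifier_integral i]
    have j: "integrable lborel (\<lambda>z. mollifier z * (u (x + \<epsilon> *\<^sub>R z) - u x))" by (rule J) simp
    have "integrable lborel (\<lambda>z. mollifier z * (u (x + \<epsilon> *\<^sub>R z) - u x) + mollifier z * u x)"
      using j mollifier_integrable by auto
    then have "integrable lborel (\<lambda>z. mollifier z * u (x + \<epsilon> *\<^sub>R z))" by (simp add: algebra_simps)
    then have "mollify \<epsilon> u x - u x = (\<integral>z. mollifier z * (u (x + \<epsilon> *\<^sub>R z) - u x) \<partial>lborel)"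
      using mollifier_integral[where 'a='a] integrable_mult_left[OF mollifier_integrable, of "u x"]
      unfolding right_diff_distrib by (subst Bochner_Integration.integral_diff) (simp_all add: mollify_def)
    then show ?thesis using J(2) by (subst nn_integral_eq_integral[OF i]) (auto simp: mollifier_nonneg intro!: ennreal_leI)
  next
    case False
    then have "(\<integral>\<^sup>+z. ennreal (mollifier z * (u (x + \<epsilon> *\<^sub>R z) - u x)\<^sup>2) \<partial>lborel) = \<infinity>"
      by (simp add: not_less top_unique)
    then show ?thesis by simp
  qed
  have "(\<integral>\<^sup>+x. ennreal ((mollify \<epsilon> u x - u x)\<^sup>2) \<partial>lborel) \<le>
     (\<integral>\<^sup>+x. (\<integral>\<^sup>+z. ennreal (mollifier z * (u (x + \<epsilon> *\<^sub>R z) - u x)\<^sup>2) \<partial>lborel) \<partial>lborel)"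
    by (intro nn_integral_mono pt)
  also have "\<dots> = (\<integral>\<^sup>+z. (\<integral>\<^sup>+x. ennreal (mollifier z * (u (x + \<epsilon> *\<^sub>R z) - u x)\<^sup>2) \<partial>lborel) \<partial>lborel)"
    by (rule lborel_pair.Fubini') measurable
  also have "\<dots> \<le> (\<integral>\<^sup>+z. ennreal (mollifier (z::'a) * (2 * \<delta>)) \<partial>lborel)"
  proof (intro nn_integral_mono)
    fix z :: 'a
    show "(\<integral>\<^sup>+x. ennreal (mollifier z * (u (x + \<epsilon> *\<^sub>R z) - u x)\<^sup>2) \<partial>lborel) \<le> ennreal (mollifier z * (2 * \<delta>))"
    proof (cases "mollifier z = 0")
      case False
      have iv: "integrable lborel (\<lambda>x. \<bar>v (x + \<epsilon> *\<^sub>R z) - v x\<bar>)" 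
        using integrable_translate(1)[OF v] v by simp
      have "(\<integral>\<^sup>+x. ennreal (mollifier z * (u (x + \<epsilon> *\<^sub>R z) - u x)\<^sup>2) \<partial>lborel) \<le>
         (\<integral>\<^sup>+x. ennreal (mollifier z * (2 * \<bar>v (x + \<epsilon> *\<^sub>R z) - v x\<bar>)) \<partial>lborel)"
        unfolding v_def by (intro nn_integral_mono ennreal_leI mult_left_mono diff_square_le mollifier_nonneg)
      also have "\<dots> = ennreal (\<integral>x. mollifier z * (2 * \<bar>v (x + \<epsilon> *\<^sub>R z) - v x\<bar>) \<partial>lborel)"
        using iv by (intro nn_integral_eq_integral) (auto simp: mollifier_nonneg)
      also have "\<dots> \<le> ennreal (mollifier z * (2 * \<delta>))"
        using small[OF False] unfolding v_def[symmetric] by (auto intro!: ennreal_leI mult_left_mono mollifier_nonneg)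
      finally show ?thesis .
    qed simp
  qed
  also have "\<dots> = ennreal (\<integral>z. mollifier (z::'a) * (2 * \<delta>) \<partial>lborel)"
    using mollifier_integrable \<open>\<delta> \<ge> 0\<close> by (intro nn_integral_eq_integral) (auto simp: mollifier_nonneg)
  also have "\<dots> = ennreal (2 * \<delta>)" by (simp add: mollifier_integral)
  finally have *: "(\<integral>\<^sup>+x. ennreal ((mollify \<epsilon> u x - u x)\<^sup>2) \<partial>lborel) \<le> ennreal (2 * \<delta>)" .
  then have "integrable lborel (\<lambda>x. (mollify \<epsilon> u x - u x)\<^sup>2)"
    using m by (intro integrableI_nonneg) (auto intro: le_less_trans)
  then show "(\<lambda>x. mollify \<epsilon> u x - u x) \<in> L2 lborel" using m by (simp add: L2_def)
  show "(L2_norm lborel (\<lambda>x. mollify \<epsilon> u x - u x))\<^sup>2 \<le> 2 * \<delta>"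
    using * \<open>\<delta> \<ge> 0\<close> m by (simp add: L2_norm_power2 integral_eq_nn_integral enn2real_leI)
qed

lemma mollify_tendsto:
  fixes u :: "'a::euclidean_space \<Rightarrow> real"
  assumes u: "u \<in> L2 lborel" 
  shows "(\<lambda>n. L2_norm lborel (\<lambda>x. mollify (1 / Suc n) u x - u x)) \<longlonglongrightarrow> 0"
    "(\<lambda>x. mollify (1 / Suc n) u x - u x) \<in> L2 lborel"
    "mollify (1 / Suc n) u \<in> L2 lborel"
proof -
  have [measurable]: "u \<in> borel_measurable borel" using L2_measurable[OF u] by simp
  define v where "v x = u x * \<bar>u x\<bar>" for x
  have [measurable]: "v \<in> borel_measurable borel" unfolding v_def by measurable
  have v: "integrable lborel v"
    by (rule Bochner_Integration.integrable_bound[OF L2_integrable[OF u]]) (auto simp: v_def abs_mult power2_eq_square)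
  obtain R where R: "R > 0" "\<And>z::'a. mollifier z \<noteq> 0 \<Longrightarrow> norm z \<le> R" using mollifier_support_bounded by blast
  show 1: "(\<lambda>x. mollify (1 / Suc n) u x - u x) \<in> L2 lborel" for n
  proof (rule mollify_L2_le(1)[OF u])
    fix z :: 'a
    have iv: "integrable lborel (\<lambda>x. v (x + (1 / Suc n) *\<^sub>R z))" by (rule integrable_translate[OF v])
    have "(\<integral>x. \<bar>v (x + (1 / Suc n) *\<^sub>R z) - v x\<bar> \<partial>lborel) \<le> (\<integral>x. \<bar>v (x + (1 / Suc n) *\<^sub>R z)\<bar> + \<bar>v x\<bar> \<partial>lborel)"
      using iv v by (intro integral_mono') auto
    also have "\<dots> = 2 * (\<integral>x. \<bar>v x\<bar> \<partial>lborel)"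
      using iv v integrable_translate(2)[OF integrable_abs[OF v], of "(1 / Suc n) *\<^sub>R z"] by simp
    finally show "(\<integral>x. \<bar>u (x + (1 / Suc n) *\<^sub>R z) * \<bar>u (x + (1 / Suc n) *\<^sub>R z)\<bar> - u x * \<bar>u x\<bar>\<bar> \<partial>lborel) \<le> 2 * (\<integral>x. \<bar>v x\<bar> \<partial>lborel)"
      by (simp add: v_def)
  qed simp
  show "mollify (1 / Suc n) u \<in> L2 lborel" using L2_add(1)[OF 1 u] by simp
  show "(\<lambda>n. L2_norm lborel (\<lambda>x. mollify (1 / Suc n) u x - u x)) \<longlonglongrightarrow> 0"
  proof (rule LIMSEQ_I)
    fix r :: real assume r: "r > 0"
    then have "r\<^sup>2 / 8 > 0" by simp
    then obtain d where d: "d > 0" "\<And>h. norm h < d \<Longrightarrow> (\<integral>x. \<bar>v (x + h) - v x\<bar> \<partial>lborel) < r\<^sup>2 / 8"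
      using translation_continuousE[OF translation_continuous_integrable[OF v] \<open>r\<^sup>2 / 8 > 0\<close>] by metis
    obtain N where N: "R / d < real N" using reals_Archimedean2 by blast
    show "\<exists>N. \<forall>n\<ge>N. norm (L2_norm lborel (\<lambda>x. mollify (1 / Suc n) u x - u x) - 0) < r"
    proof (intro exI allI impI)
      fix n assume "n \<ge> N"
      then have *: "R / d < Suc n" using N by linarith
      have "(L2_norm lborel (\<lambda>x. mollify (1 / Suc n) u x - u x))\<^sup>2 \<le> 2 * (r\<^sup>2 / 8)"
      proof (rule mollify_L2_le(2)[OF u])
        fix z :: 'a assume "mollifier z \<noteq> 0"
        then have "norm z \<le> R" using R by simp
        moreover have "R < d * Suc n" using * \<open>d > 0\<close> by (subst (asm) pos_divide_less_eq) (simp_all add: mult.commute)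
        ultimately have "norm z < d * Suc n" by linarith
        then have "norm z / Suc n < d" by (subst pos_divide_less_eq) auto
        then have "norm ((1 / Suc n) *\<^sub>R z) < d" by simp
        from d(2)[OF this]
        show "(\<integral>x. \<bar>u (x + (1 / Suc n) *\<^sub>R z) * \<bar>u (x + (1 / Suc n) *\<^sub>R z)\<bar> - u x * \<bar>u x\<bar>\<bar> \<partial>lborel) \<le> r\<^sup>2 / 8"
          by (simp add: v_def)
      qed simp
      also have "\<dots> = (r/2)\<^sup>2" by (simp add: power2_eq_square)
      finally have "L2_norm lborel (\<lambda>x. mollify (1 / Suc n) u x - u x) \<le> r / 2"
        by (rule power2_le_imp_le) (use r in auto)
      then show "norm (L2_norm lborel (\<lambda>x. mollify (1 / Suc n) u x - u x) - 0) < r" 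
        using r by (simp add: L2_norm_nonneg)
    qed
  qed
qed

section \<open>Convolution with a test function\<close>

definition grad :: "('a::euclidean_space \<Rightarrow> real) \<Rightarrow> 'a \<Rightarrow> 'a" where
  "grad \<eta> x = (\<Sum>b\<in>Basis. pd \<eta> b x *\<^sub>R b)"

lemma grad_inner: "b \<in> Basis \<Longrightarrow> grad \<eta> x \<bullet> b = pd \<eta> b x"
  by (simp add: grad_def inner_sum_left inner_Basis if_distrib cong: if_cong)

lemma grad_inner_sum: "grad \<eta> x \<bullet> h = (\<Sum>b\<in>Basis. (h \<bullet> b) * pd \<eta> b x)"
  by (subst inner_commute) (simp add: grad_def inner_sum_right mult.commute)

lemma frechet_grad: "smooth \<eta> \<Longrightarrow> frechet_derivative \<eta> (at x) h = grad \<eta> x \<bullet> h"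
  by (simp add: frechet_derivative_Basis[OF smooth_differentiable] grad_inner_sum)

lemma continuous_grad: "smooth \<eta> \<Longrightarrow> continuous_on S (grad \<eta>)"
  unfolding grad_def by (intro continuous_intros smooth_continuous smooth_pd) auto

text \<open>The correlation rather than the convolution: the reflected argument makes \<open>y \<mapsto> \<eta> (y - x)\<close> a test function
placed at \<open>x\<close>.\<close>

definition convolve :: "('a::euclidean_space \<Rightarrow> real) \<Rightarrow> ('a \<Rightarrow> real) \<Rightarrow> 'a \<Rightarrow> real" where
  "convolve \<eta> u x = (\<integral>y. u y * \<eta> (y - x) \<partial>lborel)"

lemma test_functions_shift:
  assumes "\<eta> \<in> test_functions UNIV" shows "(\<lambda>y. \<eta> (y - x)) \<in> test_functions UNIV"
proof -
  obtain S where S: "smooth \<eta>" "compact S" "\<And>x. x \<notin> S \<Longrightarrow> \<eta> x = 0" using assms by (metis test_functionsE)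
  have "smooth (\<lambda>y. \<eta> (y + - x))" using S by (intro smooth_affine[where A="\<lambda>z. z"]) auto
  moreover have "compact ((+) x ` S)" using S(2) by (rule compact_translation)
  moreover have "\<eta> (y - x) = 0" if "y \<notin> (+) x ` S" for y
  proof (rule S(3))
    show "y - x \<notin> S" using that by (force simp: image_iff)
  qed
  ultimately show ?thesis 
    by (intro test_functionsI[of _ "(+) x ` S"]) auto
qed

text \<open>The mean value theorem for \<open>t \<mapsto> \<eta> (w - t h) + t \<nabla>\<eta>(w) h\<close> on \<open>[0, 1]\<close>.\<close>

lemma taylor_bound:
  fixes \<eta> :: "'a::euclidean_space \<Rightarrow> real"
  assumes "smooth \<eta>" and B: "\<And>t. 0 \<le> t \<Longrightarrow> t \<le> 1 \<Longrightarrow> norm (grad \<eta> w - grad \<eta> (w - t *\<^sub>R h)) \<le> B"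
  shows "\<bar>\<eta> (w - h) - \<eta> w + grad \<eta> w \<bullet> h\<bar> \<le> B * norm h"
proof -
  define g where "g t = \<eta> (w - t *\<^sub>R h) + t * (grad \<eta> w \<bullet> h)" for t
  have D: "DERIV g t :> (grad \<eta> w - grad \<eta> (w - t *\<^sub>R h)) \<bullet> h" for t
  proof -
    have "((\<lambda>t. w - t *\<^sub>R h) has_derivative (\<lambda>s. - (s *\<^sub>R h))) (at t)"
      by (auto intro!: derivative_eq_intros)
    from diff_chain_at[OF this smooth_has_derivative[OF assms(1), of "w - t *\<^sub>R h"]]
    have "((\<lambda>t. \<eta> (w - t *\<^sub>R h)) has_derivative (\<lambda>s. s * - (grad \<eta> (w - t *\<^sub>R h) \<bullet> h))) (at t)"
      by (simp add: o_def frechet_grad[OF assms(1)])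
    then have "((\<lambda>t. \<eta> (w - t *\<^sub>R h)) has_derivative (*) (- (grad \<eta> (w - t *\<^sub>R h) \<bullet> h))) (at t)"
      by (rule has_derivative_eq_rhs) (auto simp: mult.commute)
    then have "((\<lambda>t. \<eta> (w - t *\<^sub>R h)) has_real_derivative - (grad \<eta> (w - t *\<^sub>R h) \<bullet> h)) (at t)"
      by (simp add: has_field_derivative_def)
    then show ?thesis unfolding g_def
      by (auto intro!: derivative_eq_intros simp: inner_diff_left)
  qed
  obtain z where z: "0 < z" "z < 1" "g 1 - g 0 = (1 - 0) * ((grad \<eta> w - grad \<eta> (w - z *\<^sub>R h)) \<bullet> h)"
    using MVT2[of 0 1 g "\<lambda>t. (grad \<eta> w - grad \<eta> (w - t *\<^sub>R h)) \<bullet> h"] D by auto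
  have "\<eta> (w - h) - \<eta> w + grad \<eta> w \<bullet> h = (grad \<eta> w - grad \<eta> (w - z *\<^sub>R h)) \<bullet> h"
    using z(3) by (simp add: g_def)
  also have "\<bar>\<dots>\<bar> \<le> norm (grad \<eta> w - grad \<eta> (w - z *\<^sub>R h)) * norm h"
    by (rule Cauchy_Schwarz_ineq2)
  also have "\<dots> \<le> B * norm h" using B[of z] z by (intro mult_right_mono) auto
  finally show ?thesis .
qed

text \<open>The derivative falls on the test function. The first-order error is uniformly small by uniform
continuity of the gradient and is supported in one fixed ball, on which \<open>u\<close> is integrable.\<close>

lemma convolve_has_derivative:
  fixes \<eta> u :: "'a::euclidean_space \<Rightarrow> real"
  assumes \<eta>: "\<eta> \<in> test_functions UNIV" and u: "u \<in> L2 lborel"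
  shows "(convolve \<eta> u has_derivative (\<lambda>h. \<Sum>b\<in>Basis. (h \<bullet> b) * - convolve (pd \<eta> b) u x)) (at x)"
  unfolding has_derivative_at_alt
proof (intro conjI allI impI)
  show "bounded_linear (\<lambda>h. \<Sum>b\<in>Basis. (h \<bullet> b) * - convolve (pd \<eta> b) u x)"
    by (intro bounded_linear_sum bounded_linear_mult_const bounded_linear_inner_left bounded_linear_ident)
  obtain S where S: "smooth \<eta>" "compact S" "\<And>x. x \<notin> S \<Longrightarrow> \<eta> x = 0" "\<And>x b. x \<notin> S \<Longrightarrow> pd \<eta> b x = 0" 
    using \<eta> by (metis test_functionsE)
  obtain R where R: "\<And>x. x \<in> S \<Longrightarrow> norm x \<le> R" "R > 0" using compact_imp_bounded[OF S(2)] by (metis bounded_pos)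
  define B where "B = cball x (R + 1)"
  have [measurable]: "B \<in> sets borel" "u \<in> borel_measurable borel"
    using L2_measurable[OF u] by (auto simp: B_def)
  have iB: "integrable lborel (\<lambda>y. indicator B y * \<bar>u y\<bar>)"
  proof (rule Bochner_Integration.integrable_bound)
    show "integrable lborel (\<lambda>y. indicator B y + (norm (u y))\<^sup>2)"
      using L2_integrable[OF u] emeasure_bounded_finite[of B] by (auto simp: B_def)
    have "\<bar>u y\<bar> \<le> 1 + \<bar>u y\<bar>\<^sup>2" for y
      using sum_squares_bound[of 1 "\<bar>u y\<bar>"] abs_ge_zero[of "u y"] unfolding one_power2 by linarith
    then show "AE y in lborel. norm (indicator B y * \<bar>u y\<bar>) \<le> norm (indicator B y + (norm (u y))\<^sup>2)"
      by (intro AE_I2) (auto simp: indicator_def)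
  qed simp
  define J where "J = (\<integral>y. indicator B y * \<bar>u y\<bar> \<partial>lborel)"
  have J: "J \<ge> 0" unfolding J_def by (rule Bochner_Integration.integral_nonneg) simp
  fix e :: real assume "e > 0"
  then have "e / (J + 1) > 0" using J by simp
  moreover have "uniformly_continuous_on (cball 0 (R + 2)) (grad \<eta>)"
    by (intro compact_uniformly_continuous continuous_grad S) auto
  ultimately obtain d where d: "d > 0" "\<And>p q. p \<in> cball 0 (R + 2) \<Longrightarrow> q \<in> cball 0 (R + 2) \<Longrightarrow> dist q p < d \<Longrightarrow> 
      dist (grad \<eta> q) (grad \<eta> p) < e / (J + 1)"
    unfolding uniformly_continuous_on_def by metis
  show "\<exists>d>0. \<forall>y. norm (y - x) < d \<longrightarrow> norm (convolve \<eta> u y - convolve \<eta> u x -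
        (\<Sum>b\<in>Basis. ((y - x) \<bullet> b) * - convolve (pd \<eta> b) u x)) \<le> e * norm (y - x)"
  proof (intro exI[of _ "min d 1"] conjI allI impI)
    fix x' assume x': "norm (x' - x) < min d 1"
    define h where "h = x' - x"
    have h: "norm h < d" "norm h < 1" "x' = x + h" using x' by (auto simp: h_def)
    have i1: "integrable lborel (\<lambda>y. u y * \<zeta> (y - z))" if "\<zeta> \<in> test_functions UNIV" for \<zeta> z
      by (intro L2_times_test_integrable u test_functions_shift that)
    have i2: "integrable lborel (\<lambda>y. u y * pd \<eta> b (y - x))" if "b \<in> Basis" for b
      by (intro i1 test_functions_pd \<eta> that)
    define P where "P y = \<eta> (y - x - h) - \<eta> (y - x) + grad \<eta> (y - x) \<bullet> h" for y
    have P: "\<bar>P y\<bar> \<le> e / (J + 1) * norm h * indicator B y" for y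
    proof (cases "y \<in> B")
      case True
      have w: "norm (y - x) \<le> R + 1" using True by (auto simp: B_def dist_norm norm_minus_commute)
      have th: "norm (t *\<^sub>R h) \<le> norm h" if "0 \<le> t" "t \<le> 1" for t
        using that by (simp add: mult_left_le_one_le)
      have nn: "norm (grad \<eta> (y - x) - grad \<eta> (y - x - t *\<^sub>R h)) \<le> e / (J + 1)" if "0 \<le> t" "t \<le> 1" for t
      proof -
        have "norm (y - x - t *\<^sub>R h) \<le> R + 2"
          using norm_triangle_ineq4[of "y - x" "t *\<^sub>R h"] w th[OF that] h by linarith
        then have "y - x - t *\<^sub>R h \<in> cball 0 (R + 2)" "y - x \<in> cball 0 (R + 2)" using w by simp_all
        moreover have "dist (y - x) (y - x - t *\<^sub>R h) < d" using th[OF that] h by (simp add: dist_norm)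
        ultimately have "dist (grad \<eta> (y - x)) (grad \<eta> (y - x - t *\<^sub>R h)) < e / (J + 1)"
          by (intro d(2))
        then show ?thesis by (simp add: dist_norm)
      qed
      show ?thesis unfolding P_def
        using taylor_bound[OF S(1) nn] True by simp
    next
      case False
      then have "R + 1 < norm (y - x)" by (auto simp: B_def dist_norm norm_minus_commute)
      moreover have "norm (y - x) \<le> norm (y - x - h) + norm h" by (metis norm_triangle_sub add.commute)
      ultimately have "y - x \<notin> S" "y - x - h \<notin> S" using R(1)[of "y - x"] R(1)[of "y - x - h"] h by auto
      then show ?thesis using False by (simp add: P_def S grad_def)
    qed
    have "convolve \<eta> u x' - convolve \<eta> u x - (\<Sum>b\<in>Basis. (h \<bullet> b) * - convolve (pd \<eta> b) u x)
      = (\<integral>y. u y * \<eta> (y - x - h) \<partial>lborel) - (\<integral>y. u y * \<eta> (y - x) \<partial>lborel) + (\<integral>y. (\<Sum>b\<in>Basis. (h \<bullet> b) * (u y * pd \<eta> b (y - x))) \<partial>lborel)"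
      using i2 by (simp add: convolve_def h(3) sum_negf diff_diff_eq)
    also have "\<dots> = (\<integral>y. u y * P y \<partial>lborel)"
    proof -
      have "u y * P y = u y * \<eta> (y - x - h) - u y * \<eta> (y - x) + (\<Sum>b\<in>Basis. (h \<bullet> b) * (u y * pd \<eta> b (y - x)))" for y
        by (simp add: P_def grad_inner_sum sum_distrib_left algebra_simps)
      moreover have "integrable lborel (\<lambda>y. u y * \<eta> (y - x - h))" using i1[OF \<eta>, of "x + h"] by (simp add: algebra_simps)
      ultimately show ?thesis using i1[OF \<eta>] i2 by simp
    qed
    finally have "\<bar>convolve \<eta> u x' - convolve \<eta> u x - (\<Sum>b\<in>Basis. (h \<bullet> b) * - convolve (pd \<eta> b) u x)\<bar>
      \<le> (\<integral>y. \<bar>u y * P y\<bar> \<partial>lborel)" by simp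
    also have "\<dots> \<le> (\<integral>y. e / (J + 1) * norm h * (indicator B y * \<bar>u y\<bar>) \<partial>lborel)"
    proof (rule integral_mono')
      show "integrable lborel (\<lambda>y. e / (J + 1) * norm h * (indicator B y * \<bar>u y\<bar>))" using iB by simp
      fix y show "\<bar>u y * P y\<bar> \<le> e / (J + 1) * norm h * (indicator B y * \<bar>u y\<bar>)"
        using mult_right_mono[OF P[of y], of "\<bar>u y\<bar>"] by (simp add: abs_mult ac_simps)
    qed (use J \<open>e > 0\<close> in simp)
    also have "\<dots> = e / (J + 1) * norm h * J" by (simp add: J_def)
    also have "\<dots> = e * norm h * (J / (J + 1))" by simp
    also have "\<dots> \<le> e * norm h * 1" using J \<open>e > 0\<close> by (intro mult_left_mono) auto
    finally show "norm (convolve \<eta> u x' - convolve \<eta> u x - (\<Sum>b\<in>Basis. ((x' - x) \<bullet> b) * - convolve (pd \<eta> b) u x)) \<le> e * norm (x' - x)"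
      by (simp add: h_def)
  qed (use d in auto)
qed

lemma smooth_convolve:
  fixes \<eta> u :: "'a::euclidean_space \<Rightarrow> real"
  assumes "\<eta> \<in> test_functions UNIV" and u: "u \<in> L2 lborel"
  shows "smooth (convolve \<eta> u)"
  unfolding smooth_def
proof
  fix k show "C_k k (convolve \<eta> u)" using assms(1)
  proof (induction k arbitrary: \<eta>)
    case 0
    show ?case using has_derivative_continuous[OF convolve_has_derivative[OF 0 u]]
      by (auto intro!: continuous_at_imp_continuous_on)
  next
    case (Suc k)
    show ?case
    proof (rule C_k_SucI[OF convolve_has_derivative[OF Suc.prems u]])
      fix b :: 'a assume "b \<in> Basis"
      have "C_k k (\<lambda>x. (\<Sum>i\<in>Basis. (b \<bullet> i) * (- 1 * convolve (pd \<eta> i) u x)))"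
        by (intro C_k_sum C_k_mult C_k_const Suc.IH test_functions_pd Suc.prems)
      then show "C_k k (\<lambda>x. \<Sum>i\<in>Basis. (b \<bullet> i) * - convolve (pd \<eta> i) u x)" by simp
    qed
  qed
qed

lemma pd_convolve:
  assumes "\<eta> \<in> test_functions UNIV" "u \<in> L2 lborel" "b \<in> Basis"
  shows "pd (convolve \<eta> u) b x = - convolve (pd \<eta> b) u x"
  using assms(3) by (simp add: frechet_derivative_eqI[OF convolve_has_derivative[OF assms(1,2)]] inner_Basis if_distrib
      if_distribR cong: if_cong)

definition scaled_mollifier :: "real \<Rightarrow> 'a::euclidean_space \<Rightarrow> real" where
  "scaled_mollifier \<epsilon> w = mollifier (w /\<^sub>R \<epsilon>) / \<epsilon> ^ DIM('a)"

lemma scaled_mollifier_zero: 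
  assumes "\<epsilon> > 0" "w \<notin> (*\<^sub>R) \<epsilon> ` cbox One (2 *\<^sub>R One)" shows "scaled_mollifier \<epsilon> w = 0"
proof -
  have "w /\<^sub>R \<epsilon> \<notin> cbox One (2 *\<^sub>R One)"
  proof
    assume "w /\<^sub>R \<epsilon> \<in> cbox One (2 *\<^sub>R One)"
    then have "\<epsilon> *\<^sub>R (w /\<^sub>R \<epsilon>) \<in> (*\<^sub>R) \<epsilon> ` cbox One (2 *\<^sub>R One)" by blast
    then show False using assms by simp
  qed
  then show ?thesis by (simp add: scaled_mollifier_def mollifier_zero)
qed

lemma smooth_scaled_mollifier: "smooth (scaled_mollifier \<epsilon> :: 'a::euclidean_space \<Rightarrow> real)"
proof -
  have "smooth (\<lambda>w::'a. inverse (\<epsilon> ^ DIM('a)) * mollifier (inverse \<epsilon> *\<^sub>R w + 0))"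
    by (intro smooth_mult smooth_const smooth_affine[where A="\<lambda>w. inverse \<epsilon> *\<^sub>R w"] smooth_mollifier bounded_linear_scaleR_right)
  then show ?thesis by (simp add: scaled_mollifier_def[abs_def] divide_inverse mult.commute)
qed

lemma scaled_mollifier_test: "\<epsilon> > 0 \<Longrightarrow> scaled_mollifier \<epsilon> \<in> test_functions UNIV"
  by (rule test_functionsI[OF smooth_scaled_mollifier, of "(*\<^sub>R) \<epsilon> ` cbox One (2 *\<^sub>R One)"])
     (auto intro: compact_scaling simp: scaled_mollifier_zero)

lemma mollify_eq_convolve:
  fixes u :: "'a::euclidean_space \<Rightarrow> real"
  assumes "\<epsilon> > 0" "u \<in> borel_measurable borel"
  shows "mollify \<epsilon> u = convolve (scaled_mollifier \<epsilon>) u"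
proof
  fix x :: 'a
  have [measurable]: "u \<in> borel_measurable borel" by fact
  have [measurable]: "(scaled_mollifier \<epsilon> :: 'a \<Rightarrow> real) \<in> borel_measurable borel"
    by (rule smooth_borel[OF smooth_scaled_mollifier])
  have *: "lborel = density (distr lborel borel (\<lambda>z. x + \<epsilon> *\<^sub>R z)) (\<lambda>_. \<bar>\<epsilon>\<bar> ^ DIM('a))"
    using assms(1) by (intro lborel_affine) auto
  have "convolve (scaled_mollifier \<epsilon>) u x = (\<integral>y. u y * scaled_mollifier \<epsilon> (y - x) \<partial>density (distr lborel borel (\<lambda>z. x + \<epsilon> *\<^sub>R z)) (\<lambda>_. \<bar>\<epsilon>\<bar> ^ DIM('a)))"
    unfolding convolve_def using * by simp
  also have "\<dots> = (\<integral>z. \<bar>\<epsilon>\<bar> ^ DIM('a) * (u (x + \<epsilon> *\<^sub>R z) * scaled_mollifier \<epsilon> (\<epsilon> *\<^sub>R z)) \<partial>lborel)"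
    using assms(1) by (subst integral_real_density) (simp_all add: integral_distr)
  also have "\<dots> = mollify \<epsilon> u x"
    using assms(1) unfolding mollify_def scaled_mollifier_def 
    by (intro Bochner_Integration.integral_cong) auto
  finally show "mollify \<epsilon> u x = convolve (scaled_mollifier \<epsilon>) u x" by simp
qed

section \<open>Slicing along a coordinate and integration by parts\<close>

lemma sets_hyperplane: "sets (hyperplane_measure e) = sets borel"
  by (simp add: hyperplane_measure_def)

lemma measurable_hyperplane: "measurable (hyperplane_measure e) N = measurable borel N"
  by (rule measurable_cong_sets[OF sets_hyperplane refl])

lemma hyperplane_map_measurable:
  "(\<lambda>z. \<Sum>b\<in>Basis - {e}. z b *\<^sub>R b) \<in> (\<Pi>\<^sub>M b\<in>Basis - {e::'a::euclidean_space}. lborel) \<rightarrow>\<^sub>M borel"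
proof (rule borel_measurable_sum)
  fix b assume "b \<in> Basis - {e}"
  then have "(\<lambda>z. z b) \<in> (\<Pi>\<^sub>M b\<in>Basis - {e}. lborel) \<rightarrow>\<^sub>M lborel" by measurable
  then have "(\<lambda>z. z b) \<in> (\<Pi>\<^sub>M b\<in>Basis - {e}. lborel) \<rightarrow>\<^sub>M borel" by simp
  then show "(\<lambda>z. z b *\<^sub>R b) \<in> borel_measurable (\<Pi>\<^sub>M b\<in>Basis - {e}. lborel)" by (intro borel_measurable_scaleR) auto
qed

text \<open>Lebesgue measure and the hyperplane measure are images of product measures that differ by one
factor, so this is Tonelli's theorem for that factor.\<close>

lemma nn_integral_lborel_slice:
  fixes f :: "'a::euclidean_space \<Rightarrow> ennreal"
  assumes e: "e \<in> Basis" and f[measurable]: "f \<in> borel_measurable borel"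
  shows "(\<integral>\<^sup>+x. f x \<partial>lborel) = (\<integral>\<^sup>+x. (\<integral>\<^sup>+t. f (x + t *\<^sub>R e) \<partial>lborel) \<partial>hyperplane_measure e)"
proof -
  interpret product_sigma_finite "\<lambda>_::'a. lborel :: real measure" by standard
  have B: "insert e (Basis - {e}) = Basis" using e by auto
  have m: "(\<lambda>z. \<Sum>b\<in>Basis. z b *\<^sub>R b) \<in> (\<Pi>\<^sub>M b\<in>Basis. lborel) \<rightarrow>\<^sub>M (borel :: 'a measure)"
    using hyperplane_map_measurable[of "0::'a"] by (simp add: nonzero_Basis)
  have "(\<integral>\<^sup>+x. f x \<partial>lborel) = (\<integral>\<^sup>+z. f (\<Sum>b\<in>Basis. z b *\<^sub>R b) \<partial>(\<Pi>\<^sub>M b\<in>Basis. lborel))"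
    by (subst lborel_eq) (rule nn_integral_distr[OF m], simp)
  also have "\<dots> = (\<integral>\<^sup>+z. f (\<Sum>b\<in>Basis. z b *\<^sub>R b) \<partial>(\<Pi>\<^sub>M b\<in>insert e (Basis - {e}). lborel))"
    unfolding B ..
  also have "\<dots> = (\<integral>\<^sup>+z. (\<integral>\<^sup>+t. f (\<Sum>b\<in>Basis. (z(e := t)) b *\<^sub>R b) \<partial>lborel) \<partial>(\<Pi>\<^sub>M b\<in>Basis - {e}. lborel))"
    using m by (intro product_nn_integral_insert) (auto simp: B)
  also have "\<dots> = (\<integral>\<^sup>+z. (\<integral>\<^sup>+t. f ((\<Sum>b\<in>Basis - {e}. z b *\<^sub>R b) + t *\<^sub>R e) \<partial>lborel) \<partial>(\<Pi>\<^sub>M b\<in>Basis - {e}. lborel))"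
  proof -
    have "(\<Sum>b\<in>Basis. (z(e := t)) b *\<^sub>R b) = (\<Sum>b\<in>Basis - {e}. z b *\<^sub>R b) + t *\<^sub>R e" for z t
      using e by (subst sum.remove[of _ e]) (auto simp: add.commute intro!: sum.cong)
    then show ?thesis by simp
  qed
  also have "\<dots> = (\<integral>\<^sup>+x. (\<integral>\<^sup>+t. f (x + t *\<^sub>R e) \<partial>lborel) \<partial>hyperplane_measure e)"
    unfolding hyperplane_measure_def
    by (rule nn_integral_distr[OF hyperplane_map_measurable, symmetric]) measurable
  finally show ?thesis .
qed

lemma AE_hyperplane: "e \<in> Basis \<Longrightarrow> AE x in hyperplane_measure e. x \<bullet> e = 0"
  unfolding hyperplane_measure_def
  by (subst AE_distr_iff[OF hyperplane_map_measurable])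
     (auto intro!: AE_I2 sum.neutral simp: inner_sum_left inner_Basis)

lemma smooth_slice: "smooth \<eta> \<Longrightarrow> smooth (\<lambda>t::real. \<eta> (x + t *\<^sub>R e))"
  using smooth_affine[where A="\<lambda>t::real. t *\<^sub>R e" and a=x] by (simp add: bounded_linear_scaleR_left add.commute)

lemma test_functions_slice:
  fixes \<eta> :: "'a::euclidean_space \<Rightarrow> real"
  assumes "\<eta> \<in> test_functions UNIV" and e: "e \<in> Basis"
  shows "(\<lambda>t. \<eta> (x + t *\<^sub>R e)) \<in> test_functions UNIV"
proof -
  obtain S where S: "smooth \<eta>" "compact S" "\<And>x. x \<notin> S \<Longrightarrow> \<eta> x = 0" using assms by (metis test_functionsE)
  obtain R where R: "\<And>x. x \<in> S \<Longrightarrow> norm x \<le> R" using compact_imp_bounded[OF S(2)] by (metis bounded_pos)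
  show ?thesis
  proof (rule test_functionsI[OF smooth_slice[OF S(1)], of "cball 0 (R + norm x)"])
    fix t :: real assume "t \<notin> cball 0 (R + norm x)"
    then have "norm (x + t *\<^sub>R e) > R"
      using norm_triangle_ineq4[of "x + t *\<^sub>R e" x] e by (simp add: dist_norm)
    then show "\<eta> (x + t *\<^sub>R e) = 0" using R S(3) by (meson not_le)
  qed auto
qed

lemma slice_has_derivative:
  fixes \<eta> :: "'a::euclidean_space \<Rightarrow> real"
  assumes "smooth \<eta>" 
  shows "((\<lambda>t. \<eta> (x + t *\<^sub>R e)) has_real_derivative pd \<eta> e (x + t *\<^sub>R e)) (at t)"
proof -
  have "((\<lambda>t. x + t *\<^sub>R e) has_derivative (\<lambda>s. s *\<^sub>R e)) (at t)"
    by (auto intro!: derivative_eq_intros)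
  from diff_chain_at[OF this smooth_has_derivative[OF assms(1)]]
  have "((\<lambda>t. \<eta> (x + t *\<^sub>R e)) has_derivative (\<lambda>s. s * (grad \<eta> (x + t *\<^sub>R e) \<bullet> e))) (at t)"
    by (simp add: o_def frechet_grad[OF assms(1)])
  then have "((\<lambda>t. \<eta> (x + t *\<^sub>R e)) has_derivative (*) (grad \<eta> (x + t *\<^sub>R e) \<bullet> e)) (at t)"
    by (rule has_derivative_eq_rhs) (auto simp: mult.commute)
  then show ?thesis by (simp add: has_field_derivative_def frechet_grad[OF assms])
qed

lemma pd_slice:
  fixes \<eta> :: "'a::euclidean_space \<Rightarrow> real"
  assumes "smooth \<eta>" 
  shows "pd (\<lambda>t. \<eta> (x + t *\<^sub>R e)) 1 t = pd \<eta> e (x + t *\<^sub>R e)"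
  using frechet_derivative_eqI[OF slice_has_derivative[OF assms, unfolded has_field_derivative_def]] by simp

lemma smooth_real_DERIV:
  assumes "smooth (\<eta> :: real \<Rightarrow> real)" shows "(\<eta> has_real_derivative pd \<eta> 1 t) (at t within S)"
  using has_field_derivative_at_within[OF slice_has_derivative[OF assms, of 0 1 t]] by simp

lemma FTC_lborel:
  fixes F f :: "real \<Rightarrow> real"
  assumes "a \<le> b" "\<And>x. a \<le> x \<Longrightarrow> x \<le> b \<Longrightarrow> (F has_real_derivative f x) (at x within {a .. b})" "continuous_on {a .. b} f"
  shows "integrable lborel (\<lambda>x. indicator {a..b} x * f x)" "(\<integral>x. indicator {a..b} x * f x \<partial>lborel) = F b - F a"
  using borel_integrable_atLeastAtMost'[OF assms(3)] integral_FTC_atLeastAtMost[OF assms(1) _ assms(3), of F] assms(2)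
  by (auto simp: set_integrable_def has_real_derivative_iff_has_vector_derivative)

lemma integral_deriv_zero:
  fixes w :: "real \<Rightarrow> real"
  assumes "w \<in> test_functions UNIV" shows "(\<integral>t. pd w 1 t \<partial>lborel) = 0"
proof -
  obtain S where S: "smooth w" "compact S" "\<And>x. x \<notin> S \<Longrightarrow> w x = 0" "\<And>x b. x \<notin> S \<Longrightarrow> pd w b x = 0" using assms by (metis test_functionsE)
  obtain R where R: "\<And>x. x \<in> S \<Longrightarrow> norm x \<le> R" "R > 0" using compact_imp_bounded[OF S(2)] by (metis bounded_pos)
  have "(\<integral>t. pd w 1 t \<partial>lborel) = (\<integral>t. indicator {-(R+1)..R+1} t * pd w 1 t \<partial>lborel)"
    using R(1) S(4) by (intro Bochner_Integration.integral_cong) (force simp: indicator_def abs_le_iff)+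
  also have "\<dots> = w (R+1) - w (-(R+1))"
    using R by (intro FTC_lborel smooth_real_DERIV S smooth_continuous smooth_pd) auto
  also have "\<dots> = 0"
  proof -
    have "R + 1 \<notin> S" "- (R + 1) \<notin> S" using R(1)[of "R+1"] R(1)[of "-(R+1)"] R(2) by auto
    then show ?thesis by (simp add: S(3) del: minus_add_distrib)
  qed
  finally show ?thesis .
qed

text \<open>Slicing is available for nonnegative integrals; this transfers the vanishing of a signed integral.\<close>

lemma integral_eq_0_iff_nn:
  fixes f :: "'a \<Rightarrow> real"
  assumes "integrable M f"
  shows "(\<integral>x. f x \<partial>M) = 0 \<longleftrightarrow> (\<integral>\<^sup>+x. ennreal (f x) \<partial>M) = (\<integral>\<^sup>+x. ennreal (- f x) \<partial>M)"
proof -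
  have f: "(\<integral>\<^sup>+x. ennreal (f x) \<partial>M) < \<infinity>" "(\<integral>\<^sup>+x. ennreal (- f x) \<partial>M) < \<infinity>"
    using assms by (auto simp: real_integrable_def less_top)
  show ?thesis unfolding real_lebesgue_integral_def[OF assms]
    using f by (metis ennreal_enn2real eq_iff_diff_eq_0 infinity_ennreal_def)
qed

text \<open>The integral vanishes along every line in direction \<open>e\<close> by the fundamental theorem of calculus.\<close>

lemma integral_pd_zero:
  fixes w :: "'a::euclidean_space \<Rightarrow> real"
  assumes w: "w \<in> test_functions UNIV" and e: "e \<in> Basis" shows "(\<integral>x. pd w e x \<partial>lborel) = 0"
proof -
  have t: "pd w e \<in> test_functions UNIV" by (rule test_functions_pd[OF w e])
  have s: "smooth w" "smooth (pd w e)" using w t by (metis test_functionsE)+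
  have [measurable]: "pd w e \<in> borel_measurable borel" by (rule smooth_borel[OF s(2)])
  have "(\<integral>\<^sup>+t. ennreal (pd w e (x + t *\<^sub>R e)) \<partial>lborel) = (\<integral>\<^sup>+t. ennreal (- pd w e (x + t *\<^sub>R e)) \<partial>lborel)" for x
    using integral_deriv_zero[OF test_functions_slice[OF w e, of x]] unfolding pd_slice[OF s(1)]
    by (subst (asm) integral_eq_0_iff_nn) (auto intro!: test_functions_integrable test_functions_slice t e)
  then have "(\<integral>\<^sup>+x. ennreal (pd w e x) \<partial>lborel) = (\<integral>\<^sup>+x. ennreal (- pd w e x) \<partial>lborel)"
    by (simp add: nn_integral_lborel_slice[OF e])
  then show ?thesis by (simp add: integral_eq_0_iff_nn test_functions_integrable[OF t])
qed

lemma pd_mult: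
  assumes "smooth f" "smooth g" shows "pd (\<lambda>x. f x * g x) b x = f x * pd g b x + pd f b x * g x"
  by (simp add: frechet_derivative_eqI[OF has_derivative_mult[OF smooth_has_derivative[OF assms(1)] smooth_has_derivative[OF assms(2)]]])

lemma pd_diff:
  assumes "smooth f" "smooth g" shows "pd (\<lambda>x. f x - g x) b x = pd f b x - pd g b x"
  by (simp add: frechet_derivative_eqI[OF has_derivative_diff[OF smooth_has_derivative[OF assms(1)] smooth_has_derivative[OF assms(2)]]])

lemma integration_by_parts:
  fixes \<eta> \<zeta> :: "'a::euclidean_space \<Rightarrow> real"
  assumes "\<eta> \<in> test_functions UNIV" "\<zeta> \<in> test_functions UNIV" "b \<in> Basis"
  shows "(\<integral>x. \<eta> x * pd \<zeta> b x \<partial>lborel) = - (\<integral>x. pd \<eta> b x * \<zeta> x \<partial>lborel)"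
proof -
  have s: "smooth \<eta>" "smooth \<zeta>" using assms by (metis test_functionsE)+
  have "(\<integral>x. pd (\<lambda>x. \<eta> x * \<zeta> x) b x \<partial>lborel) = 0"
    by (intro integral_pd_zero test_functions_mult assms s)
  moreover have "integrable lborel (\<lambda>x. \<eta> x * pd \<zeta> b x)" "integrable lborel (\<lambda>x. pd \<eta> b x * \<zeta> x)"
    by (intro test_functions_integrable test_functions_mult test_functions_pd smooth_pd assms s)+
  ultimately show ?thesis by (simp add: pd_mult[OF s])
qed

section \<open>Weak gradients on a half-space\<close>

lemma open_half_space: "open (half_space e)"
  unfolding half_space_def by (intro open_Collect_less continuous_intros)

lemma half_space_borel[measurable]: "half_space e \<in> sets borel"
  by (rule borel_open[OF open_half_space])

lemma integral_test_support:
  fixes f \<zeta> :: "'a::euclidean_space \<Rightarrow> real"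
  assumes "open D" "\<zeta> \<in> test_functions D"
  shows "(\<integral>x. f x * \<zeta> x \<partial>leb D) = (\<integral>x. f x * \<zeta> x \<partial>lborel)"
    "(\<integral>x. f x * \<zeta> x \<partial>leb D) = (\<integral>x. indicator D x * f x * \<zeta> x \<partial>lborel)"
proof -
  obtain S where S: "S \<subseteq> D" "\<And>x. x \<notin> S \<Longrightarrow> \<zeta> x = 0" using assms by (metis test_functionsE)
  show "(\<integral>x. f x * \<zeta> x \<partial>leb D) = (\<integral>x. f x * \<zeta> x \<partial>lborel)"
    unfolding restrict_lborel_simps(2)[OF assms(1)] using S
    by (intro Bochner_Integration.integral_cong) (auto simp: indicator_def)
  show "(\<integral>x. f x * \<zeta> x \<partial>leb D) = (\<integral>x. indicator D x * f x * \<zeta> x \<partial>lborel)"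
    unfolding restrict_lborel_simps(2)[OF assms(1)] by (simp add: mult.assoc)
qed

lemma L2_norm_zero_iff:
  fixes u :: "'a \<Rightarrow> 'b::euclidean_space"
  assumes "u \<in> L2 M" shows "L2_norm M u = 0 \<longleftrightarrow> (AE x in M. u x = 0)"
proof -
  have "L2_norm M u = 0 \<longleftrightarrow> (\<integral>x. (norm (u x))\<^sup>2 \<partial>M) = 0" by (simp add: L2_norm_def)
  also have "\<dots> \<longleftrightarrow> (AE x in M. (norm (u x))\<^sup>2 = 0)"
    by (rule integral_nonneg_eq_0_iff_AE[OF L2_integrable[OF assms]]) simp
  finally show ?thesis by simp
qed

lemma L2_component:
  fixes G :: "'a \<Rightarrow> 'b::euclidean_space"
  assumes "G \<in> L2 M" "b \<in> Basis" shows "(\<lambda>x. G x \<bullet> b) \<in> L2 M" "L2_norm M (\<lambda>x. G x \<bullet> b) \<le> L2_norm M G"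
  using L2_mono[OF assms(1), of "\<lambda>x. G x \<bullet> b" 1] L2_measurable[OF assms(1)] assms(2)
  by (auto simp: Basis_le_norm)

lemma L2_extend_by_zero:
  fixes u :: "'a::euclidean_space \<Rightarrow> real"
  assumes "open D" "u \<in> L2 (leb D)"
  shows "(\<lambda>x. indicator D x * u x) \<in> L2 lborel"
  using assms L2_leb(1)[OF assms(1), of u] by simp

text \<open>This is why the mollifier is one-sided: seen from a point of the half-space, the averaging weight is
an admissible test function for weak gradients.\<close>

lemma shifted_mollifier_test:
  fixes e :: "'a::euclidean_space"
  assumes e: "e \<in> Basis" and x: "x \<in> half_space e" and \<epsilon>: "\<epsilon> > 0"
  shows "(\<lambda>y. scaled_mollifier \<epsilon> (y - x)) \<in> test_functions (half_space e)"
proof (rule test_functionsI)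
  have "smooth (\<lambda>y::'a. scaled_mollifier \<epsilon> (y + - x))"
    by (rule smooth_affine[OF bounded_linear_ident smooth_scaled_mollifier])
  then show "smooth (\<lambda>y. scaled_mollifier \<epsilon> (y - x))" by simp
  let ?S = "(+) x ` (*\<^sub>R) \<epsilon> ` cbox One (2 *\<^sub>R (One :: 'a))"
  show "compact ?S" by (intro compact_translation compact_scaling) simp
  show "?S \<subseteq> half_space e"
  proof clarify
    fix z :: 'a assume "z \<in> cbox One (2 *\<^sub>R One)"
    then have "1 \<le> z \<bullet> e" using e by (auto simp: mem_box)
    then have "0 < \<epsilon> * (z \<bullet> e)" using \<epsilon> by simp
    then show "x + \<epsilon> *\<^sub>R z \<in> half_space e"
      using x by (simp add: half_space_def inner_add_left)
  qed
  show "scaled_mollifier \<epsilon> (y - x) = 0" if "y \<notin> ?S" for y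
  proof (rule scaled_mollifier_zero[OF \<epsilon>])
    show "y - x \<notin> (*\<^sub>R) \<epsilon> ` cbox One (2 *\<^sub>R One)"
    proof
      assume "y - x \<in> (*\<^sub>R) \<epsilon> ` cbox One (2 *\<^sub>R One)"
      then have "x + (y - x) \<in> ?S" by (rule imageI)
      then show False using that by simp
    qed
  qed
qed

lemma pd_shift: "smooth \<eta> \<Longrightarrow> pd (\<lambda>y. \<eta> (y - x)) b y = pd \<eta> b (y - x)"
  using frechet_derivative_eqI[OF has_derivative_affine_comp[of \<eta> "\<lambda>z. z" y "- x"]] smooth_differentiable[of \<eta>]
  by (simp add: bounded_linear_ident)

text \<open>Mollification commutes with weak differentiation at every point of the half-space: differentiating the
weight and testing the weak gradient with it are the same computation.\<close>

lemma pd_mollify: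
  fixes e :: "'a::euclidean_space"
  assumes e: "e \<in> Basis" and \<psi>: "\<psi> \<in> L2 (leb (half_space e))" and G: "G \<in> L2 (leb (half_space e))"
    and w: "is_weak_gradient (half_space e) \<psi> G"
    and x: "x \<in> half_space e" and \<epsilon>: "\<epsilon> > 0" and b: "b \<in> Basis"
  shows "pd (mollify \<epsilon> (\<lambda>y. indicator (half_space e) y * \<psi> y)) b x = mollify \<epsilon> (\<lambda>y. indicator (half_space e) y * (G y \<bullet> b)) x"
proof -
  let ?D = "half_space e" and ?K = "scaled_mollifier \<epsilon> :: 'a \<Rightarrow> real"
  have u: "(\<lambda>y. indicator ?D y * \<psi> y) \<in> L2 lborel" and g: "(\<lambda>y. indicator ?D y * (G y \<bullet> b)) \<in> L2 lborel"
    by (intro L2_extend_by_zero open_half_space \<psi> L2_component G b)+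
  have t: "(\<lambda>y. ?K (y - x)) \<in> test_functions ?D" by (rule shifted_mollifier_test[OF e x \<epsilon>])
  have "pd (mollify \<epsilon> (\<lambda>y. indicator ?D y * \<psi> y)) b x = - convolve (pd ?K b) (\<lambda>y. indicator ?D y * \<psi> y) x"
    using \<epsilon> L2_measurable[OF u] by (simp add: mollify_eq_convolve pd_convolve[OF scaled_mollifier_test u b])
  also have "\<dots> = - (\<integral>y. \<psi> y * pd (\<lambda>y. ?K (y - x)) b y \<partial>leb ?D)"
    unfolding convolve_def integral_test_support(2)[OF open_half_space test_functions_pd[OF t b]]
    by (simp add: pd_shift smooth_scaled_mollifier)
  also have "\<dots> = (\<integral>y. (G y \<bullet> b) * ?K (y - x) \<partial>leb ?D)"
    using w t b unfolding is_weak_gradient_def by simp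
  also have "\<dots> = mollify \<epsilon> (\<lambda>y. indicator ?D y * (G y \<bullet> b)) x"
    using \<epsilon> L2_measurable[OF g] unfolding integral_test_support(2)[OF open_half_space t]
    by (simp add: mollify_eq_convolve convolve_def)
  finally show ?thesis .
qed

text \<open>The mollifications of \<open>h\<close> vanish on the half-space, since they are integrals against test
functions, and they converge to \<open>h\<close>.\<close>

lemma fundamental_lemma:
  fixes e :: "'a::euclidean_space"
  assumes e: "e \<in> Basis" and h: "h \<in> L2 (leb (half_space e))"
    and z: "\<And>\<eta>. \<eta> \<in> test_functions (half_space e) \<Longrightarrow> (\<integral>x. h x * \<eta> x \<partial>leb (half_space e)) = 0"
  shows "AE x in leb (half_space e). h x = (0::real)"
proof -
  let ?D = "half_space e"
  define u where "u y = indicator ?D y * h y" for y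
  have u: "u \<in> L2 lborel" unfolding u_def by (intro L2_extend_by_zero open_half_space h)
  have "mollify (1 / Suc n) u x = 0" if "x \<in> ?D" for x n
  proof -
    have t: "(\<lambda>y. scaled_mollifier (1 / Suc n) (y - x)) \<in> test_functions ?D"
      by (rule shifted_mollifier_test[OF e that]) simp
    have "mollify (1 / Suc n) u x = (\<integral>y. u y * scaled_mollifier (1 / Suc n) (y - x) \<partial>lborel)"
      using L2_measurable[OF u] by (simp add: mollify_eq_convolve convolve_def)
    also have "\<dots> = 0" using z[OF t] unfolding integral_test_support(2)[OF open_half_space t] u_def .
    finally show ?thesis .
  qed
  then have "L2_norm (leb ?D) (\<lambda>x. mollify (1 / Suc n) u x - u x) = L2_norm (leb ?D) h" for n
    by (intro L2_norm_cong) (simp add: space_restrict_space u_def)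
  moreover have "L2_norm (leb ?D) (\<lambda>x. mollify (1 / Suc n) u x - u x) \<le> L2_norm lborel (\<lambda>x. mollify (1 / Suc n) u x - u x)" for n
    by (rule L2_restrict(2)[OF open_half_space mollify_tendsto(2)[OF u]])
  ultimately have "L2_norm (leb ?D) h \<le> L2_norm lborel (\<lambda>x. mollify (1 / Suc n) u x - u x)" for n
    by simp
  then have "L2_norm (leb ?D) h \<le> 0"
    by (intro LIMSEQ_le_const[OF mollify_tendsto(1)[OF u]]) blast
  then show ?thesis using L2_norm_nonneg[of "leb ?D" h] L2_norm_zero_iff[OF h] by simp
qed

lemma L2_leb_times_test_integrable:
  fixes u \<eta> :: "'a::euclidean_space \<Rightarrow> real"
  assumes "open D" "u \<in> L2 (leb D)" "\<eta> \<in> test_functions UNIV"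
  shows "integrable (leb D) (\<lambda>x. u x * \<eta> x)"
  using L2_times_test_integrable[OF L2_extend_by_zero[OF assms(1,2)] assms(3)]
  unfolding restrict_lborel_simps(1)[OF assms(1)] by (simp add: mult.assoc)

lemma weak_gradient_unique:
  fixes e :: "'a::euclidean_space"
  assumes e: "e \<in> Basis" and G: "G \<in> L2 (leb (half_space e))" "is_weak_gradient (half_space e) \<psi> G"
    and H: "H \<in> L2 (leb (half_space e))" "is_weak_gradient (half_space e) \<psi> H"
  shows "AE x in leb (half_space e). G x = H x"
proof -
  have "AE x in leb (half_space e). G x \<bullet> b - H x \<bullet> b = 0" if b: "b \<in> Basis" for b
  proof (rule fundamental_lemma[OF e L2_diff(1)])
    fix \<eta> :: "'a \<Rightarrow> real" assume \<eta>: "\<eta> \<in> test_functions (half_space e)"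
    have t: "\<eta> \<in> test_functions UNIV" by (rule test_functions_mono[OF _ \<eta>]) simp
    have "(\<integral>x. (G x \<bullet> b) * \<eta> x \<partial>leb (half_space e)) = (\<integral>x. (H x \<bullet> b) * \<eta> x \<partial>leb (half_space e))"
      using bspec[OF bspec[OF G(2)[unfolded is_weak_gradient_def] \<eta>] b]
        bspec[OF bspec[OF H(2)[unfolded is_weak_gradient_def] \<eta>] b] by linarith
    then show "(\<integral>x. (G x \<bullet> b - H x \<bullet> b) * \<eta> x \<partial>leb (half_space e)) = 0"
      using L2_leb_times_test_integrable[OF open_half_space L2_component(1)[OF G(1) b] t]
        L2_leb_times_test_integrable[OF open_half_space L2_component(1)[OF H(1) b] t]
      by (simp add: left_diff_distrib)
  qed (intro L2_component G H b)+
  then have "AE x in leb (half_space e). \<forall>b\<in>Basis. G x \<bullet> b - H x \<bullet> b = 0"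
    by (intro AE_finite_allI) auto
  then show ?thesis
  proof eventually_elim
    fix x assume "\<forall>b\<in>Basis. G x \<bullet> b - H x \<bullet> b = 0"
    then show "G x = H x" by (subst euclidean_eq_iff) simp
  qed
qed

lemma L2_sum:
  fixes f :: "'i \<Rightarrow> 'a \<Rightarrow> 'b::euclidean_space"
  assumes "\<And>i. i \<in> I \<Longrightarrow> f i \<in> L2 M" 
  shows "(\<lambda>x. \<Sum>i\<in>I. f i x) \<in> L2 M \<and> L2_norm M (\<lambda>x. \<Sum>i\<in>I. f i x) \<le> (\<Sum>i\<in>I. L2_norm M (f i))"
  using assms
proof (induction I rule: infinite_finite_induct)
  case (insert i I)
  then show ?case using L2_add[of "f i" M "\<lambda>x. \<Sum>i\<in>I. f i x"] by auto
qed (auto simp: L2_def L2_norm_def)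

lemma L2_vector:
  fixes w :: "'a \<Rightarrow> 'b::euclidean_space"
  assumes "w \<in> borel_measurable M" "\<And>b. b \<in> Basis \<Longrightarrow> (\<lambda>x. w x \<bullet> b) \<in> L2 M"
  shows "w \<in> L2 M" "L2_norm M w \<le> (\<Sum>b\<in>Basis. L2_norm M (\<lambda>x. w x \<bullet> b))"
proof -
  have a: "(\<lambda>x. \<bar>w x \<bullet> b\<bar>) \<in> L2 M" if "b \<in> Basis" for b
    using L2_mono(1)[OF assms(2)[OF that], of "\<lambda>x. \<bar>w x \<bullet> b\<bar>" 1] L2_measurable[OF assms(2)[OF that]] by auto
  note s = L2_sum[of Basis "\<lambda>b x. \<bar>w x \<bullet> b\<bar>" M, OF a]
  have le: "norm (w x) \<le> 1 * norm (\<Sum>b\<in>Basis. \<bar>w x \<bullet> b\<bar>)" for x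
    using norm_le_l1[of "w x"] by simp
  show "w \<in> L2 M" using L2_mono(1)[OF conjunct1[OF s] assms(1) le] by simp
  have "L2_norm M w \<le> L2_norm M (\<lambda>x. \<Sum>b\<in>Basis. \<bar>w x \<bullet> b\<bar>)"
    using L2_mono(2)[OF conjunct1[OF s] assms(1) le] by simp
  also have "\<dots> \<le> (\<Sum>b\<in>Basis. L2_norm M (\<lambda>x. \<bar>w x \<bullet> b\<bar>))" using s by simp
  also have "\<dots> = (\<Sum>b\<in>Basis. L2_norm M (\<lambda>x. w x \<bullet> b))" by (intro sum.cong refl L2_norm_cong) simp
  finally show "L2_norm M w \<le> (\<Sum>b\<in>Basis. L2_norm M (\<lambda>x. w x \<bullet> b))" .
qed

lemma grad_L2:
  assumes "\<eta> \<in> test_functions UNIV" shows "grad \<eta> \<in> L2 lborel"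
proof (rule L2_vector)
  have "smooth \<eta>" using assms by (metis test_functionsE)
  then show "grad \<eta> \<in> borel_measurable lborel" using continuous_imp_borel[OF continuous_grad] by simp
  show "(\<lambda>x. grad \<eta> x \<bullet> b) \<in> L2 lborel" if "b \<in> Basis" for b
    using test_functions_L2[OF test_functions_pd[OF assms that]] by (simp add: grad_inner that)
qed

lemma grad_is_weak_gradient:
  assumes "open D" "\<eta> \<in> test_functions UNIV" shows "is_weak_gradient D \<eta> (grad \<eta>)"
  unfolding is_weak_gradient_def
proof (intro ballI)
  fix \<zeta> b assume z: "\<zeta> \<in> test_functions D" and b: "(b::'a) \<in> Basis"
  have "\<zeta> \<in> test_functions UNIV" by (rule test_functions_mono[OF _ z]) simp
  from integration_by_parts[OF assms(2) this b]
  show "(\<integral>x. \<eta> x * pd \<zeta> b x \<partial>leb D) = - (\<integral>x. grad \<eta> x \<bullet> b * \<zeta> x \<partial>leb D)"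
    unfolding integral_test_support(1)[OF assms(1) z] integral_test_support(1)[OF assms(1) test_functions_pd[OF z b]]
    by (simp add: grad_inner b)
qed

lemma H1D: "\<psi> \<in> H1 D \<Longrightarrow> \<psi> \<in> L2 (leb D)" "\<psi> \<in> H1 D \<Longrightarrow> weak_gradient D \<psi> \<in> L2 (leb D)"
  "\<psi> \<in> H1 D \<Longrightarrow> is_weak_gradient D \<psi> (weak_gradient D \<psi>)"
proof -
  assume "\<psi> \<in> H1 D"
  then have "\<exists>G. G \<in> L2 (leb D) \<and> is_weak_gradient D \<psi> G" by (auto simp: H1_def)
  from someI_ex[OF this] show "weak_gradient D \<psi> \<in> L2 (leb D)" "is_weak_gradient D \<psi> (weak_gradient D \<psi>)"
    by (auto simp: weak_gradient_def)
qed (auto simp: H1_def)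

lemma test_functions_H1: 
  assumes "open D" "\<eta> \<in> test_functions UNIV" shows "\<eta> \<in> H1 D"
  unfolding H1_def using assms grad_is_weak_gradient L2_restrict(1)[OF assms(1) grad_L2[OF assms(2)]] 
    L2_restrict(1)[OF assms(1) test_functions_L2[OF assms(2)]] by auto

lemma weak_gradient_diff:
  fixes D :: "'a::euclidean_space set"
  assumes D: "open D" and "\<psi> \<in> L2 (leb D)" "\<omega> \<in> L2 (leb D)" "G \<in> L2 (leb D)" "H \<in> L2 (leb D)"
    "is_weak_gradient D \<psi> G" "is_weak_gradient D \<omega> H"
  shows "is_weak_gradient D (\<lambda>x. \<psi> x - \<omega> x) (\<lambda>x. G x - H x)"
  unfolding is_weak_gradient_def
proof (intro ballI)
  fix \<zeta> b assume z: "\<zeta> \<in> test_functions D" and b: "(b::'a) \<in> Basis"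
  have t: "\<zeta> \<in> test_functions UNIV" "pd \<zeta> b \<in> test_functions UNIV"
    by (auto intro: test_functions_mono[OF _ z] test_functions_mono[OF _ test_functions_pd[OF z b]])
  show "(\<integral>x. (\<psi> x - \<omega> x) * pd \<zeta> b x \<partial>leb D) = - (\<integral>x. (G x - H x) \<bullet> b * \<zeta> x \<partial>leb D)"
    using assms(6,7) z b L2_leb_times_test_integrable[OF D assms(2) t(2)] L2_leb_times_test_integrable[OF D assms(3) t(2)]
      L2_leb_times_test_integrable[OF D L2_component(1)[OF assms(4) b] t(1)]
      L2_leb_times_test_integrable[OF D L2_component(1)[OF assms(5) b] t(1)]
    unfolding is_weak_gradient_def by (simp add: left_diff_distrib inner_diff_left)
qed

lemma H1_norm_eq:
  fixes e :: "'a::euclidean_space"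
  assumes e: "e \<in> Basis" and G: "G \<in> L2 (leb (half_space e))" "is_weak_gradient (half_space e) \<psi> G"
    and \<psi>: "\<psi> \<in> L2 (leb (half_space e))"
  shows "H1_norm (half_space e) \<psi> = sqrt ((L2_norm (leb (half_space e)) \<psi>)\<^sup>2 + (L2_norm (leb (half_space e)) G)\<^sup>2)"
    "L2_norm (leb (half_space e)) (weak_gradient (half_space e) \<psi>) = L2_norm (leb (half_space e)) G"
    "AE x in leb (half_space e). weak_gradient (half_space e) \<psi> x = G x"
proof -
  have H: "\<psi> \<in> H1 (half_space e)" unfolding H1_def using \<psi> G by blast
  show *: "AE x in leb (half_space e). weak_gradient (half_space e) \<psi> x = G x"
    by (rule weak_gradient_unique[OF e H1D(2,3)[OF H] G])
  show "L2_norm (leb (half_space e)) (weak_gradient (half_space e) \<psi>) = L2_norm (leb (half_space e)) G"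
    by (rule L2_norm_cong_AE[OF L2_measurable[OF H1D(2)[OF H]] L2_measurable[OF G(1)] *])
  then show "H1_norm (half_space e) \<psi> = sqrt ((L2_norm (leb (half_space e)) \<psi>)\<^sup>2 + (L2_norm (leb (half_space e)) G)\<^sup>2)"
    by (simp add: H1_norm_def)
qed

lemma H1_norm_dist:
  fixes e :: "'a::euclidean_space"
  assumes e: "e \<in> Basis" and \<eta>: "\<eta> \<in> test_functions UNIV" and \<psi>: "\<psi> \<in> L2 (leb (half_space e))" 
    and G: "G \<in> L2 (leb (half_space e))" "is_weak_gradient (half_space e) \<psi> G"
  shows "H1_norm (half_space e) (\<lambda>x. \<eta> x - \<psi> x) =
     sqrt ((L2_norm (leb (half_space e)) (\<lambda>x. \<eta> x - \<psi> x))\<^sup>2 + (L2_norm (leb (half_space e)) (\<lambda>x. grad \<eta> x - G x))\<^sup>2)"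
proof -
  note l = L2_restrict(1)[OF open_half_space test_functions_L2[OF \<eta>], of e] L2_restrict(1)[OF open_half_space grad_L2[OF \<eta>], of e]
  show ?thesis
    by (rule H1_norm_eq(1)[OF e L2_diff(1)[OF l(2) G(1)]
          weak_gradient_diff[OF open_half_space l(1) \<psi> l(2) G(1) grad_is_weak_gradient[OF open_half_space \<eta>] G(2)]
          L2_diff(1)[OF l(1) \<psi>]])
qed

section \<open>Density of test functions\<close>

text \<open>Normalised to \<open>1\<close> at the origin, so that the dilations \<open>cutoff (x / n)\<close>, which are uniformly bounded,
converge to \<open>1\<close> pointwise and dominated convergence applies.\<close>

definition cutoff :: "'a::euclidean_space \<Rightarrow> real" where
  "cutoff x = box_bump (x + (1/2) *\<^sub>R One) / box_bump ((1/2) *\<^sub>R (One::'a))"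

lemma cutoff_test: "cutoff \<in> test_functions (UNIV :: 'a::euclidean_space set)"
proof -
  have "(\<lambda>x::'a. box_bump (x - - ((1/2) *\<^sub>R One))) \<in> test_functions UNIV"
    by (rule test_functions_shift[OF box_bump_test])
  from test_functions_mult[OF this smooth_const[of "inverse (box_bump ((1/2) *\<^sub>R (One::'a)))"]]
  show ?thesis unfolding cutoff_def[abs_def] divide_inverse diff_minus_eq_add .
qed

lemma cutoff_0: "cutoff (0::'a::euclidean_space) = 1"
proof -
  have "box_bump ((1/2) *\<^sub>R (One::'a)) > 0" by (rule box_bump_pos) (auto simp: mem_box)
  then show ?thesis by (simp add: cutoff_def)
qed

lemma test_functions_scale:
  fixes \<eta> :: "'a::euclidean_space \<Rightarrow> real"
  assumes "\<eta> \<in> test_functions UNIV" "c > 0" 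
  shows "(\<lambda>x. \<eta> (c *\<^sub>R x)) \<in> test_functions UNIV" "pd (\<lambda>x. \<eta> (c *\<^sub>R x)) b x = c * pd \<eta> b (c *\<^sub>R x)"
proof -
  obtain S where S: "smooth \<eta>" "compact S" "\<And>x. x \<notin> S \<Longrightarrow> \<eta> x = 0" using assms by (metis test_functionsE)
  have "smooth (\<lambda>x. \<eta> (c *\<^sub>R x + 0))" 
    by (rule smooth_affine[OF bounded_linear_scaleR_right S(1)])
  moreover have "compact ((*\<^sub>R) (inverse c) ` S)" using S(2) by (rule compact_scaling)
  moreover have "\<eta> (c *\<^sub>R x) = 0" if "x \<notin> (*\<^sub>R) (inverse c) ` S" for x
  proof (rule S(3), rule)
    assume "c *\<^sub>R x \<in> S"
    then have "inverse c *\<^sub>R (c *\<^sub>R x) \<in> (*\<^sub>R) (inverse c) ` S" by (rule imageI)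
    then show False using that assms(2) by simp
  qed
  ultimately show "(\<lambda>x. \<eta> (c *\<^sub>R x)) \<in> test_functions UNIV"
    using test_functionsI[of "\<lambda>x. \<eta> (c *\<^sub>R x)" "(*\<^sub>R) (inverse c) ` S" UNIV] unfolding add_0_right by blast
  have "((\<lambda>x. \<eta> (c *\<^sub>R x + 0)) has_derivative (\<lambda>h. frechet_derivative \<eta> (at (c *\<^sub>R x + 0)) (c *\<^sub>R h))) (at x)"
    by (rule has_derivative_affine_comp[OF smooth_differentiable[OF S(1)] bounded_linear_scaleR_right])
  from frechet_derivative_eqI[OF this]
  have "pd (\<lambda>x. \<eta> (c *\<^sub>R x)) b x = frechet_derivative \<eta> (at (c *\<^sub>R x)) (c *\<^sub>R b)"
    unfolding add_0_right by (rule fun_cong)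
  then show "pd (\<lambda>x. \<eta> (c *\<^sub>R x)) b x = c * pd \<eta> b (c *\<^sub>R x)"
    unfolding frechet_grad[OF S(1)] inner_scaleR_right .
qed

definition cut_mollify :: "nat \<Rightarrow> ('a::euclidean_space \<Rightarrow> real) \<Rightarrow> 'a \<Rightarrow> real" where
  "cut_mollify n u x = cutoff ((1 / Suc n) *\<^sub>R x) * mollify (1 / Suc n) u x"

lemma mollify_smooth:
  assumes "u \<in> L2 lborel" shows "smooth (mollify (1 / Suc n) u)"
  using smooth_convolve[OF scaled_mollifier_test assms, of "1 / Suc n"] L2_measurable[OF assms]
  by (simp add: mollify_eq_convolve)

lemma cut_mollify_test:
  assumes "u \<in> L2 lborel" shows "cut_mollify n u \<in> test_functions UNIV"
  unfolding cut_mollify_def[abs_def]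
  by (intro test_functions_mult test_functions_scale cutoff_test mollify_smooth assms) simp

text \<open>The error splits into the mollification error times a bounded factor and the truncation error of \<open>u\<close>
itself.\<close>

lemma cut_mollify_tendsto:
  fixes u :: "'a::euclidean_space \<Rightarrow> real"
  assumes u: "u \<in> L2 lborel" shows "(\<lambda>n. L2_norm lborel (\<lambda>x. cut_mollify n u x - u x)) \<longlonglongrightarrow> 0"
proof -
  obtain C where C: "C \<ge> 0" "\<And>x::'a. \<bar>cutoff x\<bar> \<le> C" using test_functions_bounded[OF cutoff_test] by blast
  have [measurable]: "u \<in> borel_measurable borel" using L2_measurable[OF u] by simp
  have cs: "smooth (cutoff :: 'a \<Rightarrow> real)" using cutoff_test by (rule test_functionsE)
  have [measurable]: "(cutoff :: 'a \<Rightarrow> real) \<in> borel_measurable borel" by (rule smooth_borel[OF cs])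
  have m[measurable]: "mollify (1 / Suc n) u \<in> borel_measurable borel" for n by (rule smooth_borel[OF mollify_smooth[OF u]])
  define A where "A n x = cutoff ((1 / Suc n) *\<^sub>R x) * (mollify (1 / Suc n) u x - u x)" for n x
  define B where "B n x = (cutoff ((1 / Suc n) *\<^sub>R x) - 1) * u x" for n x
  have [measurable]: "A n \<in> borel_measurable borel" "B n \<in> borel_measurable borel" for n
    unfolding A_def B_def by measurable
  have aa: "norm (A n x) \<le> C * norm (mollify (1 / Suc n) u x - u x)" for n x
    unfolding A_def norm_mult real_norm_def abs_mult by (intro mult_right_mono C) simp
  have A: "A n \<in> L2 lborel" "L2_norm lborel (A n) \<le> C * L2_norm lborel (\<lambda>x. mollify (1 / Suc n) u x - u x)" for n
    by (rule L2_mono[OF mollify_tendsto(2)[OF u] _ aa], simp) (rule L2_mono(2)[OF mollify_tendsto(2)[OF u] _ aa C(1)], simp)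
  have bb: "\<bar>B n x\<bar> \<le> (C + 1) * \<bar>u x\<bar>" for n x
  proof -
    have "\<bar>cutoff ((1 / Suc n) *\<^sub>R x) - 1\<bar> \<le> C + 1" using C(2)[of "(1 / Suc n) *\<^sub>R x"] by linarith
    then show ?thesis unfolding B_def abs_mult by (rule mult_right_mono) simp
  qed
  have B: "B n \<in> L2 lborel" for n
    by (rule L2_mono(1)[OF u, of _ "C + 1"]) (simp_all only: real_norm_def bb, simp)
  have "(\<lambda>n. \<integral>x. (norm (B n x))\<^sup>2 \<partial>lborel) \<longlonglongrightarrow> (\<integral>x. 0 \<partial>(lborel :: 'a measure))"
  proof (rule integral_dominated_convergence)
    show "integrable lborel (\<lambda>x. (C + 1)\<^sup>2 * (norm (u x))\<^sup>2)" using L2_integrable[OF u] by simp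
    show "AE x in lborel. norm ((norm (B n x))\<^sup>2) \<le> (C + 1)\<^sup>2 * (norm (u x))\<^sup>2" for n
    proof (rule AE_I2)
      fix x show "norm ((norm (B n x))\<^sup>2) \<le> (C + 1)\<^sup>2 * (norm (u x))\<^sup>2"
        using power_mono[OF bb[of n x], of 2] by (simp add: power_mult_distrib)
    qed
    show "AE x in lborel. (\<lambda>n. (norm (B n x))\<^sup>2) \<longlonglongrightarrow> 0"
    proof (rule AE_I2)
      fix x :: 'a
      have "isCont (cutoff :: 'a \<Rightarrow> real) 0"
        using smooth_continuous[OF cs, of UNIV] by (simp add: continuous_on_eq_continuous_at)
      moreover have "(\<lambda>n. (1 / real (Suc n)) *\<^sub>R x) \<longlonglongrightarrow> 0 *\<^sub>R x"
        using LIMSEQ_inverse_real_of_nat by (intro tendsto_scaleR tendsto_const) (simp add: inverse_eq_divide)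
      ultimately have "(\<lambda>n. cutoff ((1 / Suc n) *\<^sub>R x)) \<longlonglongrightarrow> cutoff (0::'a)"
        unfolding scaleR_zero_left by (rule isCont_tendsto_compose)
      then have "(\<lambda>n. (norm (B n x))\<^sup>2) \<longlonglongrightarrow> (norm ((cutoff (0::'a) - 1) * u x))\<^sup>2"
        unfolding B_def by (intro tendsto_intros)
      then show "(\<lambda>n. (norm (B n x))\<^sup>2) \<longlonglongrightarrow> 0" by (simp add: cutoff_0)
    qed
  qed auto
  then have "(\<lambda>n. L2_norm lborel (B n)) \<longlonglongrightarrow> sqrt (\<integral>x. 0 \<partial>(lborel :: 'a measure))"
    unfolding L2_norm_def by (rule tendsto_real_sqrt)
  then have Bl: "(\<lambda>n. L2_norm lborel (B n)) \<longlonglongrightarrow> 0" by simp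
  have "(\<lambda>n. C * L2_norm lborel (\<lambda>x. mollify (1 / Suc n) u x - u x) + L2_norm lborel (B n)) \<longlonglongrightarrow> C * 0 + 0"
    by (intro tendsto_intros mollify_tendsto u Bl)
  then have lim: "(\<lambda>n. C * L2_norm lborel (\<lambda>x. mollify (1 / Suc n) u x - u x) + L2_norm lborel (B n)) \<longlonglongrightarrow> 0" by simp
  have "L2_norm lborel (\<lambda>x. cut_mollify n u x - u x) \<le> C * L2_norm lborel (\<lambda>x. mollify (1 / Suc n) u x - u x) + L2_norm lborel (B n)" for n
  proof -
    have "(\<lambda>x. cut_mollify n u x - u x) = (\<lambda>x. A n x + B n x)"
      by (auto simp: A_def B_def cut_mollify_def algebra_simps)
    then show ?thesis using L2_add(2)[OF A(1) B, of n n] A(2)[of n] by simp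
  qed
  then show ?thesis
    by (intro Lim_null_comparison[OF _ lim] always_eventually) (simp add: L2_norm_nonneg)
qed

text \<open>The approximants are truncated mollifications of the extension of \<open>\<psi>\<close> by zero. Inside the half-space
their gradient is the truncated mollification of the weak gradient plus a term from the cutoff, which is of order \<open>1 / n\<close>.\<close>

lemma H1_density:
  fixes e :: "'a::euclidean_space"
  assumes e: "e \<in> Basis" and \<psi>: "\<psi> \<in> H1 (half_space e)"
  obtains \<eta> where "\<And>n. \<eta> n \<in> test_functions UNIV" 
    "(\<lambda>n::nat. H1_norm (half_space e) (\<lambda>x. \<eta> n x - \<psi> x)) \<longlonglongrightarrow> 0"
proof
  let ?D = "half_space e"
  define G where "G = weak_gradient ?D \<psi>"
  note H = H1D[OF \<psi>, folded G_def]
  define u where "u y = indicator ?D y * \<psi> y" for y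
  define g where "g b y = indicator ?D y * (G y \<bullet> b)" for b y
  have u: "u \<in> L2 lborel" unfolding u_def by (intro L2_extend_by_zero open_half_space H)
  have g: "g b \<in> L2 lborel" if "b \<in> Basis" for b unfolding g_def by (intro L2_extend_by_zero open_half_space L2_component H that)
  define \<eta> where "\<eta> n = cut_mollify n u" for n
  show t: "\<eta> n \<in> test_functions UNIV" for n unfolding \<eta>_def by (rule cut_mollify_test[OF u])
  have "L2_norm (leb ?D) (\<lambda>x. \<eta> n x - \<psi> x) \<le> L2_norm lborel (\<lambda>x. cut_mollify n u x - u x)" for n
  proof -
    have "L2_norm (leb ?D) (\<lambda>x. \<eta> n x - \<psi> x) = L2_norm (leb ?D) (\<lambda>x. cut_mollify n u x - u x)"
      by (rule L2_norm_cong) (simp add: \<eta>_def u_def space_restrict_space)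
    also have "\<dots> \<le> L2_norm lborel (\<lambda>x. cut_mollify n u x - u x)"
      by (intro L2_restrict open_half_space L2_diff test_functions_L2 cut_mollify_test u)
    finally show ?thesis .
  qed
  then have 1: "(\<lambda>n. L2_norm (leb ?D) (\<lambda>x. \<eta> n x - \<psi> x)) \<longlonglongrightarrow> 0"
    by (intro Lim_null_comparison[OF _ cut_mollify_tendsto[OF u]] always_eventually) (simp add: L2_norm_nonneg)
  have 2: "(\<lambda>n. L2_norm (leb ?D) (\<lambda>x. pd (\<eta> n) b x - G x \<bullet> b)) \<longlonglongrightarrow> 0" if b: "b \<in> Basis" for b
  proof -
    obtain C where C: "C \<ge> 0" "\<And>x::'a. \<bar>pd cutoff b x\<bar> \<le> C"
      using test_functions_bounded[OF test_functions_pd[OF cutoff_test b]] by blast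
    define A where "A n x = (1 / Suc n) * pd cutoff b ((1 / Suc n) *\<^sub>R x) * mollify (1 / Suc n) u x" for n x
    have t2: "(\<lambda>x. pd cutoff b ((1 / Suc n) *\<^sub>R x)) \<in> test_functions UNIV" for n
      by (rule test_functions_scale(1)[OF test_functions_pd[OF cutoff_test b]]) simp
    then have "(\<lambda>x. pd cutoff b ((1 / Suc n) *\<^sub>R x) * (1 / Suc n * mollify (1 / Suc n) u x)) \<in> test_functions UNIV" for n
      by (intro test_functions_mult[OF t2] smooth_mult smooth_const mollify_smooth u)
    moreover have "(\<lambda>x. pd cutoff b ((1 / Suc n) *\<^sub>R x) * (1 / Suc n * mollify (1 / Suc n) u x)) = A n" for n
      by (auto simp: A_def)
    ultimately have At: "A n \<in> test_functions UNIV" for n by metis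
    have A: "L2_norm lborel (A n) \<le> (1 / Suc n) * C * L2_norm lborel (mollify (1 / Suc n) u)" for n
    proof (rule L2_mono(2)[OF mollify_tendsto(3)[OF u]])
      show "A n \<in> borel_measurable lborel" using L2_measurable[OF test_functions_L2[OF At]] by simp
      fix x :: 'a
      have "\<bar>pd cutoff b ((1 / Suc n) *\<^sub>R x)\<bar> * (1 / Suc n * \<bar>mollify (1 / Suc n) u x\<bar>) \<le> C * (1 / Suc n * \<bar>mollify (1 / Suc n) u x\<bar>)"
        by (intro mult_right_mono C) simp
      then show "norm (A n x) \<le> 1 / Suc n * C * norm (mollify (1 / Suc n) u x)"
        by (simp add: A_def abs_mult mult_ac)
    qed (use C in auto)
    have pdx: "pd (\<eta> n) b x - G x \<bullet> b = A n x + (cut_mollify n (g b) x - g b x)" if x: "x \<in> ?D" for n x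
    proof -
      have "pd (\<eta> n) b x = cutoff ((1 / Suc n) *\<^sub>R x) * pd (mollify (1 / Suc n) u) b x + pd (\<lambda>x. cutoff ((1 / Suc n) *\<^sub>R x)) b x * mollify (1 / Suc n) u x"
        unfolding \<eta>_def cut_mollify_def[abs_def]
        by (intro pd_mult mollify_smooth u) (metis test_functionsE test_functions_scale(1)[OF cutoff_test] of_nat_0_less_iff zero_less_Suc zero_less_divide_1_iff)
      also have "pd (\<lambda>x. cutoff ((1 / Suc n) *\<^sub>R x)) b x = (1 / Suc n) * pd cutoff b ((1 / Suc n) *\<^sub>R x)"
        by (rule test_functions_scale(2)[OF cutoff_test]) simp
      also have "pd (mollify (1 / Suc n) u) b x = mollify (1 / Suc n) (g b) x"
        unfolding u_def g_def by (rule pd_mollify[OF e H x _ b]) simp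
      finally show ?thesis using x by (simp add: A_def cut_mollify_def g_def)
    qed
    have le: "L2_norm (leb ?D) (\<lambda>x. pd (\<eta> n) b x - G x \<bullet> b) \<le> 
       (1 / Suc n) * C * L2_norm lborel (mollify (1 / Suc n) u) + L2_norm lborel (\<lambda>x. cut_mollify n (g b) x - g b x)" for n
    proof -
      have i: "(\<lambda>x. cut_mollify n (g b) x - g b x) \<in> L2 lborel"
        by (intro L2_diff test_functions_L2 cut_mollify_test g b)
      have "L2_norm (leb ?D) (\<lambda>x. pd (\<eta> n) b x - G x \<bullet> b) = L2_norm (leb ?D) (\<lambda>x. A n x + (cut_mollify n (g b) x - g b x))"
        by (rule L2_norm_cong) (simp add: pdx space_restrict_space)
      also have "\<dots> \<le> L2_norm lborel (\<lambda>x. A n x + (cut_mollify n (g b) x - g b x))"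
        by (intro L2_restrict open_half_space L2_add i test_functions_L2 At)
      also have "\<dots> \<le> L2_norm lborel (A n) + L2_norm lborel (\<lambda>x. cut_mollify n (g b) x - g b x)"
        by (intro L2_add i test_functions_L2 At)
      finally show ?thesis using A[of n] by linarith
    qed
    have "(\<lambda>n. (1 / Suc n) * C * L2_norm lborel (mollify (1 / Suc n) u) + L2_norm lborel (\<lambda>x. cut_mollify n (g b) x - g b x))
      \<longlonglongrightarrow> 0 * C * L2_norm lborel u + 0"
      using LIMSEQ_inverse_real_of_nat
      by (intro tendsto_intros L2_norm_tendsto mollify_tendsto u cut_mollify_tendsto g b) (simp add: inverse_eq_divide)
    then have "(\<lambda>n. (1 / Suc n) * C * L2_norm lborel (mollify (1 / Suc n) u) + L2_norm lborel (\<lambda>x. cut_mollify n (g b) x - g b x)) \<longlonglongrightarrow> 0"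
      by simp
    then show ?thesis 
      by (rule Lim_null_comparison[OF always_eventually, rotated]) (use le in \<open>auto simp: L2_norm_nonneg\<close>)
  qed
  have gL: "(\<lambda>x. grad (\<eta> n) x - G x) \<in> L2 (leb ?D)" for n
    by (intro L2_diff L2_restrict open_half_space grad_L2 t H)
  have le3: "L2_norm (leb ?D) (\<lambda>x. grad (\<eta> n) x - G x) \<le> (\<Sum>b\<in>Basis. L2_norm (leb ?D) (\<lambda>x. pd (\<eta> n) b x - G x \<bullet> b))" for n
    using L2_vector(2)[OF L2_measurable[OF gL[of n]] L2_component(1)[OF gL[of n]]] by (simp add: inner_diff_left grad_inner)
  have "(\<lambda>n. \<Sum>b\<in>Basis. L2_norm (leb ?D) (\<lambda>x. pd (\<eta> n) b x - G x \<bullet> b)) \<longlonglongrightarrow> 0"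
    by (intro tendsto_null_sum 2)
  then have 3: "(\<lambda>n. L2_norm (leb ?D) (\<lambda>x. grad (\<eta> n) x - G x)) \<longlonglongrightarrow> 0"
    by (rule Lim_null_comparison[OF always_eventually, rotated]) (use le3 in \<open>auto simp: L2_norm_nonneg\<close>)
  have "(\<lambda>n. sqrt ((L2_norm (leb ?D) (\<lambda>x. \<eta> n x - \<psi> x))\<^sup>2 + (L2_norm (leb ?D) (\<lambda>x. grad (\<eta> n) x - G x))\<^sup>2)) \<longlonglongrightarrow> sqrt (0\<^sup>2 + 0\<^sup>2)"
    by (intro tendsto_intros 1 3)
  then show "(\<lambda>n. H1_norm ?D (\<lambda>x. \<eta> n x - \<psi> x)) \<longlonglongrightarrow> 0"
    by (simp add: H1_norm_dist[OF e t H])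
qed

section \<open>Traces on the boundary hyperplane\<close>

text \<open>For a smooth function \<open>u\<close> with normal derivative \<open>v\<close> the integrand is the derivative of
\<open>- (1 - t) u (x + t e)\<close>, so the value is \<open>u x\<close>. The formula makes sense for arbitrary square-integrable
\<open>u\<close> and \<open>v\<close> and thus defines the trace without a limit process.\<close>

definition trace_op :: "'a::euclidean_space \<Rightarrow> ('a \<Rightarrow> real) \<Rightarrow> ('a \<Rightarrow> real) \<Rightarrow> 'a \<Rightarrow> real" where
  "trace_op e u v x = (\<integral>t. indicator {0<..1} t * (indicator (half_space e) (x + t *\<^sub>R e) * (u (x + t *\<^sub>R e) - (1 - t) * v (x + t *\<^sub>R e))) \<partial>lborel)"

lemma indicator_Ioc_integrable: "integrable lborel (indicator {0<..1::real} :: real \<Rightarrow> real)"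
   "(\<integral>t. indicator {0<..1::real} t \<partial>lborel) = (1::real)"
  by simp_all

lemma trace_test:
  fixes \<eta> :: "'a::euclidean_space \<Rightarrow> real"
  assumes "smooth \<eta>" "e \<in> Basis" "x \<bullet> e = 0"
  shows "integrable lborel (\<lambda>t. indicator {0<..1} t * (indicator (half_space e) (x + t *\<^sub>R e) * (\<eta> (x + t *\<^sub>R e) - (1 - t) * pd \<eta> e (x + t *\<^sub>R e))))" (is "integrable _ ?f")
    "trace_op e \<eta> (pd \<eta> e) x = \<eta> x"
proof -
  have [measurable]: "\<eta> \<in> borel_measurable borel" "pd \<eta> e \<in> borel_measurable borel"
    by (rule smooth_borel[OF assms(1)], rule smooth_borel[OF smooth_pd[OF assms(1,2)]])
  define F where "F t = - (1 - t) * \<eta> (x + t *\<^sub>R e)" for t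
  define f where "f t = \<eta> (x + t *\<^sub>R e) - (1 - t) * pd \<eta> e (x + t *\<^sub>R e)" for t
  have D: "(F has_real_derivative f t) (at t within S)" for t S
    unfolding F_def f_def
    by (auto intro!: derivative_eq_intros has_field_derivative_at_within[OF slice_has_derivative[OF assms(1)]]
        simp: algebra_simps)
  have cf: "continuous_on {0..1} f"
    unfolding f_def
    by (intro continuous_intros smooth_continuous[OF smooth_slice[OF assms(1)]]
        smooth_continuous[OF smooth_slice[OF smooth_pd[OF assms(1,2)]]])
  have eq: "AE t in lborel. ?f t = indicator {0..1} t * f t"
  proof -
    have "AE t in lborel. t \<noteq> (0::real)" by (rule AE_lborel_singleton)
    then show ?thesis
      by (rule AE_mp) (use assms in \<open>auto intro!: AE_I2 simp: indicator_def f_def half_space_def inner_add_left\<close>)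
  qed
  note FT = FTC_lborel[of 0 1 F f, OF _ D cf, simplified]
  have m: "?f \<in> borel_measurable lborel"
    by measurable
  have m2: "(\<lambda>t. indicator {0..1} t * f t) \<in> borel_measurable lborel" using FT(1) by (rule borel_measurable_integrable)
  show "integrable lborel ?f" using integrable_cong_AE[OF m m2 eq] FT(1) by simp
  have "trace_op e \<eta> (pd \<eta> e) x = (\<integral>t. indicator {0..1} t * f t \<partial>lborel)"
    unfolding trace_op_def by (rule integral_cong_AE[OF m m2 eq])
  also have "\<dots> = \<eta> x" using FT(2) by (simp add: F_def)
  finally show "trace_op e \<eta> (pd \<eta> e) x = \<eta> x" .
qed

text \<open>On almost every line both integrands are square-integrable, so Jensen's inequality on the unit interval
bounds the squared difference of the traces by the integral of \<open>2 (\<eta> - u)\<^sup>2 + 2 (\<partial>\<^sub>e\<eta> - v)\<^sup>2\<close> along the line. Integrating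
over the hyperplane gives the claim.\<close>

lemma trace_estimate:
  fixes e :: "'a::euclidean_space"
  assumes e: "e \<in> Basis" and u: "u \<in> L2 (leb (half_space e))" and v: "v \<in> L2 (leb (half_space e))"
    and \<eta>: "\<eta> \<in> test_functions UNIV"
  shows "(\<lambda>x. \<eta> x - trace_op e u v x) \<in> L2 (hyperplane_measure e)"
   "(L2_norm (hyperplane_measure e) (\<lambda>x. \<eta> x - trace_op e u v x))\<^sup>2 \<le>
     2 * (L2_norm (leb (half_space e)) (\<lambda>x. \<eta> x - u x))\<^sup>2 + 2 * (L2_norm (leb (half_space e)) (\<lambda>x. pd \<eta> e x - v x))\<^sup>2"
proof -
  let ?D = "half_space e" and ?\<sigma> = "hyperplane_measure e"
  let ?i = "indicator {0<..1::real} :: real \<Rightarrow> real" and ?d = "indicator ?D :: 'a \<Rightarrow> real"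
  have s: "smooth \<eta>" "smooth (pd \<eta> e)" using \<eta> test_functions_pd[OF \<eta> e] by (metis test_functionsE)+
  have [measurable]: "\<eta> \<in> borel_measurable borel" "pd \<eta> e \<in> borel_measurable borel" using s by (auto intro: smooth_borel)
  define u' v' where "u' x = ?d x * u x" and "v' x = ?d x * v x" for x
  have uv: "u' \<in> L2 lborel" "v' \<in> L2 lborel"
    unfolding u'_def v'_def by (intro L2_extend_by_zero open_half_space u v)+
  have [measurable]: "u' \<in> borel_measurable borel" "v' \<in> borel_measurable borel"
    using L2_measurable[OF uv(1)] L2_measurable[OF uv(2)] by auto
  define a where "a x t = u' (x + t *\<^sub>R e) - (1 - t) * v' (x + t *\<^sub>R e)" for x t
  define b where "b x t = ?d (x + t *\<^sub>R e) * (\<eta> (x + t *\<^sub>R e) - (1 - t) * pd \<eta> e (x + t *\<^sub>R e))" for x t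
  have [measurable]: "case_prod a \<in> borel_measurable (borel \<Otimes>\<^sub>M borel)" "case_prod b \<in> borel_measurable (borel \<Otimes>\<^sub>M borel)"
     "a x \<in> borel_measurable borel" "b x \<in> borel_measurable borel" for x
    unfolding a_def b_def by measurable
  have T: "trace_op e u v x = (\<integral>t. ?i t * a x t \<partial>lborel)" for x
    unfolding trace_op_def a_def u'_def v'_def by (simp add: algebra_simps)
  define P Q where "P x = 2 * (?d x * (\<eta> x - u x)\<^sup>2) + 2 * (?d x * (pd \<eta> e x - v x)\<^sup>2)"
    and "Q x = 2 * (u' x)\<^sup>2 + 2 * (v' x)\<^sup>2" for x
  have P': "P x = 2 * (?d x * \<eta> x - u' x)\<^sup>2 + 2 * (?d x * pd \<eta> e x - v' x)\<^sup>2" for x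
    by (auto simp: P_def u'_def v'_def indicator_def)
  have "(\<lambda>x. 2 * (?d x * \<eta> x - u' x)\<^sup>2 + 2 * (?d x * pd \<eta> e x - v' x)\<^sup>2) \<in> borel_measurable borel" by measurable
  then have mPQ[measurable]: "P \<in> borel_measurable borel" "Q \<in> borel_measurable borel"
    unfolding P'[abs_def, symmetric] Q_def by measurable
  have dd: "(\<lambda>x. \<eta> x - u x) \<in> L2 (leb ?D)" "(\<lambda>x. pd \<eta> e x - v x) \<in> L2 (leb ?D)"
    by (intro L2_diff L2_restrict open_half_space test_functions_L2 \<eta> test_functions_pd e u v)+
  have iP: "integrable lborel P" "(\<integral>x. P x \<partial>lborel) = 2 * (L2_norm (leb ?D) (\<lambda>x. \<eta> x - u x))\<^sup>2 + 2 * (L2_norm (leb ?D) (\<lambda>x. pd \<eta> e x - v x))\<^sup>2"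
    using L2_integrable[OF dd(1)] L2_integrable[OF dd(2)]
    by (simp_all add: P_def[abs_def] L2_norm_power2 restrict_lborel_simps[OF open_half_space])
  have iQ: "integrable lborel Q"
    using L2_integrable[OF uv(1)] L2_integrable[OF uv(2)] by (simp add: Q_def[abs_def])
  have nonneg: "P x \<ge> 0" "Q x \<ge> 0" for x by (auto simp: P_def Q_def)
  have sq: "(p - (1 - t) * q)\<^sup>2 \<le> 2 * p\<^sup>2 + 2 * q\<^sup>2" if "0 < t" "t \<le> 1" for p q t :: real
  proof -
    have "(p - (1 - t) * q)\<^sup>2 \<le> 2 * p\<^sup>2 + 2 * ((1 - t) * q)\<^sup>2"
      using zero_le_power2[of "p + (1 - t) * q"] by (simp add: power2_eq_square algebra_simps)
    also have "((1 - t) * q)\<^sup>2 \<le> q\<^sup>2"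
      unfolding power_mult_distrib using that by (intro mult_left_le_one_le) (auto intro!: power_le_one)
    finally show ?thesis by simp
  qed
  have aQ: "?i t * (a x t)\<^sup>2 \<le> Q (x + t *\<^sub>R e)" for x t
    using sq[of t "u' (x + t *\<^sub>R e)" "v' (x + t *\<^sub>R e)"] nonneg by (auto simp: indicator_def a_def Q_def)
  have abP: "?i t * (b x t - a x t)\<^sup>2 \<le> P (x + t *\<^sub>R e)" for x t
  proof -
    have "b x t - a x t = (?d (x + t *\<^sub>R e) * \<eta> (x + t *\<^sub>R e) - u' (x + t *\<^sub>R e)) - (1 - t) * (?d (x + t *\<^sub>R e) * pd \<eta> e (x + t *\<^sub>R e) - v' (x + t *\<^sub>R e))"
      by (simp add: a_def b_def algebra_simps)
    then show ?thesis using nonneg sq[of t] unfolding P' by (auto simp: indicator_def)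
  qed
  have slice_fin: "AE x in ?\<sigma>. (\<integral>\<^sup>+t. ennreal (R (x + t *\<^sub>R e)) \<partial>lborel) < \<infinity>" 
    if "integrable lborel R" "R \<in> borel_measurable borel" for R :: "'a \<Rightarrow> real"
  proof -
    note [measurable] = that(2)
    have "(\<integral>\<^sup>+x. ennreal (R x) \<partial>lborel) \<noteq> \<infinity>" using that(1) by (simp add: real_integrable_def)
    then have "(\<integral>\<^sup>+x. (\<integral>\<^sup>+t. ennreal (R (x + t *\<^sub>R e)) \<partial>lborel) \<partial>?\<sigma>) \<noteq> \<infinity>"
      by (simp add: nn_integral_lborel_slice[OF e])
    then have "AE x in ?\<sigma>. (\<integral>\<^sup>+t. ennreal (R (x + t *\<^sub>R e)) \<partial>lborel) \<noteq> \<infinity>"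
      by (intro nn_integral_PInf_AE) (auto simp: measurable_hyperplane)
    then show ?thesis by (simp add: less_top)
  qed
  have key: "AE x in ?\<sigma>. ennreal ((\<eta> x - trace_op e u v x)\<^sup>2) \<le> (\<integral>\<^sup>+t. ennreal (P (x + t *\<^sub>R e)) \<partial>lborel)"
    using AE_hyperplane[OF e] slice_fin[OF iP(1) mPQ(1)] slice_fin[OF iQ mPQ(2)]
  proof eventually_elim
    fix x assume x: "x \<bullet> e = 0" "(\<integral>\<^sup>+t. ennreal (P (x + t *\<^sub>R e)) \<partial>lborel) < \<infinity>" "(\<integral>\<^sup>+t. ennreal (Q (x + t *\<^sub>R e)) \<partial>lborel) < \<infinity>"
    have int: "integrable lborel (\<lambda>t. ?i t * (c t)\<^sup>2)" 
      if "\<And>t. ?i t * (c t)\<^sup>2 \<le> R (x + t *\<^sub>R e)" "(\<integral>\<^sup>+t. ennreal (R (x + t *\<^sub>R e)) \<partial>lborel) < \<infinity>" "c \<in> borel_measurable borel" for c R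
    proof (rule integrableI_nonneg)
      have "(\<integral>\<^sup>+t. ennreal (?i t * (c t)\<^sup>2) \<partial>lborel) \<le> (\<integral>\<^sup>+t. ennreal (R (x + t *\<^sub>R e)) \<partial>lborel)"
        by (intro nn_integral_mono ennreal_leI that)
      then show "(\<integral>\<^sup>+t. ennreal (?i t * (c t)\<^sup>2) \<partial>lborel) < \<infinity>" using that(2) by (rule le_less_trans)
    qed (use that in auto)
    have ia: "integrable lborel (\<lambda>t. ?i t * a x t)"
      by (rule jensen_square(1)[OF indicator_Ioc_integrable(1) _ indicator_Ioc_integrable(2) int[OF aQ x(3)]]) auto
    have ib: "integrable lborel (\<lambda>t. ?i t * b x t)" and Tb: "(\<integral>t. ?i t * b x t \<partial>lborel) = \<eta> x"
      using trace_test[OF s(1) e x(1)] by (simp_all add: b_def trace_op_def)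
    have iab: "integrable lborel (\<lambda>t. ?i t * (b x t - a x t)\<^sup>2)" by (rule int[OF abP x(2)]) auto
    have "\<eta> x - trace_op e u v x = (\<integral>t. ?i t * (b x t - a x t) \<partial>lborel)"
      using ia ib by (simp add: T Tb[symmetric] right_diff_distrib)
    then have "(\<eta> x - trace_op e u v x)\<^sup>2 \<le> (\<integral>t. ?i t * (b x t - a x t)\<^sup>2 \<partial>lborel)"
      using jensen_square(2)[OF indicator_Ioc_integrable(1) _ indicator_Ioc_integrable(2) iab] by simp
    then have "ennreal ((\<eta> x - trace_op e u v x)\<^sup>2) \<le> (\<integral>\<^sup>+t. ennreal (?i t * (b x t - a x t)\<^sup>2) \<partial>lborel)"
      by (subst nn_integral_eq_integral[OF iab]) (auto intro!: ennreal_leI)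
    also have "\<dots> \<le> (\<integral>\<^sup>+t. ennreal (P (x + t *\<^sub>R e)) \<partial>lborel)"
      by (intro nn_integral_mono ennreal_leI abP)
    finally show "ennreal ((\<eta> x - trace_op e u v x)\<^sup>2) \<le> (\<integral>\<^sup>+t. ennreal (P (x + t *\<^sub>R e)) \<partial>lborel)" .
  qed
  have mT: "(\<lambda>x. \<eta> x - trace_op e u v x) \<in> borel_measurable ?\<sigma>"
    unfolding measurable_hyperplane T by measurable
  have le: "(\<integral>\<^sup>+x. ennreal ((\<eta> x - trace_op e u v x)\<^sup>2) \<partial>?\<sigma>) \<le> ennreal (\<integral>x. P x \<partial>lborel)"
  proof -
    have "(\<integral>\<^sup>+x. ennreal ((\<eta> x - trace_op e u v x)\<^sup>2) \<partial>?\<sigma>) \<le> (\<integral>\<^sup>+x. (\<integral>\<^sup>+t. ennreal (P (x + t *\<^sub>R e)) \<partial>lborel) \<partial>?\<sigma>)"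
      by (rule nn_integral_mono_AE[OF key])
    also have "\<dots> = (\<integral>\<^sup>+x. ennreal (P x) \<partial>lborel)" by (simp add: nn_integral_lborel_slice[OF e])
    also have "\<dots> = ennreal (\<integral>x. P x \<partial>lborel)" by (rule nn_integral_eq_integral[OF iP(1)]) (simp add: nonneg)
    finally show ?thesis .
  qed
  have "integrable ?\<sigma> (\<lambda>x. (\<eta> x - trace_op e u v x)\<^sup>2)"
    using mT le by (intro integrableI_nonneg) (auto intro: le_less_trans)
  then show "(\<lambda>x. \<eta> x - trace_op e u v x) \<in> L2 ?\<sigma>" using mT by (simp add: L2_def)
  have "(L2_norm ?\<sigma> (\<lambda>x. \<eta> x - trace_op e u v x))\<^sup>2 \<le> (\<integral>x. P x \<partial>lborel)"
    using le mT nonneg(1) by (simp add: L2_norm_power2 integral_eq_nn_integral enn2real_leI Bochner_Integration.integral_nonneg)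
  then show "(L2_norm ?\<sigma> (\<lambda>x. \<eta> x - trace_op e u v x))\<^sup>2 \<le>
     2 * (L2_norm (leb ?D) (\<lambda>x. \<eta> x - u x))\<^sup>2 + 2 * (L2_norm (leb ?D) (\<lambda>x. pd \<eta> e x - v x))\<^sup>2"
    unfolding iP(2) .
qed

lemma grad_norm_ge: "b \<in> Basis \<Longrightarrow> \<bar>pd \<eta> b x\<bar> \<le> norm (grad \<eta> x)"
  using Basis_le_norm[of b "grad \<eta> x"] by (simp add: grad_inner)

lemma trace_op_bound:
  fixes e :: "'a::euclidean_space"
  assumes e: "e \<in> Basis" and \<psi>: "\<psi> \<in> L2 (leb (half_space e))" 
    and G: "G \<in> L2 (leb (half_space e))" "is_weak_gradient (half_space e) \<psi> G"
    and \<eta>: "\<eta> \<in> test_functions UNIV"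
  shows "(\<lambda>x. \<eta> x - trace_op e \<psi> (\<lambda>x. G x \<bullet> e) x) \<in> L2 (hyperplane_measure e)"
   "L2_norm (hyperplane_measure e) (\<lambda>x. \<eta> x - trace_op e \<psi> (\<lambda>x. G x \<bullet> e) x) \<le> 2 * H1_norm (half_space e) (\<lambda>x. \<eta> x - \<psi> x)"
proof -
  let ?D = "half_space e" and ?\<sigma> = "hyperplane_measure e"
  note T = trace_estimate[OF e \<psi> L2_component(1)[OF G(1) e] \<eta>]
  show "(\<lambda>x. \<eta> x - trace_op e \<psi> (\<lambda>x. G x \<bullet> e) x) \<in> L2 ?\<sigma>" by (rule T(1))
  define A B where "A = L2_norm (leb ?D) (\<lambda>x. \<eta> x - \<psi> x)" and "B = L2_norm (leb ?D) (\<lambda>x. grad \<eta> x - G x)"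
  have d: "(\<lambda>x. grad \<eta> x - G x) \<in> L2 (leb ?D)"
    by (rule L2_diff(1)[OF L2_restrict(1)[OF open_half_space grad_L2[OF \<eta>]] G(1)])
  have "L2_norm (leb ?D) (\<lambda>x. pd \<eta> e x - G x \<bullet> e) \<le> B"
    using L2_component(2)[OF d e] by (simp add: B_def inner_diff_left grad_inner e)
  then have "(L2_norm (leb ?D) (\<lambda>x. pd \<eta> e x - G x \<bullet> e))\<^sup>2 \<le> B\<^sup>2"
    by (rule power_mono) (rule L2_norm_nonneg)
  moreover have "(H1_norm ?D (\<lambda>x. \<eta> x - \<psi> x))\<^sup>2 = A\<^sup>2 + B\<^sup>2"
    unfolding H1_norm_dist[OF e \<eta> \<psi> G] A_def B_def by simp
  moreover have "0 \<le> A\<^sup>2" "0 \<le> B\<^sup>2" by simp_all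
  moreover have "(2 * H1_norm ?D (\<lambda>x. \<eta> x - \<psi> x))\<^sup>2 = 4 * (H1_norm ?D (\<lambda>x. \<eta> x - \<psi> x))\<^sup>2"
    by (simp add: power_mult_distrib)
  ultimately have "(L2_norm ?\<sigma> (\<lambda>x. \<eta> x - trace_op e \<psi> (\<lambda>x. G x \<bullet> e) x))\<^sup>2 \<le> (2 * H1_norm ?D (\<lambda>x. \<eta> x - \<psi> x))\<^sup>2"
    using T(2)[folded A_def] by linarith
  then show "L2_norm ?\<sigma> (\<lambda>x. \<eta> x - trace_op e \<psi> (\<lambda>x. G x \<bullet> e) x) \<le> 2 * H1_norm ?D (\<lambda>x. \<eta> x - \<psi> x)"
    by (rule power2_le_imp_le) (simp add: H1_norm_def)
qed

lemma zero_weak_gradient: "is_weak_gradient D (\<lambda>x. 0) (\<lambda>x. 0)"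
  by (simp add: is_weak_gradient_def)

lemma zero_L2: "(\<lambda>x. 0) \<in> L2 M"
  by (simp add: L2_def)

text \<open>The case \<open>u = v = 0\<close> of the trace estimate is the trace inequality for test functions.\<close>

lemma test_trace_bound:
  fixes e :: "'a::euclidean_space"
  assumes e: "e \<in> Basis" and \<eta>: "\<eta> \<in> test_functions UNIV"
  shows "\<eta> \<in> L2 (hyperplane_measure e)"
   "L2_norm (hyperplane_measure e) \<eta> \<le> 2 * H1_norm (half_space e) \<eta>"
  using trace_op_bound[OF e zero_L2 zero_L2 zero_weak_gradient \<eta>] by (simp_all add: trace_op_def)

lemma trace_op_L2:
  fixes e :: "'a::euclidean_space"
  assumes e: "e \<in> Basis" and \<psi>: "\<psi> \<in> H1 (half_space e)" 
  shows "trace_op e \<psi> (\<lambda>x. weak_gradient (half_space e) \<psi> x \<bullet> e) \<in> L2 (hyperplane_measure e)"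
proof -
  let ?g = "trace_op e \<psi> (\<lambda>x. weak_gradient (half_space e) \<psi> x \<bullet> e)"
  have "(\<lambda>x. mollifier x - (mollifier x - ?g x)) \<in> L2 (hyperplane_measure e)"
    by (rule L2_diff(1)[OF test_trace_bound(1)[OF e mollifier_test] trace_op_bound(1)[OF e H1D[OF \<psi>] mollifier_test]])
  then show ?thesis by simp
qed

text \<open>Existence of the trace: test functions converging in \<open>H\<^sup>1\<close> also converge on the hyperplane to the
value of the explicit trace operator.\<close>

lemma is_trace_trace_on:
  fixes e :: "'a::euclidean_space"
  assumes e: "e \<in> Basis" and \<psi>: "\<psi> \<in> H1 (half_space e)" 
  shows "is_trace (half_space e) (hyperplane_measure e) \<psi> (trace_on (half_space e) (hyperplane_measure e) \<psi>)"
proof -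
  let ?D = "half_space e" and ?\<sigma> = "hyperplane_measure e"
  let ?g = "trace_op e \<psi> (\<lambda>x. weak_gradient ?D \<psi> x \<bullet> e)"
  obtain \<eta> where \<eta>: "\<And>n. \<eta> n \<in> test_functions UNIV" "(\<lambda>n::nat. H1_norm ?D (\<lambda>x. \<eta> n x - \<psi> x)) \<longlonglongrightarrow> 0"
    using H1_density[OF e \<psi>] by metis
  have "(\<lambda>n. 2 * H1_norm ?D (\<lambda>x. \<eta> n x - \<psi> x)) \<longlonglongrightarrow> 2 * 0" by (intro tendsto_mult tendsto_const \<eta>(2))
  then have l: "(\<lambda>n. 2 * H1_norm ?D (\<lambda>x. \<eta> n x - \<psi> x)) \<longlonglongrightarrow> 0" by simp
  have "(\<lambda>n. L2_norm ?\<sigma> (\<lambda>x. \<eta> n x - ?g x)) \<longlonglongrightarrow> 0"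
    by (rule Lim_null_comparison[OF always_eventually l])
       (simp add: L2_norm_nonneg trace_op_bound(2)[OF e H1D[OF \<psi>] \<eta>(1)])
  then have "is_trace ?D ?\<sigma> \<psi> ?g"
    unfolding is_trace_def using trace_op_L2[OF e \<psi>] \<eta> by blast
  then show ?thesis unfolding trace_on_def by (rule someI[of "is_trace ?D ?\<sigma> \<psi>"])
qed

text \<open>Uniqueness of the trace: any two approximating sequences differ by test functions which are small in
\<open>H\<^sup>1\<close> and hence, by the trace inequality, on the hyperplane.\<close>

lemma trace_on_test:
  fixes e :: "'a::euclidean_space"
  assumes e: "e \<in> Basis" and \<eta>: "\<eta> \<in> test_functions UNIV"
  shows "(\<integral>x. (trace_on (half_space e) (hyperplane_measure e) \<eta> x)\<^sup>2 \<partial>hyperplane_measure e) = (\<integral>x. (\<eta> x)\<^sup>2 \<partial>hyperplane_measure e)"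
proof -
  let ?D = "half_space e" and ?\<sigma> = "hyperplane_measure e"
  let ?g = "trace_on ?D ?\<sigma> \<eta>"
  have it: "is_trace ?D ?\<sigma> \<eta> ?g" by (rule is_trace_trace_on[OF e test_functions_H1[OF open_half_space \<eta>]])
  then obtain \<zeta> where \<zeta>: "\<And>n. \<zeta> n \<in> test_functions UNIV" "(\<lambda>n::nat. H1_norm ?D (\<lambda>x. \<zeta> n x - \<eta> x)) \<longlonglongrightarrow> 0"
     "(\<lambda>n. L2_norm ?\<sigma> (\<lambda>x. \<zeta> n x - ?g x)) \<longlonglongrightarrow> 0" and g: "?g \<in> L2 ?\<sigma>"
    unfolding is_trace_def by blast
  have "(\<lambda>n. L2_norm ?\<sigma> (\<zeta> n)) \<longlonglongrightarrow> L2_norm ?\<sigma> ?g"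
    by (rule L2_norm_tendsto[OF g test_trace_bound(1)[OF e \<zeta>(1)] \<zeta>(3)])
  moreover have "(\<lambda>n. L2_norm ?\<sigma> (\<zeta> n)) \<longlonglongrightarrow> L2_norm ?\<sigma> \<eta>"
  proof (rule L2_norm_tendsto[OF test_trace_bound(1)[OF e \<eta>] test_trace_bound(1)[OF e \<zeta>(1)]])
    have "(\<lambda>n. 2 * H1_norm ?D (\<lambda>x. \<zeta> n x - \<eta> x)) \<longlonglongrightarrow> 2 * 0" by (intro tendsto_mult tendsto_const \<zeta>(2))
    then have l: "(\<lambda>n. 2 * H1_norm ?D (\<lambda>x. \<zeta> n x - \<eta> x)) \<longlonglongrightarrow> 0" by simp
    show "(\<lambda>n. L2_norm ?\<sigma> (\<lambda>x. \<zeta> n x - \<eta> x)) \<longlonglongrightarrow> 0"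
      by (rule Lim_null_comparison[OF always_eventually l])
         (simp add: L2_norm_nonneg test_trace_bound(2)[OF e test_functions_diff[OF \<zeta>(1) \<eta>]])
  qed
  ultimately have "L2_norm ?\<sigma> ?g = L2_norm ?\<sigma> \<eta>" by (rule LIMSEQ_unique)
  then have "(L2_norm ?\<sigma> ?g)\<^sup>2 = (L2_norm ?\<sigma> \<eta>)\<^sup>2" by simp
  then show ?thesis unfolding L2_norm_power2 by simp
qed

section \<open>Reduction of the eigenvalue to test functions\<close>

definition test_form :: "'a::euclidean_space \<Rightarrow> ('a \<Rightarrow> real) \<Rightarrow> real \<Rightarrow> ('a \<Rightarrow> real) \<Rightarrow> real" where
  "test_form e V \<beta> \<eta> = (\<integral>x. (norm (grad \<eta> x))\<^sup>2 + V x * (\<eta> x)\<^sup>2 \<partial>leb (half_space e)) + \<beta> * (\<integral>x. (\<eta> x)\<^sup>2 \<partial>hyperplane_measure e)"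

text \<open>For \<open>\<rho> = 0\<close> test functions vanish at the boundary, so any finite weight describes the same form; the value
\<open>0\<close> agrees with the absent boundary term.\<close>

definition robin_weight :: "real \<Rightarrow> real" where
  "robin_weight \<rho> = (if \<rho> = 0 then 0 else robin_coeff \<rho>)"

definition form_core :: "'a::euclidean_space \<Rightarrow> real \<Rightarrow> ('a \<Rightarrow> real) set" where
  "form_core e \<rho> = test_functions (if \<rho> = 0 then half_space e else UNIV)"

lemma form_core_test: "\<eta> \<in> form_core e \<rho> \<Longrightarrow> \<eta> \<in> test_functions UNIV"
  unfolding form_core_def by (rule test_functions_mono[OF subset_UNIV])

lemma robin_weight_nonneg: "0 \<le> \<rho> \<Longrightarrow> \<rho> \<le> 1 \<Longrightarrow> 0 \<le> robin_weight \<rho>"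
  by (simp add: robin_weight_def robin_coeff_def)

text \<open>Adding the constant \<open>C\<close> makes the potential nonnegative. The form is then a combination of squared \<open>L\<^sup>2\<close>
norms, which pass to limits by the triangle inequality.\<close>

lemma form_as_L2_norms:
  fixes D :: "'a::euclidean_space set"
  assumes V: "V \<in> borel_measurable (leb D)" "\<forall>x\<in>D. \<bar>V x\<bar> \<le> C" and \<psi>: "\<psi> \<in> L2 (leb D)" and G: "G \<in> L2 (leb D)"
  shows "(\<lambda>x. sqrt (V x + C) * \<psi> x) \<in> L2 (leb D)"
    "L2_norm (leb D) (\<lambda>x. sqrt (V x + C) * \<psi> x) \<le> sqrt (2 * \<bar>C\<bar>) * L2_norm (leb D) \<psi>"
    "(\<integral>x. (norm (G x))\<^sup>2 + V x * (\<psi> x)\<^sup>2 \<partial>leb D) = 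
      (L2_norm (leb D) G)\<^sup>2 + (L2_norm (leb D) (\<lambda>x. sqrt (V x + C) * \<psi> x))\<^sup>2 - C * (L2_norm (leb D) \<psi>)\<^sup>2"
proof -
  note [measurable] = V(1) L2_measurable[OF \<psi>]
  have m: "(\<lambda>x. sqrt (V x + C) * \<psi> x) \<in> borel_measurable (leb D)" by measurable
  have sp: "space (leb D) = D" by (simp add: space_restrict_space)
  have le: "norm (sqrt (V x + C) * \<psi> x) \<le> sqrt (2 * \<bar>C\<bar>) * norm (\<psi> x)" if "x \<in> space (leb D)" for x
  proof -
    have "0 \<le> V x + C" "V x + C \<le> 2 * \<bar>C\<bar>" using bspec[OF V(2), of x] that unfolding sp by (auto simp: abs_le_iff)
    then show ?thesis unfolding norm_mult by (intro mult_right_mono) auto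
  qed
  show l: "(\<lambda>x. sqrt (V x + C) * \<psi> x) \<in> L2 (leb D)" by (rule L2_mono(1)[OF \<psi> m le])
  show "L2_norm (leb D) (\<lambda>x. sqrt (V x + C) * \<psi> x) \<le> sqrt (2 * \<bar>C\<bar>) * L2_norm (leb D) \<psi>"
    by (rule L2_mono(2)[OF \<psi> m le]) simp_all
  have "(\<integral>x. (norm (G x))\<^sup>2 + V x * (\<psi> x)\<^sup>2 \<partial>leb D) = (\<integral>x. (norm (G x))\<^sup>2 + (norm (sqrt (V x + C) * \<psi> x))\<^sup>2 - C * (norm (\<psi> x))\<^sup>2 \<partial>leb D)"
  proof (rule Bochner_Integration.integral_cong[OF refl])
    fix x assume "x \<in> space (leb D)"
    then have "0 \<le> V x + C" using bspec[OF V(2), of x] unfolding sp by (auto simp: abs_le_iff)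
    then have "(norm (sqrt (V x + C) * \<psi> x))\<^sup>2 = (V x + C) * (\<psi> x)\<^sup>2"
      by (simp add: power_mult_distrib)
    then show "(norm (G x))\<^sup>2 + V x * (\<psi> x)\<^sup>2 = (norm (G x))\<^sup>2 + (norm (sqrt (V x + C) * \<psi> x))\<^sup>2 - C * (norm (\<psi> x))\<^sup>2"
      by (simp add: distrib_right)
  qed
  also have "\<dots> = (L2_norm (leb D) G)\<^sup>2 + (L2_norm (leb D) (\<lambda>x. sqrt (V x + C) * \<psi> x))\<^sup>2 - C * (L2_norm (leb D) \<psi>)\<^sup>2"
    unfolding L2_norm_power2
    by (subst Bochner_Integration.integral_diff Bochner_Integration.integral_add,
        (intro Bochner_Integration.integrable_add integrable_mult_right L2_integrable[OF G] L2_integrable[OF l] L2_integrable[OF \<psi>])+)+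
       simp
  finally show "(\<integral>x. (norm (G x))\<^sup>2 + V x * (\<psi> x)\<^sup>2 \<partial>leb D) = 
      (L2_norm (leb D) G)\<^sup>2 + (L2_norm (leb D) (\<lambda>x. sqrt (V x + C) * \<psi> x))\<^sup>2 - C * (L2_norm (leb D) \<psi>)\<^sup>2" .
qed

lemma form_domain_H1: "\<psi> \<in> form_domain D \<rho> \<Longrightarrow> \<psi> \<in> H1 D"
  by (auto simp: form_domain_def H1_0_def split: if_splits)

lemma mollifier_half_space:
  fixes e :: "'a::euclidean_space"
  assumes e: "e \<in> Basis"
  shows "mollifier \<in> test_functions (half_space e)" "L2_norm (leb (half_space e)) mollifier \<noteq> 0"
proof -
  show t: "mollifier \<in> test_functions (half_space e)"
  proof (rule test_functionsI[OF smooth_mollifier, of "cbox One (2 *\<^sub>R One)"])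
    show "cbox One (2 *\<^sub>R One) \<subseteq> half_space e"
      using e by (force simp: mem_box half_space_def)
  qed (auto simp: mollifier_zero)
  have l: "mollifier \<in> L2 (leb (half_space e))" by (rule L2_restrict(1)[OF open_half_space test_functions_L2[OF mollifier_test]])
  show "L2_norm (leb (half_space e)) mollifier \<noteq> 0"
  proof
    assume "L2_norm (leb (half_space e)) mollifier = 0"
    then have "AE x in leb (half_space e). mollifier x = 0" using L2_norm_zero_iff[OF l] by simp
    then have "(\<integral>x. 1 * mollifier x \<partial>leb (half_space e)) = 0" by (intro integral_eq_zero_AE) simp
    then show False unfolding integral_test_support(1)[OF open_half_space t] by (simp add: mollifier_integral)
  qed
qed

lemma form_core_domain: 
  assumes "\<eta> \<in> form_core e \<rho>" and e: "e \<in> Basis" shows "\<eta> \<in> form_domain (half_space e) \<rho>"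
proof -
  note t = form_core_test[OF assms(1)]
  have H: "\<eta> \<in> H1 (half_space e)" by (rule test_functions_H1[OF open_half_space t])
  have "H1_norm (half_space e) (\<lambda>x. \<eta> x - \<eta> x) = 0"
    using H1_norm_eq(1)[OF e zero_L2 zero_weak_gradient zero_L2] by (simp add: L2_norm_def)
  then have "\<eta> \<in> H1_0 (half_space e)" if "\<eta> \<in> test_functions (half_space e)"
    using that H unfolding H1_0_def by (auto intro!: exI[of _ "\<lambda>n. \<eta>"])
  then show ?thesis using assms(1) H by (auto simp: form_core_def form_domain_def split: if_splits)
qed

context
  fixes e :: "'a::euclidean_space" and V :: "'a \<Rightarrow> real" and C :: real
  assumes e: "e \<in> Basis"
    and V: "V \<in> borel_measurable (leb (half_space e))" "\<forall>x\<in>half_space e. \<bar>V x\<bar> \<le> C"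
begin

lemma form_bound_limit:
  assumes \<psi>: "\<psi> \<in> H1 (half_space e)" and \<eta>: "\<And>n. \<eta> n \<in> test_functions UNIV"
    and lim: "(\<lambda>n::nat. H1_norm (half_space e) (\<lambda>x. \<eta> n x - \<psi> x)) \<longlonglongrightarrow> 0"
    and g: "g \<in> L2 (hyperplane_measure e)" "(\<lambda>n. L2_norm (hyperplane_measure e) (\<lambda>x. \<eta> n x - g x)) \<longlonglongrightarrow> 0"
    and le: "\<And>n. c * (L2_norm (leb (half_space e)) (\<eta> n))\<^sup>2 \<le> test_form e V \<beta> (\<eta> n)"
  shows "c * (L2_norm (leb (half_space e)) \<psi>)\<^sup>2 \<le> 
     (\<integral>x. (norm (weak_gradient (half_space e) \<psi> x))\<^sup>2 + V x * (\<psi> x)\<^sup>2 \<partial>leb (half_space e)) + \<beta> * (\<integral>x. (g x)\<^sup>2 \<partial>hyperplane_measure e)"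
proof -
  let ?D = "half_space e" and ?\<sigma> = "hyperplane_measure e"
  define G where "G = weak_gradient ?D \<psi>"
  note H = H1D[OF \<psi>, folded G_def]
  have t: "\<eta> n \<in> L2 (leb ?D)" "grad (\<eta> n) \<in> L2 (leb ?D)" for n
    by (rule L2_restrict(1)[OF open_half_space test_functions_L2[OF \<eta>]],
        rule L2_restrict(1)[OF open_half_space grad_L2[OF \<eta>]])
  have hn: "H1_norm ?D (\<lambda>x. \<eta> n x - \<psi> x) = 
     sqrt ((L2_norm (leb ?D) (\<lambda>x. \<eta> n x - \<psi> x))\<^sup>2 + (L2_norm (leb ?D) (\<lambda>x. grad (\<eta> n) x - G x))\<^sup>2)" for n
    by (rule H1_norm_dist[OF e \<eta> H])
  have l0: "(\<lambda>n. L2_norm (leb ?D) (\<lambda>x. \<eta> n x - \<psi> x)) \<longlonglongrightarrow> 0"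
    by (rule Lim_null_comparison[OF always_eventually lim]) (simp add: hn L2_norm_nonneg real_le_rsqrt)
  have l1: "(\<lambda>n. L2_norm (leb ?D) (\<lambda>x. grad (\<eta> n) x - G x)) \<longlonglongrightarrow> 0"
    by (rule Lim_null_comparison[OF always_eventually lim]) (simp add: hn L2_norm_nonneg real_le_rsqrt)
  have "(\<lambda>n. sqrt (2 * \<bar>C\<bar>) * L2_norm (leb ?D) (\<lambda>x. \<eta> n x - \<psi> x)) \<longlonglongrightarrow> sqrt (2 * \<bar>C\<bar>) * 0"
    by (intro tendsto_mult tendsto_const l0)
  then have l2': "(\<lambda>n. sqrt (2 * \<bar>C\<bar>) * L2_norm (leb ?D) (\<lambda>x. \<eta> n x - \<psi> x)) \<longlonglongrightarrow> 0" by simp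
  note w = form_as_L2_norms(1)[OF V t(1) t(2)] form_as_L2_norms(1)[OF V H(1,2)] form_as_L2_norms(2)[OF V L2_diff(1)[OF t(1) H(1)] H(2)]
  have l2: "(\<lambda>n. L2_norm (leb ?D) (\<lambda>x. sqrt (V x + C) * \<eta> n x - sqrt (V x + C) * \<psi> x)) \<longlonglongrightarrow> 0"
    by (rule Lim_null_comparison[OF always_eventually l2'])
       (use w(3) in \<open>simp add: L2_norm_nonneg right_diff_distrib[symmetric]\<close>)
  note n0 = L2_norm_tendsto[OF H(1) t(1) l0]
  note n1 = L2_norm_tendsto[OF H(2) t(2) l1]
  note n2 = L2_norm_tendsto[OF w(2) w(1) l2]
  note n3 = L2_norm_tendsto[OF g(1) test_trace_bound(1)[OF e \<eta>] g(2)]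
  have tf: "test_form e V \<beta> (\<eta> n) = (L2_norm (leb ?D) (grad (\<eta> n)))\<^sup>2 + (L2_norm (leb ?D) (\<lambda>x. sqrt (V x + C) * \<eta> n x))\<^sup>2
      - C * (L2_norm (leb ?D) (\<eta> n))\<^sup>2 + \<beta> * (L2_norm ?\<sigma> (\<eta> n))\<^sup>2" for n
    unfolding test_form_def form_as_L2_norms(3)[OF V t(1)[of n] t(2)[of n]] by (simp add: L2_norm_power2)
  have "(\<lambda>n. test_form e V \<beta> (\<eta> n)) \<longlonglongrightarrow> (L2_norm (leb ?D) G)\<^sup>2 + (L2_norm (leb ?D) (\<lambda>x. sqrt (V x + C) * \<psi> x))\<^sup>2
      - C * (L2_norm (leb ?D) \<psi>)\<^sup>2 + \<beta> * (L2_norm ?\<sigma> g)\<^sup>2"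
    unfolding tf by (intro tendsto_intros n0 n1 n2 n3)
  moreover have "(\<lambda>n. c * (L2_norm (leb ?D) (\<eta> n))\<^sup>2) \<longlonglongrightarrow> c * (L2_norm (leb ?D) \<psi>)\<^sup>2"
    by (intro tendsto_intros n0)
  ultimately have "c * (L2_norm (leb ?D) \<psi>)\<^sup>2 \<le> (L2_norm (leb ?D) G)\<^sup>2 + (L2_norm (leb ?D) (\<lambda>x. sqrt (V x + C) * \<psi> x))\<^sup>2
      - C * (L2_norm (leb ?D) \<psi>)\<^sup>2 + \<beta> * (L2_norm ?\<sigma> g)\<^sup>2"
    using le by (intro LIMSEQ_le[of _ _ "\<lambda>n. test_form e V \<beta> (\<eta> n)"]) auto
  then show ?thesis
    unfolding G_def[symmetric] form_as_L2_norms(3)[OF V H(1,2)] by (simp add: L2_norm_power2)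
qed

text \<open>A lower bound on test functions extends to the whole form domain: for \<open>\<rho> > 0\<close> along the sequence that
comes with the trace, for \<open>\<rho> = 0\<close> along the sequence in the definition of \<open>H\<^sup>1\<^sub>0\<close>.\<close>

lemma quad_form_lower:
  assumes \<rho>: "0 \<le> \<rho>" "\<rho> \<le> 1" and \<psi>: "\<psi> \<in> form_domain (half_space e) \<rho>"
    and le: "\<And>\<eta>. \<eta> \<in> form_core e \<rho> \<Longrightarrow> c * (L2_norm (leb (half_space e)) \<eta>)\<^sup>2 \<le> test_form e V (robin_weight \<rho>) \<eta>"
  shows "c * (L2_norm (leb (half_space e)) \<psi>)\<^sup>2 \<le> quad_form (half_space e) (hyperplane_measure e) V \<rho> \<psi>"
proof -
  let ?D = "half_space e" and ?\<sigma> = "hyperplane_measure e"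
  have H: "\<psi> \<in> H1 ?D" by (rule form_domain_H1[OF \<psi>])
  show ?thesis
  proof (cases "\<rho> = 0")
    case False
    from is_trace_trace_on[OF e H] obtain \<eta> where
      "\<And>n. \<eta> n \<in> test_functions UNIV" "(\<lambda>n::nat. H1_norm ?D (\<lambda>x. \<eta> n x - \<psi> x)) \<longlonglongrightarrow> 0"
      "trace_on ?D ?\<sigma> \<psi> \<in> L2 ?\<sigma>" "(\<lambda>n. L2_norm ?\<sigma> (\<lambda>x. \<eta> n x - trace_on ?D ?\<sigma> \<psi> x)) \<longlonglongrightarrow> 0"
      unfolding is_trace_def by blast
    from form_bound_limit[OF H this le] \<open>\<And>n. \<eta> n \<in> test_functions UNIV\<close> False
    show ?thesis by (simp add: quad_form_def robin_weight_def form_core_def)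
  next
    case True
    obtain \<eta> where \<eta>: "\<And>n. \<eta> n \<in> test_functions ?D" "(\<lambda>n::nat. H1_norm ?D (\<lambda>x. \<eta> n x - \<psi> x)) \<longlonglongrightarrow> 0"
      using \<psi> True by (auto simp: form_domain_def H1_0_def)
    have t: "\<eta> n \<in> test_functions UNIV" for n by (rule test_functions_mono[OF subset_UNIV \<eta>(1)])
    let ?g = "trace_op e \<psi> (\<lambda>x. weak_gradient ?D \<psi> x \<bullet> e)"
    have "(\<lambda>n. 2 * H1_norm ?D (\<lambda>x. \<eta> n x - \<psi> x)) \<longlonglongrightarrow> 2 * 0" by (intro tendsto_mult tendsto_const \<eta>(2))
    then have l: "(\<lambda>n. 2 * H1_norm ?D (\<lambda>x. \<eta> n x - \<psi> x)) \<longlonglongrightarrow> 0" by simp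
    have "(\<lambda>n. L2_norm ?\<sigma> (\<lambda>x. \<eta> n x - ?g x)) \<longlonglongrightarrow> 0"
      by (rule Lim_null_comparison[OF always_eventually l])
         (simp add: L2_norm_nonneg trace_op_bound(2)[OF e H1D[OF H] t])
    from form_bound_limit[OF H t \<eta>(2) trace_op_L2[OF e H] this le] True \<eta>(1)
    show ?thesis by (simp add: quad_form_def robin_weight_def form_core_def)
  qed
qed

lemma quad_form_test:
  assumes t: "\<eta> \<in> test_functions UNIV"
  shows "quad_form (half_space e) (hyperplane_measure e) V \<rho> \<eta> = test_form e V (robin_weight \<rho>) \<eta>"
proof -
  note t1 = L2_restrict(1)[OF open_half_space test_functions_L2[OF t], of e] L2_restrict(1)[OF open_half_space grad_L2[OF t], of e]
  have g: "L2_norm (leb (half_space e)) (weak_gradient (half_space e) \<eta>) = L2_norm (leb (half_space e)) (grad \<eta>)"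
    by (rule H1_norm_eq(2)[OF e t1(2) grad_is_weak_gradient[OF open_half_space t] t1(1)])
  have H: "\<eta> \<in> H1 (half_space e)" by (rule test_functions_H1[OF open_half_space t])
  have "(\<integral>x. (norm (weak_gradient (half_space e) \<eta> x))\<^sup>2 + V x * (\<eta> x)\<^sup>2 \<partial>leb (half_space e)) = (\<integral>x. (norm (grad \<eta> x))\<^sup>2 + V x * (\<eta> x)\<^sup>2 \<partial>leb (half_space e))"
    unfolding form_as_L2_norms(3)[OF V H1D(1,2)[OF H]] form_as_L2_norms(3)[OF V t1] g ..
  then show ?thesis unfolding quad_form_def test_form_def robin_weight_def trace_on_test[OF e t] by simp
qed

lemma principal_eigenvalue_ge:
  assumes \<rho>: "0 \<le> \<rho>" "\<rho> \<le> 1"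
    and le: "\<And>\<eta>. \<eta> \<in> form_core e \<rho> \<Longrightarrow> c * (L2_norm (leb (half_space e)) \<eta>)\<^sup>2 \<le> test_form e V (robin_weight \<rho>) \<eta>"
  shows "c \<le> principal_eigenvalue (half_space e) (hyperplane_measure e) V \<rho>"
  unfolding principal_eigenvalue_def
proof (rule cINF_greatest)
  have "mollifier \<in> form_core e \<rho>"
    using mollifier_half_space(1)[OF e] mollifier_test[where 'a='a] by (simp add: form_core_def)
  from form_core_domain[OF this e] mollifier_half_space(2)[OF e]
  show "{\<psi> \<in> form_domain (half_space e) \<rho>. L2_norm (leb (half_space e)) \<psi> \<noteq> 0} \<noteq> {}" by blast
  fix \<psi> assume \<psi>: "\<psi> \<in> {\<psi> \<in> form_domain (half_space e) \<rho>. L2_norm (leb (half_space e)) \<psi> \<noteq> 0}"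
  then have "c * (L2_norm (leb (half_space e)) \<psi>)\<^sup>2 \<le> quad_form (half_space e) (hyperplane_measure e) V \<rho> \<psi>"
    by (intro quad_form_lower[OF \<rho> _ le]) auto
  moreover have "(L2_norm (leb (half_space e)) \<psi>)\<^sup>2 > 0" using \<psi> by simp
  ultimately show "c \<le> quad_form (half_space e) (hyperplane_measure e) V \<rho> \<psi> / (L2_norm (leb (half_space e)) \<psi>)\<^sup>2"
    by (subst pos_le_divide_eq)
qed

lemma test_form_ge:
  assumes "\<beta> \<ge> 0" and t: "\<eta> \<in> test_functions UNIV"
  shows "- C * (L2_norm (leb (half_space e)) \<eta>)\<^sup>2 + (L2_norm (leb (half_space e)) (grad \<eta>))\<^sup>2 \<le> test_form e V \<beta> \<eta>"
proof -
  note t1 = L2_restrict(1)[OF open_half_space test_functions_L2[OF t], of e] L2_restrict(1)[OF open_half_space grad_L2[OF t], of e]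
  have "0 \<le> \<beta> * (\<integral>x. (\<eta> x)\<^sup>2 \<partial>hyperplane_measure e)" using assms by simp
  moreover have "0 \<le> (L2_norm (leb (half_space e)) (\<lambda>x. sqrt (V x + C) * \<eta> x))\<^sup>2" by simp
  ultimately show ?thesis unfolding test_form_def form_as_L2_norms(3)[OF V t1] by simp
qed

text \<open>An infimum of reals is a lower bound only if the set is bounded below; here \<open>- C\<close> bounds it.\<close>

lemma principal_eigenvalue_le:
  assumes \<rho>: "0 \<le> \<rho>" "\<rho> \<le> 1" and \<eta>: "\<eta> \<in> form_core e \<rho>"
  shows "principal_eigenvalue (half_space e) (hyperplane_measure e) V \<rho> * (L2_norm (leb (half_space e)) \<eta>)\<^sup>2 \<le> test_form e V (robin_weight \<rho>) \<eta>"
proof (cases "L2_norm (leb (half_space e)) \<eta> = 0")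
  case True
  have "0 \<le> test_form e V (robin_weight \<rho>) \<eta>"
    by (rule order_trans[OF zero_le_power2[of "L2_norm (leb (half_space e)) (grad \<eta>)"]])
       (use test_form_ge[OF robin_weight_nonneg[OF \<rho>] form_core_test[OF \<eta>]] True in simp)
  then show ?thesis using True by simp
next
  case False
  let ?F = "\<lambda>\<psi>. quad_form (half_space e) (hyperplane_measure e) V \<rho> \<psi> / (L2_norm (leb (half_space e)) \<psi>)\<^sup>2"
  let ?S = "{\<psi> \<in> form_domain (half_space e) \<rho>. L2_norm (leb (half_space e)) \<psi> \<noteq> 0}"
  have "bdd_below (?F ` ?S)"
  proof (rule bdd_belowI2[where m="- C"])
    fix \<psi> assume \<psi>: "\<psi> \<in> ?S"
    have "- C * (L2_norm (leb (half_space e)) \<psi>)\<^sup>2 \<le> quad_form (half_space e) (hyperplane_measure e) V \<rho> \<psi>"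
    proof (rule quad_form_lower[OF \<rho>])
      fix \<zeta> assume "\<zeta> \<in> form_core e \<rho>"
      from test_form_ge[OF robin_weight_nonneg[OF \<rho>] form_core_test[OF this]]
      show "- C * (L2_norm (leb (half_space e)) \<zeta>)\<^sup>2 \<le> test_form e V (robin_weight \<rho>) \<zeta>"
        using zero_le_power2[of "L2_norm (leb (half_space e)) (grad \<zeta>)"] by linarith
    qed (use \<psi> in auto)
    moreover have "(L2_norm (leb (half_space e)) \<psi>)\<^sup>2 > 0" using \<psi> by simp
    ultimately show "- C \<le> ?F \<psi>" by (subst pos_le_divide_eq)
  qed
  then have "principal_eigenvalue (half_space e) (hyperplane_measure e) V \<rho> \<le> ?F \<eta>"
    unfolding principal_eigenvalue_def using form_core_domain[OF \<eta> e] False by (intro cINF_lower) auto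
  moreover have "(L2_norm (leb (half_space e)) \<eta>)\<^sup>2 > 0" using False by simp
  ultimately show ?thesis unfolding quad_form_test[OF form_core_test[OF \<eta>]] by (subst (asm) pos_le_divide_eq)
qed

end

section \<open>From the half-line to the half-space\<close>

lemma test_functions_slice_half:
  fixes \<eta> :: "'a::euclidean_space \<Rightarrow> real"
  assumes "\<eta> \<in> test_functions (half_space e)" and e: "e \<in> Basis" and x: "x \<bullet> e = 0"
  shows "(\<lambda>t. \<eta> (x + t *\<^sub>R e)) \<in> test_functions {0<..}"
proof -
  obtain S where S: "smooth \<eta>" "compact S" "S \<subseteq> half_space e" "\<And>x. x \<notin> S \<Longrightarrow> \<eta> x = 0" using assms by (metis test_functionsE)
  obtain R where R: "\<And>x. x \<in> S \<Longrightarrow> norm x \<le> R" using compact_imp_bounded[OF S(2)] by (metis bounded_pos)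
  let ?T = "(\<lambda>t. x + t *\<^sub>R e) -` S"
  show ?thesis
  proof (rule test_functionsI[OF smooth_slice[OF S(1)], of ?T])
    have "closed ?T" by (intro continuous_closed_vimage compact_imp_closed S continuous_intros)
    moreover have "bounded ?T"
    proof (rule boundedI)
      fix t assume "t \<in> ?T"
      then have "norm (x + t *\<^sub>R e) \<le> R" using R by simp
      then show "norm t \<le> R + norm x"
        using norm_triangle_ineq4[of "x + t *\<^sub>R e" x] e by simp
    qed
    ultimately show "compact ?T" by (simp add: compact_eq_bounded_closed)
    show "?T \<subseteq> {0<..}" using S(3) x e by (auto simp: half_space_def inner_add_left)
  qed (use S(4) in auto)
qed

lemma form_core_slice:
  assumes "\<eta> \<in> form_core e \<rho>" "e \<in> Basis" "x \<bullet> e = 0"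
  shows "(\<lambda>t. \<eta> (x + t *\<^sub>R e)) \<in> form_core (1::real) \<rho>"
  using assms test_functions_slice_half[of \<eta> e x] test_functions_slice[of \<eta> e x]
  by (auto simp: form_core_def half_space_real)

lemma real_test_form:
  assumes "smooth s"
  shows "test_form (1::real) W \<beta> s = (\<integral>t. (pd s 1 t)\<^sup>2 + W t * (s t)\<^sup>2 \<partial>leb {0<..}) + \<beta> * (s 0)\<^sup>2"
proof -
  have [measurable]: "s \<in> borel_measurable borel" by (rule smooth_borel[OF assms])
  show ?thesis unfolding test_form_def half_space_real hyperplane_measure_real
    by (simp add: grad_def integral_return)
qed

lemma test_square_integrable: "\<zeta> \<in> test_functions UNIV \<Longrightarrow> integrable lborel (\<lambda>x. (\<zeta> x)\<^sup>2)"
  using L2_integrable[OF test_functions_L2] by fastforce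

text \<open>The argument \<open>f\<close> of the potential is a coordinate in the half-space and the identity on the half-line.\<close>

lemma weighted_square_integrable:
  fixes \<zeta> f :: "'b::euclidean_space \<Rightarrow> real" and U :: "real \<Rightarrow> real"
  assumes "\<zeta> \<in> test_functions UNIV" and [measurable]: "U \<in> borel_measurable borel"
    and U: "\<And>t. \<bar>U t\<bar> \<le> C" and C: "0 \<le> C" and [measurable]: "f \<in> borel_measurable borel"
  shows "integrable lborel (\<lambda>x. U (f x) * (\<zeta> x)\<^sup>2)" 
proof (rule Bochner_Integration.integrable_bound)
  show "integrable lborel (\<lambda>x. C * (\<zeta> x)\<^sup>2)" using test_square_integrable[OF assms(1)] by simp
  have [measurable]: "\<zeta> \<in> borel_measurable borel"
    using L2_measurable[OF test_functions_L2[OF assms(1)]] by auto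
  show "(\<lambda>x. U (f x) * (\<zeta> x)\<^sup>2) \<in> borel_measurable lborel" by measurable
  show "AE x in lborel. norm (U (f x) * (\<zeta> x)\<^sup>2) \<le> norm (C * (\<zeta> x)\<^sup>2)"
    using U C by (intro AE_I2) (auto simp: abs_mult intro!: mult_right_mono)
qed

lemma indicator_mult_integrable:
  fixes g :: "'b::euclidean_space \<Rightarrow> real"
  assumes "integrable lborel g" "A \<in> sets borel" shows "integrable lborel (\<lambda>x. indicator A x * g x)"
  using integrable_mult_indicator[of A lborel g] assms by simp

context
  fixes e :: "'a::euclidean_space" and W :: "real \<Rightarrow> real" and C :: real
  assumes e: "e \<in> Basis"
    and W: "W \<in> borel_measurable (leb {0<..})" "\<forall>x\<in>{0<..}. \<bar>W x\<bar> \<le> C"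
begin

lemma potential_borel: "(\<lambda>t. indicator {0<..} t * W t) \<in> borel_measurable borel"
  using W(1) restrict_lborel_simps(3)[of "{0<..}" W] by simp

lemma potential_half_space:
  "(\<lambda>x. W (x \<bullet> e)) \<in> borel_measurable (leb (half_space e))" "\<forall>x\<in>half_space e. \<bar>W (x \<bullet> e)\<bar> \<le> C"
proof -
  have "(\<lambda>x. indicator (half_space e) x *\<^sub>R W (x \<bullet> e)) = (\<lambda>x. (\<lambda>t. indicator {0<..} t * W t) (x \<bullet> e))"
    by (auto simp: half_space_def indicator_def)
  moreover have "\<dots> \<in> borel_measurable borel" by (rule measurable_compose[OF _ potential_borel]) simp
  ultimately show "(\<lambda>x. W (x \<bullet> e)) \<in> borel_measurable (leb (half_space e))"
    by (simp add: restrict_lborel_simps(3)[OF open_half_space])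
  show "\<forall>x\<in>half_space e. \<bar>W (x \<bullet> e)\<bar> \<le> C" using W(2) by (auto simp: half_space_def)
qed

text \<open>The inequality on the half-line is applied to each slice. Adding \<open>C\<close> times the mass to both
sides makes all integrands nonnegative, so that they can be integrated over the hyperplane by Tonelli's theorem.\<close>

lemma half_space_form_ge:
  assumes \<beta>: "0 \<le> \<beta>" and m: "0 \<le> m" and \<eta>: "\<eta> \<in> form_core e \<rho>"
    and le1: "\<And>s. s \<in> form_core (1::real) \<rho> \<Longrightarrow> m * (L2_norm (leb {0<..}) s)\<^sup>2 \<le> test_form (1::real) W \<beta> s"
  shows "m * (L2_norm (leb (half_space e)) \<eta>)\<^sup>2 \<le> test_form e (\<lambda>x. W (x \<bullet> e)) \<beta> \<eta>"
proof -
  let ?D = "half_space e" and ?\<sigma> = "hyperplane_measure e" and ?P = "{0<..} :: real set"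
  have C: "0 \<le> C" using bspec[OF W(2), of 1] by simp
  have ee: "e \<bullet> e = 1" using e by simp
  have t: "\<eta> \<in> test_functions UNIV" by (rule form_core_test[OF \<eta>])
  have s: "smooth \<eta>" "smooth (pd \<eta> e)" using t test_functions_pd[OF t e] by (metis test_functionsE)+
  have [measurable]: "\<eta> \<in> borel_measurable borel" "pd \<eta> e \<in> borel_measurable borel" using s by (auto intro: smooth_borel)
  define U where "U = (\<lambda>t. indicator ?P t * W t)"
  have [measurable]: "U \<in> borel_measurable borel" unfolding U_def by (rule potential_borel)
  have U: "\<bar>U t\<bar> \<le> C" for t using W(2) C by (auto simp: U_def indicator_def)
  define p where "p x = indicator ?D x * ((m + C) * (\<eta> x)\<^sup>2)" for x
  define q where "q x = indicator ?D x * ((pd \<eta> e x)\<^sup>2 + (U (x \<bullet> e) + C) * (\<eta> x)\<^sup>2)" for x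
  have [measurable]: "p \<in> borel_measurable borel" "q \<in> borel_measurable borel" unfolding p_def q_def by measurable
  have p0: "0 \<le> p x" and q0: "0 \<le> q x" for x
    using m C U[of "x \<bullet> e"] by (auto simp: p_def q_def abs_le_iff intro!: mult_nonneg_nonneg add_nonneg_nonneg)
  note sq = test_square_integrable and ind = indicator_mult_integrable
  note Usq = weighted_square_integrable[OF _ \<open>U \<in> borel_measurable borel\<close> U C]
  have pq: "integrable lborel p" "integrable lborel q"
    unfolding p_def q_def distrib_right
    by (intro ind Bochner_Integration.integrable_add integrable_mult_right sq Usq t test_functions_pd e half_space_borel | simp)+
  have slice: "(\<integral>\<^sup>+r. ennreal (p (x + r *\<^sub>R e)) \<partial>lborel) \<le> (\<integral>\<^sup>+r. ennreal (q (x + r *\<^sub>R e)) \<partial>lborel) + ennreal (\<beta> * (\<eta> x)\<^sup>2)"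
    if x: "x \<bullet> e = 0" for x
  proof -
    define z where "z r = \<eta> (x + r *\<^sub>R e)" for r
    have zc: "z \<in> form_core 1 \<rho>" unfolding z_def by (rule form_core_slice[OF \<eta> e x])
    have zt: "z \<in> test_functions UNIV" by (rule form_core_test[OF zc])
    have zs: "smooth z" using zt by (metis test_functionsE)
    have z't: "pd z 1 \<in> test_functions UNIV" by (rule test_functions_pd[OF zt]) simp
    have z': "pd z 1 r = pd \<eta> e (x + r *\<^sub>R e)" for r unfolding z_def by (rule pd_slice[OF s(1)])
    have px: "p (x + r *\<^sub>R e) = indicator ?P r * ((m + C) * (z r)\<^sup>2)" for r
      using x ee by (simp add: p_def z_def half_space_def inner_add_left indicator_def)
    have qx: "q (x + r *\<^sub>R e) = indicator ?P r * ((pd z 1 r)\<^sup>2 + (U r + C) * (z r)\<^sup>2)" for r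
      using x ee by (simp add: q_def z_def[symmetric] z' half_space_def inner_add_left indicator_def)
    have ipx: "integrable lborel (\<lambda>r. p (x + r *\<^sub>R e))" and iqx: "integrable lborel (\<lambda>r. q (x + r *\<^sub>R e))"
      unfolding px qx distrib_right
      by (intro ind Bochner_Integration.integrable_add integrable_mult_right sq Usq[where f="\<lambda>r. r"] zt z't | simp)+
    have i1: "integrable lborel (\<lambda>r. indicator ?P r * (z r)\<^sup>2)" by (intro ind sq zt) simp
    have i2: "integrable lborel (\<lambda>r. indicator ?P r * ((pd z 1 r)\<^sup>2 + U r * (z r)\<^sup>2))" 
      by (intro ind Bochner_Integration.integrable_add sq Usq[where f="\<lambda>r. r"] zt z't | simp)+
    have n: "(L2_norm (leb ?P) z)\<^sup>2 = (\<integral>r. indicator ?P r * (z r)\<^sup>2 \<partial>lborel)"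
      by (simp add: L2_norm_power2 restrict_lborel_simps(2))
    have "(\<integral>r. (pd z 1 r)\<^sup>2 + W r * (z r)\<^sup>2 \<partial>leb ?P) = (\<integral>r. indicator ?P r * ((pd z 1 r)\<^sup>2 + U r * (z r)\<^sup>2) \<partial>lborel)"
      by (simp add: restrict_lborel_simps(2)) (auto intro!: Bochner_Integration.integral_cong simp: U_def indicator_def)
    then have tf: "test_form 1 W \<beta> z = (\<integral>r. indicator ?P r * ((pd z 1 r)\<^sup>2 + U r * (z r)\<^sup>2) \<partial>lborel) + \<beta> * (\<eta> x)\<^sup>2"
      by (simp add: real_test_form[OF zs]) (simp add: z_def)
    have ip: "(\<integral>r. p (x + r *\<^sub>R e) \<partial>lborel) = (m + C) * (\<integral>r. indicator ?P r * (z r)\<^sup>2 \<partial>lborel)"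
      unfolding px using i1 by (subst integral_mult_right_zero[symmetric]) (simp add: mult.left_commute)
    have "(\<integral>r. q (x + r *\<^sub>R e) \<partial>lborel) = (\<integral>r. indicator ?P r * ((pd z 1 r)\<^sup>2 + U r * (z r)\<^sup>2) + C * (indicator ?P r * (z r)\<^sup>2) \<partial>lborel)"
      unfolding qx by (rule Bochner_Integration.integral_cong) (simp_all add: algebra_simps)
    also have "\<dots> = (\<integral>r. indicator ?P r * ((pd z 1 r)\<^sup>2 + U r * (z r)\<^sup>2) \<partial>lborel) + C * (\<integral>r. indicator ?P r * (z r)\<^sup>2 \<partial>lborel)"
      using i1 i2 by (subst Bochner_Integration.integral_add) simp_all
    finally have iq: "(\<integral>r. q (x + r *\<^sub>R e) \<partial>lborel) = (\<integral>r. indicator ?P r * ((pd z 1 r)\<^sup>2 + U r * (z r)\<^sup>2) \<partial>lborel) + C * (\<integral>r. indicator ?P r * (z r)\<^sup>2 \<partial>lborel)" .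
    have "(\<integral>r. p (x + r *\<^sub>R e) \<partial>lborel) \<le> (\<integral>r. q (x + r *\<^sub>R e) \<partial>lborel) + \<beta> * (\<eta> x)\<^sup>2"
      using le1[OF zc] unfolding n tf ip iq by (simp add: distrib_right)
    then have "ennreal (\<integral>r. p (x + r *\<^sub>R e) \<partial>lborel) \<le> ennreal (\<integral>r. q (x + r *\<^sub>R e) \<partial>lborel) + ennreal (\<beta> * (\<eta> x)\<^sup>2)"
      unfolding ennreal_plus[OF Bochner_Integration.integral_nonneg[OF q0] mult_nonneg_nonneg[OF \<beta> zero_le_power2], symmetric]
      by (rule ennreal_leI)
    then show ?thesis
      by (subst (1 2) nn_integral_eq_integral) (use ipx iqx p0 q0 in auto)
  qed
  have ib: "integrable ?\<sigma> (\<lambda>x. (\<eta> x)\<^sup>2)" using L2_integrable[OF test_trace_bound(1)[OF e t]] by simp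
  have "(\<integral>\<^sup>+x. ennreal (p x) \<partial>lborel) = (\<integral>\<^sup>+x. (\<integral>\<^sup>+r. ennreal (p (x + r *\<^sub>R e)) \<partial>lborel) \<partial>?\<sigma>)"
    by (rule nn_integral_lborel_slice[OF e]) simp
  also have "\<dots> \<le> (\<integral>\<^sup>+x. (\<integral>\<^sup>+r. ennreal (q (x + r *\<^sub>R e)) \<partial>lborel) + ennreal (\<beta> * (\<eta> x)\<^sup>2) \<partial>?\<sigma>)"
    by (rule nn_integral_mono_AE, rule AE_mp[OF AE_hyperplane[OF e]]) (auto intro!: AE_I2 slice)
  also have "\<dots> = (\<integral>\<^sup>+x. (\<integral>\<^sup>+r. ennreal (q (x + r *\<^sub>R e)) \<partial>lborel) \<partial>?\<sigma>) + (\<integral>\<^sup>+x. ennreal (\<beta> * (\<eta> x)\<^sup>2) \<partial>?\<sigma>)"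
    by (rule nn_integral_add) (simp_all add: measurable_hyperplane)
  also have "(\<integral>\<^sup>+x. (\<integral>\<^sup>+r. ennreal (q (x + r *\<^sub>R e)) \<partial>lborel) \<partial>?\<sigma>) = (\<integral>\<^sup>+x. ennreal (q x) \<partial>lborel)"
    by (rule nn_integral_lborel_slice[OF e, symmetric]) simp
  also have "\<dots> = ennreal (\<integral>x. q x \<partial>lborel)" by (rule nn_integral_eq_integral[OF pq(2)]) (simp add: q0)
  also have "(\<integral>\<^sup>+x. ennreal (\<beta> * (\<eta> x)\<^sup>2) \<partial>?\<sigma>) = ennreal (\<beta> * (\<integral>x. (\<eta> x)\<^sup>2 \<partial>?\<sigma>))"
    using ib \<beta> by (subst nn_integral_eq_integral) auto
  also have "(\<integral>\<^sup>+x. ennreal (p x) \<partial>lborel) = ennreal (\<integral>x. p x \<partial>lborel)" by (rule nn_integral_eq_integral[OF pq(1)]) (simp add: p0)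
  finally have "ennreal (\<integral>x. p x \<partial>lborel) \<le> ennreal ((\<integral>x. q x \<partial>lborel) + \<beta> * (\<integral>x. (\<eta> x)\<^sup>2 \<partial>?\<sigma>))"
    using q0 \<beta> by (subst ennreal_plus) (auto intro!: Bochner_Integration.integral_nonneg)
  then have main: "(\<integral>x. p x \<partial>lborel) \<le> (\<integral>x. q x \<partial>lborel) + \<beta> * (\<integral>x. (\<eta> x)\<^sup>2 \<partial>?\<sigma>)"
    by (rule iffD1[OF ennreal_le_iff, rotated]) (use q0 \<beta> in \<open>auto intro!: Bochner_Integration.integral_nonneg add_nonneg_nonneg mult_nonneg_nonneg\<close>)
  have i1: "integrable lborel (\<lambda>x. indicator ?D x * (\<eta> x)\<^sup>2)" by (intro ind sq t half_space_borel)
  have gr: "integrable lborel (\<lambda>x. (norm (grad \<eta> x))\<^sup>2)" by (rule L2_integrable[OF grad_L2[OF t]])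
  have i2: "integrable lborel (\<lambda>x. indicator ?D x * ((norm (grad \<eta> x))\<^sup>2 + U (x \<bullet> e) * (\<eta> x)\<^sup>2))"
    by (intro ind Bochner_Integration.integrable_add gr Usq t half_space_borel) simp
  have P: "(\<integral>x. p x \<partial>lborel) = (m + C) * (L2_norm (leb ?D) \<eta>)\<^sup>2"
  proof -
    have "(L2_norm (leb ?D) \<eta>)\<^sup>2 = (\<integral>x. indicator ?D x * (\<eta> x)\<^sup>2 \<partial>lborel)"
      by (simp add: L2_norm_power2 restrict_lborel_simps(2)[OF open_half_space])
    then show ?thesis unfolding p_def by (simp add: mult.left_commute[of _ "m + C"])
  qed
  have "(\<integral>x. q x \<partial>lborel) \<le> (\<integral>x. indicator ?D x * ((norm (grad \<eta> x))\<^sup>2 + U (x \<bullet> e) * (\<eta> x)\<^sup>2) + C * (indicator ?D x * (\<eta> x)\<^sup>2) \<partial>lborel)"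
  proof (rule integral_mono[OF pq(2)])
    show "integrable lborel (\<lambda>x. indicator ?D x * ((norm (grad \<eta> x))\<^sup>2 + U (x \<bullet> e) * (\<eta> x)\<^sup>2) + C * (indicator ?D x * (\<eta> x)\<^sup>2))"
      using i1 i2 by simp
    fix x
    have "(pd \<eta> e x)\<^sup>2 \<le> (norm (grad \<eta> x))\<^sup>2" using grad_norm_ge[OF e, of \<eta> x] by (simp add: abs_le_square_iff[symmetric])
    then show "q x \<le> indicator ?D x * ((norm (grad \<eta> x))\<^sup>2 + U (x \<bullet> e) * (\<eta> x)\<^sup>2) + C * (indicator ?D x * (\<eta> x)\<^sup>2)"
      by (simp add: q_def indicator_def algebra_simps)
  qed
  also have "\<dots> = (\<integral>x. (norm (grad \<eta> x))\<^sup>2 + W (x \<bullet> e) * (\<eta> x)\<^sup>2 \<partial>leb ?D) + C * (L2_norm (leb ?D) \<eta>)\<^sup>2"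
  proof -
    have "(\<integral>x. (norm (grad \<eta> x))\<^sup>2 + W (x \<bullet> e) * (\<eta> x)\<^sup>2 \<partial>leb ?D) = (\<integral>x. indicator ?D x * ((norm (grad \<eta> x))\<^sup>2 + U (x \<bullet> e) * (\<eta> x)\<^sup>2) \<partial>lborel)"
      by (simp add: restrict_lborel_simps(2)[OF open_half_space])
         (auto intro!: Bochner_Integration.integral_cong simp: U_def indicator_def half_space_def)
    then show ?thesis using i1 i2 by (simp add: L2_norm_power2 restrict_lborel_simps(2)[OF open_half_space])
  qed
  finally show ?thesis using main unfolding P test_form_def by (simp add: distrib_right)
qed

end

lemma principal_eigenvalue_half_space_ge:
  fixes e :: "'a::euclidean_space"
  assumes e: "e \<in> Basis" and W: "W \<in> borel_measurable (leb {0<..})" "\<forall>x\<in>{0<..}. \<bar>W x\<bar> \<le> C"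
    and \<rho>: "0 \<le> \<rho>" "\<rho> \<le> 1" and m: "0 \<le> m" "m \<le> principal_eigenvalue {0<..} (return borel 0) W \<rho>"
  shows "m \<le> principal_eigenvalue (half_space e) (hyperplane_measure e) (\<lambda>x. W (x \<bullet> e)) \<rho>"
proof (rule principal_eigenvalue_ge[OF e potential_half_space[OF e W] \<rho>])
  fix \<eta> assume \<eta>: "\<eta> \<in> form_core e \<rho>"
  show "m * (L2_norm (leb (half_space e)) \<eta>)\<^sup>2 \<le> test_form e (\<lambda>x. W (x \<bullet> e)) (robin_weight \<rho>) \<eta>"
  proof (rule half_space_form_ge[OF e W robin_weight_nonneg[OF \<rho>] m(1) \<eta>])
    fix s :: "real \<Rightarrow> real" assume s: "s \<in> form_core 1 \<rho>"
    have "m * (L2_norm (leb {0<..}) s)\<^sup>2 \<le> principal_eigenvalue {0<..} (return borel 0) W \<rho> * (L2_norm (leb {0<..}) s)\<^sup>2"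
      using m(2) by (rule mult_right_mono) simp
    also have "\<dots> \<le> test_form 1 W (robin_weight \<rho>) s"
      using principal_eigenvalue_le[of "1::real" W C \<rho> s] W \<rho> s by (simp add: half_space_real hyperplane_measure_real)
    finally show "m * (L2_norm (leb {0<..}) s)\<^sup>2 \<le> test_form 1 W (robin_weight \<rho>) s" .
  qed
qed

section \<open>Riccati bounds on the half-line\<close>

text \<open>The Riccati solution has a two-sided derivative only away from \<open>0\<close>, so the end points carry just continuity.\<close>

lemma FTC_interior:
  fixes F f :: "real \<Rightarrow> real"
  assumes "a \<le> b" "continuous_on {a..b} F" "continuous_on {a..b} f"
    "\<And>x. a < x \<Longrightarrow> x < b \<Longrightarrow> (F has_real_derivative f x) (at x)"
  shows "integrable lborel (\<lambda>x. indicator {a..b} x * f x)" "(\<integral>x. indicator {a..b} x * f x \<partial>lborel) = F b - F a"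
proof -
  have s: "set_integrable lborel {a..b} f" by (rule borel_integrable_atLeastAtMost'[OF assms(3)])
  then show "integrable lborel (\<lambda>x. indicator {a..b} x * f x)" by (simp add: set_integrable_def)
  have "(f has_integral F b - F a) {a..b}"
    by (rule fundamental_theorem_of_calculus_interior[OF assms(1,2)])
       (use assms(4) in \<open>auto simp: has_real_derivative_iff_has_vector_derivative[symmetric]\<close>)
  then have "integral {a..b} f = F b - F a" by (rule integral_unique)
  then show "(\<integral>x. indicator {a..b} x * f x \<partial>lborel) = F b - F a"
    using set_borel_integral_eq_integral(2)[OF s] by (simp add: set_lebesgue_integral_def)
qed

lemma leb_integral_Icc:
  fixes g :: "real \<Rightarrow> real"
  assumes "continuous_on {0..R} g" "\<And>t. R < t \<Longrightarrow> g t = 0"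
  shows "integrable (leb {0<..}) g" "(\<integral>t. g t \<partial>leb {0<..}) = (\<integral>t. indicator {0..R} t * g t \<partial>lborel)"
proof -
  define k where "k t = indicator {0..R} t * g t" for t
  have ik: "integrable lborel k"
    using borel_integrable_atLeastAtMost'[OF assms(1)] by (simp add: set_integrable_def k_def[abs_def])
  have e: "(\<lambda>t. indicator {0<..} t *\<^sub>R g t) = (\<lambda>t. indicator {0<..} t * k t)"
    using assms(2) by (auto simp: k_def indicator_def fun_eq_iff not_le)
  have i: "integrable lborel (\<lambda>t. indicator {0<..} t * k t)" by (intro indicator_mult_integrable ik) simp
  then show "integrable (leb {0<..}) g" by (simp only: restrict_lborel_simps(1)[OF open_greaterThan] e)
  have "(\<integral>t. g t \<partial>leb {0<..}) = (\<integral>t. indicator {0<..} t * k t \<partial>lborel)"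
    by (simp only: restrict_lborel_simps(2)[OF open_greaterThan] e)
  also have "\<dots> = (\<integral>t. k t \<partial>lborel)"
  proof (rule integral_cong_AE)
    have "AE t in lborel. t \<noteq> (0::real)" by (rule AE_lborel_singleton)
    then show "AE t in lborel. indicator {0<..} t * k t = k t"
      by eventually_elim (auto simp: k_def indicator_def)
  qed (use i ik in auto)
  finally show "(\<integral>t. g t \<partial>leb {0<..}) = (\<integral>t. indicator {0..R} t * g t \<partial>lborel)" by (simp add: k_def)
qed

text \<open>Expanding \<open>(s' - p s)\<^sup>2 \<ge> 0\<close> gives
\<open>s'\<^sup>2 + V s\<^sup>2 \<ge> (V - p' - p\<^sup>2) s\<^sup>2 + (p s\<^sup>2)'\<close>; the last term integrates to \<open>- p 0 (s 0)\<^sup>2\<close>, which the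
boundary term compensates.\<close>

lemma riccati_bound:
  fixes p p' V s :: "real \<Rightarrow> real"
  assumes s: "s \<in> test_functions UNIV" and V: "continuous_on {0..} V"
    and p: "continuous_on {0..} p" "continuous_on {0..} p'" "\<And>y. 0 < y \<Longrightarrow> (p has_real_derivative p' y) (at y)"
    and c: "\<And>y. 0 < y \<Longrightarrow> c \<le> V y - p' y - (p y)\<^sup>2"
    and b: "p 0 \<le> \<beta> \<or> s 0 = 0"
  shows "c * (L2_norm (leb {0<..}) s)\<^sup>2 \<le> test_form (1::real) V \<beta> s"
proof -
  obtain S where S: "smooth s" "compact S" "\<And>x. x \<notin> S \<Longrightarrow> s x = 0" "\<And>x b. x \<notin> S \<Longrightarrow> pd s b x = 0" using s by (metis test_functionsE)
  obtain R0 where R0: "\<And>x. x \<in> S \<Longrightarrow> norm x \<le> R0" "R0 > 0" using compact_imp_bounded[OF S(2)] by (metis bounded_pos)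
  define R where "R = R0 + 1"
  have R: "R > 0" "\<And>x. R \<le> x \<Longrightarrow> s x = 0" "\<And>x. R \<le> x \<Longrightarrow> pd s 1 x = 0"
  proof -
    have "x \<notin> S" if "R \<le> x" for x using R0(1)[of x] that R0(2) unfolding R_def by auto
    then show "R > 0" "\<And>x. R \<le> x \<Longrightarrow> s x = 0" "\<And>x. R \<le> x \<Longrightarrow> pd s 1 x = 0" using S R0 by (auto simp: R_def)
  qed
  have sub: "{0..R} \<subseteq> {0..}" by auto
  note cs = smooth_continuous[OF S(1)] smooth_continuous[OF smooth_pd[OF S(1)], of 1, simplified]
  note cp = continuous_on_subset[OF p(1) sub] continuous_on_subset[OF p(2) sub] continuous_on_subset[OF V sub]
  define f where "f y = p' y * (s y)\<^sup>2 + p y * (2 * s y * pd s 1 y)" for y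
  define g where "g y = (pd s 1 y)\<^sup>2 + V y * (s y)\<^sup>2" for y
  have cf: "continuous_on {0..R} f" and cg: "continuous_on {0..R} g" and cs2: "continuous_on {0..R} (\<lambda>y. (s y)\<^sup>2)"
    unfolding f_def g_def by (intro continuous_intros cs cp)+
  have D: "((\<lambda>y. p y * (s y)\<^sup>2) has_real_derivative f y) (at y)" if "0 < y" for y
    unfolding f_def using smooth_real_DERIV[OF S(1), of y UNIV]
    by (auto intro!: derivative_eq_intros p(3) that simp: power2_eq_square algebra_simps)
  have cF: "continuous_on {0..R} (\<lambda>y. p y * (s y)\<^sup>2)" by (intro continuous_intros cs cp)
  have "0 \<le> R" using R(1) by simp
  note F = FTC_interior[OF \<open>0 \<le> R\<close> cF cf D]
  have ff: "(\<integral>y. indicator {0..R} y * f y \<partial>lborel) = - (p 0 * (s 0)\<^sup>2)" using F(2) R(2)[of R] by simp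
  note G = leb_integral_Icc[OF cg, unfolded g_def] and N = leb_integral_Icc[OF cs2]
  have gi: "integrable lborel (\<lambda>y. indicator {0..R} y * g y)" and ni: "integrable lborel (\<lambda>y. indicator {0..R} y * (s y)\<^sup>2)"
    using borel_integrable_atLeastAtMost'[OF cg] borel_integrable_atLeastAtMost'[OF cs2] by (auto simp: set_integrable_def)
  have gN: "(\<integral>y. g y \<partial>leb {0<..}) = (\<integral>y. indicator {0..R} y * g y \<partial>lborel)"
    by (rule leb_integral_Icc(2)[OF cg]) (simp add: g_def R)
  have nN: "(L2_norm (leb {0<..}) s)\<^sup>2 = (\<integral>y. indicator {0..R} y * (s y)\<^sup>2 \<partial>lborel)"
    unfolding L2_norm_power2 real_norm_def power2_abs by (rule leb_integral_Icc(2)[OF cs2]) (simp add: R)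
  have "(\<integral>y. c * (indicator {0..R} y * (s y)\<^sup>2) + indicator {0..R} y * f y \<partial>lborel) \<le> (\<integral>y. indicator {0..R} y * g y \<partial>lborel)"
  proof (rule integral_mono_AE)
    have "AE t in lborel. t \<noteq> (0::real)" by (rule AE_lborel_singleton)
    then show "AE y in lborel. c * (indicator {0..R} y * (s y)\<^sup>2) + indicator {0..R} y * f y \<le> indicator {0..R} y * g y"
    proof eventually_elim
      fix y :: real assume y: "y \<noteq> 0"
      show "c * (indicator {0..R} y * (s y)\<^sup>2) + indicator {0..R} y * f y \<le> indicator {0..R} y * g y"
      proof (cases "y \<in> {0..R}")
        case True
        then have "0 < y" using y by auto
        have "0 \<le> (pd s 1 y - p y * s y)\<^sup>2 + (V y - p' y - (p y)\<^sup>2 - c) * (s y)\<^sup>2"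
          using c[OF \<open>0 < y\<close>] by (intro add_nonneg_nonneg mult_nonneg_nonneg) auto
        also have "\<dots> = g y - f y - c * (s y)\<^sup>2" by (simp add: f_def g_def power2_eq_square algebra_simps)
        finally show ?thesis using True by simp
      qed simp
    qed
  qed (use ni F(1) gi in auto)
  then have "c * (L2_norm (leb {0<..}) s)\<^sup>2 - p 0 * (s 0)\<^sup>2 \<le> (\<integral>y. g y \<partial>leb {0<..})"
    unfolding gN nN using ni F(1) ff by simp
  moreover have "p 0 * (s 0)\<^sup>2 \<le> \<beta> * (s 0)\<^sup>2" using b by (auto intro: mult_right_mono)
  ultimately show ?thesis unfolding real_test_form[OF S(1)] g_def by linarith
qed

section \<open>The form on the half-line\<close>

abbreviation mass :: "(real \<Rightarrow> real) \<Rightarrow> real" where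
  "mass s \<equiv> (L2_norm (leb {0<..}) s)\<^sup>2"

lemma one_dim_eigenvalue:
  assumes W: "W \<in> borel_measurable (leb {0<..})" "\<forall>x\<in>{0<..}. \<bar>W x\<bar> \<le> C" and \<rho>: "0 \<le> \<rho>" "\<rho> \<le> 1"
  shows "s \<in> form_core (1::real) \<rho> \<Longrightarrow> principal_eigenvalue {0<..} (return borel 0) W \<rho> * mass s \<le> test_form (1::real) W (robin_weight \<rho>) s"
    "(\<And>s. s \<in> form_core (1::real) \<rho> \<Longrightarrow> c * mass s \<le> test_form (1::real) W (robin_weight \<rho>) s) \<Longrightarrow>
       c \<le> principal_eigenvalue {0<..} (return borel 0) W \<rho>"
  using principal_eigenvalue_le[of "1::real" W C \<rho> s] principal_eigenvalue_ge[of "1::real" W C \<rho> c] W \<rho>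
  by (simp_all add: half_space_real hyperplane_measure_real)

lemma real_test_L2:
  assumes "s \<in> test_functions (UNIV :: real set)"
  shows "s \<in> L2 (leb {0<..})" "pd s 1 \<in> L2 (leb {0<..})"
  using L2_restrict(1)[OF open_greaterThan test_functions_L2[OF assms]]
    L2_restrict(1)[OF open_greaterThan test_functions_L2[OF test_functions_pd[OF assms]]] by auto

lemma real_test_form_split:
  assumes W: "W \<in> borel_measurable (leb {0<..})" "\<forall>x\<in>{0<..}. \<bar>W x\<bar> \<le> C" and s: "s \<in> test_functions UNIV"
  shows "test_form (1::real) W \<beta> s = mass (pd s 1) + mass (\<lambda>x. sqrt (W x + C) * s x) - C * mass s + \<beta> * (s 0)\<^sup>2"
    "(\<lambda>x. sqrt (W x + C) * s x) \<in> L2 (leb {0<..})"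
proof -
  have "smooth s" using s by (rule test_functionsE)
  then show "test_form (1::real) W \<beta> s = mass (pd s 1) + mass (\<lambda>x. sqrt (W x + C) * s x) - C * mass s + \<beta> * (s 0)\<^sup>2"
    using form_as_L2_norms(3)[OF W real_test_L2(1,2)[OF s]] by (simp add: real_test_form)
  show "(\<lambda>x. sqrt (W x + C) * s x) \<in> L2 (leb {0<..})"
    by (rule form_as_L2_norms(1)[OF W real_test_L2(1,2)[OF s]])
qed

text \<open>The trace inequality for test functions, as the hyperplane measure of the half-line is a unit mass at \<open>0\<close>.\<close>

lemma boundary_value_bound:
  assumes s: "s \<in> test_functions (UNIV :: real set)"
  shows "(s 0)\<^sup>2 \<le> 4 * (mass s + mass (pd s 1))"
proof -
  have sm: "smooth s" using s by (rule test_functionsE)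
  have g: "grad s x = pd s 1 x" for x by (simp add: grad_def)
  then have g': "grad s = pd s 1" by (auto simp: fun_eq_iff)
  have h: "(H1_norm {0<..} s)\<^sup>2 = mass s + mass (pd s 1)"
    using H1_norm_eq(1)[of "1::real" "grad s" s] real_test_L2[OF s] grad_is_weak_gradient[OF open_greaterThan s, of 0]
    by (simp add: half_space_real g')
  have [measurable]: "s \<in> borel_measurable borel" by (rule smooth_borel[OF sm])
  have "L2_norm (return borel (0::real)) s = \<bar>s 0\<bar>"
    by (simp add: L2_norm_def integral_return)
  then have "\<bar>s 0\<bar> \<le> 2 * H1_norm {0<..} s"
    using test_trace_bound(2)[of "1::real" s] s by (simp add: half_space_real hyperplane_measure_real)
  then have "\<bar>s 0\<bar>\<^sup>2 \<le> (2 * H1_norm {0<..} s)\<^sup>2" by (rule power_mono) simp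
  then show ?thesis by (simp add: power_mult_distrib h)
qed

lemma real_test_form_diff:
  assumes W: "W \<in> borel_measurable (leb {0<..})" "\<forall>x\<in>{0<..}. \<bar>W x\<bar> \<le> C" 
    and U: "U \<in> borel_measurable (leb {0<..})" "\<forall>x\<in>{0<..}. \<bar>U x\<bar> \<le> C"
    and d: "\<forall>x\<in>{0<..}. \<bar>W x - U x\<bar> \<le> \<delta>" and s: "s \<in> test_functions UNIV"
  shows "test_form (1::real) U \<beta> s \<le> test_form (1::real) W \<beta> s + \<delta> * mass s"
proof -
  have sm: "smooth s" using s by (rule test_functionsE)
  have [measurable]: "s \<in> borel_measurable (leb {0<..})" by (rule L2_measurable[OF real_test_L2(1)[OF s]])
  have i: "integrable (leb {0<..}) (\<lambda>t. (s t)\<^sup>2)" "integrable (leb {0<..}) (\<lambda>t. (pd s 1 t)\<^sup>2)"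
    using L2_integrable[OF real_test_L2(1)[OF s]] L2_integrable[OF real_test_L2(2)[OF s]] by auto
  have j: "integrable (leb {0<..}) (\<lambda>t. X t * (s t)\<^sup>2)" if X: "X \<in> borel_measurable (leb {0<..})" "\<forall>x\<in>{0<..}. \<bar>X x\<bar> \<le> C" for X
  proof (rule Bochner_Integration.integrable_bound)
    show "integrable (leb {0<..}) (\<lambda>t. C * (s t)\<^sup>2)" using i by simp
    show "(\<lambda>t. X t * (s t)\<^sup>2) \<in> borel_measurable (leb {0<..})" using X(1) by measurable
    show "AE t in leb {0<..}. norm (X t * (s t)\<^sup>2) \<le> norm (C * (s t)\<^sup>2)"
    proof (rule AE_I2)
      fix t :: real assume "t \<in> space (leb {0<..})"
      then have "\<bar>X t\<bar> \<le> \<bar>C\<bar>" using X(2) by (force simp: space_restrict_space)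
      then show "norm (X t * (s t)\<^sup>2) \<le> norm (C * (s t)\<^sup>2)" unfolding real_norm_def abs_mult by (rule mult_right_mono) simp
    qed
  qed
  have "(\<integral>t. (pd s 1 t)\<^sup>2 + U t * (s t)\<^sup>2 \<partial>leb {0<..}) \<le> (\<integral>t. ((pd s 1 t)\<^sup>2 + W t * (s t)\<^sup>2) + \<delta> * (s t)\<^sup>2 \<partial>leb {0<..})"
  proof (rule integral_mono)
    fix t :: real assume "t \<in> space (leb {0<..})"
    then have "U t - W t \<le> \<delta>" using d by (force simp: space_restrict_space)
    then have "(U t - W t) * (s t)\<^sup>2 \<le> \<delta> * (s t)\<^sup>2" by (rule mult_right_mono) simp
    then show "(pd s 1 t)\<^sup>2 + U t * (s t)\<^sup>2 \<le> ((pd s 1 t)\<^sup>2 + W t * (s t)\<^sup>2) + \<delta> * (s t)\<^sup>2"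
      by (simp add: left_diff_distrib)
  qed (use i j[OF U] j[OF W] in auto)
  also have "\<dots> = (\<integral>t. (pd s 1 t)\<^sup>2 + W t * (s t)\<^sup>2 \<partial>leb {0<..}) + \<delta> * mass s"
    using i j[OF W] by (simp add: L2_norm_power2)
  finally show ?thesis by (simp add: real_test_form[OF sm])
qed

lemma H1_norm_nonneg: "0 \<le> H1_norm D u"
  by (simp add: H1_norm_def)

text \<open>Cut \<open>z\<close> off on \<open>[0, 1 / n]\<close>. The cutoff has slope of order \<open>n\<close> on an interval of length of order
\<open>1 / n\<close>, where \<open>z\<close> itself is of order \<open>1 / n\<close>. So the error and its derivative are bounded and live on an
interval that shrinks to a point.\<close>

lemma vanishing_in_H1_0:
  fixes z :: "real \<Rightarrow> real"
  assumes z: "z \<in> test_functions UNIV" and z0: "z 0 = 0"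
  shows "z \<in> H1_0 {0<..}"
proof -
  obtain S where S: "smooth z" "compact S" "\<And>x. x \<notin> S \<Longrightarrow> z x = 0" using z by (metis test_functionsE)
  obtain L where L: "L \<ge> 0" "\<And>x. \<bar>pd z 1 x\<bar> \<le> L"
    using test_functions_bounded[OF test_functions_pd[OF z, of 1]] by auto
  have zl: "\<bar>z x\<bar> \<le> L * x" if x: "0 < x" for x
  proof -
    obtain c where "z x - z 0 = (x - 0) * pd z 1 c"
      using MVT2[OF x, of z "pd z 1"] smooth_real_DERIV[OF S(1), of _ UNIV] by auto
    then show ?thesis using L(2)[of c] x by (simp add: z0 abs_mult mult.commute)
  qed
  have "bounded (pd smooth_step 1 ` {-1..1})"
    by (intro compact_imp_bounded compact_continuous_image smooth_continuous smooth_pd smooth_step) auto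
  then obtain B where "\<forall>t\<in>{-1..1}. \<bar>pd smooth_step 1 t\<bar> \<le> B" by (auto simp: bounded_iff)
  then have B: "\<bar>pd smooth_step 1 t\<bar> \<le> B" if "t \<in> {-1..1}" for t using that by blast
  have B0: "B \<ge> 0" using B[of 0] by auto
  define \<theta> where "\<theta> n x = smooth_step (real (Suc n) * x + -1)" for n :: nat and x :: real
  have \<theta>s: "smooth (\<theta> n)" for n unfolding \<theta>_def[abs_def] by (rule smooth_real_affine[OF smooth_step(1)])
  have \<theta>': "pd (\<theta> n) 1 x = real (Suc n) * pd smooth_step 1 (real (Suc n) * x + -1)" for n :: nat and x :: real
  proof -
    have "(\<theta> n has_real_derivative pd smooth_step 1 (real (Suc n) * x + -1) * real (Suc n)) (at x)"
      unfolding \<theta>_def by (rule DERIV_chain'[of "\<lambda>x. real (Suc n) * x + -1" "real (Suc n)" x UNIV smooth_step, OF _ smooth_real_DERIV[OF smooth_step(1)]])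
        (auto intro!: derivative_eq_intros)
    then have "(\<theta> n has_derivative (*) (pd smooth_step 1 (real (Suc n) * x + -1) * real (Suc n))) (at x)" by (simp add: has_field_derivative_def)
    from frechet_derivative_eqI[OF this] show ?thesis by simp
  qed
  have smooth_step_constant: "pd smooth_step 1 t = 0" if "t > 1" for t
  proof -
    have "((\<lambda>t::real. 1::real) has_derivative (\<lambda>h. 0)) (at t)" by simp
    from has_derivative_transform_within_open[OF this open_greaterThan[of 1], of smooth_step] that smooth_step(3)
    have "(smooth_step has_derivative (\<lambda>h. 0)) (at t)" by auto
    from frechet_derivative_eqI[OF this] show ?thesis by simp
  qed
  define \<zeta> where "\<zeta> n x = z x * \<theta> n x" for n x
  have \<zeta>t: "\<zeta> n \<in> test_functions {0<..}" for n
  proof (rule test_functionsI[of _ "S \<inter> {1 / Suc n..}"])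
    show "smooth (\<zeta> n)" unfolding \<zeta>_def[abs_def] by (rule smooth_mult[OF S(1) \<theta>s])
    show "compact (S \<inter> {1 / Suc n..})" by (intro compact_Int_closed S) auto
    show "S \<inter> {1 / Suc n..} \<subseteq> {0<..}" by (auto intro: less_le_trans[OF divide_pos_pos[of 1 "real (Suc n)"]])
    fix x assume "x \<notin> S \<inter> {1 / Suc n..}"
    then consider "x \<notin> S" | "x < 1 / Suc n" by auto
    then show "\<zeta> n x = 0"
    proof cases
      case 2
      then have "real (Suc n) * x + -1 \<le> 0" by (simp add: field_simps)
      then show ?thesis by (simp add: \<zeta>_def \<theta>_def smooth_step(2))
    qed (simp add: \<zeta>_def S)
  qed
  have \<zeta>u: "\<zeta> n \<in> test_functions UNIV" for n by (rule test_functions_mono[OF subset_UNIV \<zeta>t])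
  define d where "d n x = \<zeta> n x - z x" for n x
  have dt: "d n \<in> test_functions UNIV" for n unfolding d_def[abs_def] by (rule test_functions_diff[OF \<zeta>u z])
  \<comment> \<open>\<open>L x \<le> 2 L\<close> bounds the error; \<open>L\<close> and \<open>(L x) ((n + 1) B) \<le> 2 L B\<close> bound its derivative.\<close>
  define K where "K = 3 * L + 2 * L * B"
  have K0: "K \<ge> 0" using L B0 by (simp add: K_def)
  have bd: "\<bar>d n x\<bar> \<le> K * indicator {0..2 / Suc n} x" "\<bar>pd (d n) 1 x\<bar> \<le> K * indicator {0..2 / Suc n} x" if x: "0 < x" for n x
  proof -
    have pdd: "pd (d n) 1 x = pd z 1 x * (\<theta> n x - 1) + z x * pd (\<theta> n) 1 x"
    proof -
      have "pd (d n) 1 x = pd (\<zeta> n) 1 x - pd z 1 x"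
        unfolding d_def[abs_def] by (rule pd_diff[OF _ S(1)]) (rule test_functionsE[OF \<zeta>u])
      also have "pd (\<zeta> n) 1 x = z x * pd (\<theta> n) 1 x + pd z 1 x * \<theta> n x"
        unfolding \<zeta>_def[abs_def] by (rule pd_mult[OF S(1) \<theta>s])
      finally show ?thesis by (simp add: algebra_simps)
    qed
    have dd: "d n x = z x * (\<theta> n x - 1)" by (simp add: d_def \<zeta>_def algebra_simps)
    have t1: "\<bar>\<theta> n x - 1\<bar> \<le> 1" using smooth_step(4,5)[of "real (Suc n) * x + -1"] by (simp add: \<theta>_def)
    show "\<bar>d n x\<bar> \<le> K * indicator {0..2 / Suc n} x"
    proof (cases "x \<le> 2 / Suc n")
      case True
      have "x \<le> 2" using True by (rule order_trans) (simp add: field_simps)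
      have "\<bar>d n x\<bar> \<le> (L * x) * 1" unfolding dd abs_mult using zl[OF x] t1 L x by (intro mult_mono) auto
      also have "\<dots> \<le> L * 2" using L \<open>x \<le> 2\<close> by (simp add: mult_left_mono)
      also have "\<dots> \<le> K" using L B0 by (simp add: K_def)
      finally show ?thesis using True x by simp
    next
      case False
      then have "real (Suc n) * x + -1 \<ge> 1" by (simp add: field_simps)
      then show ?thesis using K0 by (simp add: dd \<theta>_def smooth_step(3))
    qed
    show "\<bar>pd (d n) 1 x\<bar> \<le> K * indicator {0..2 / Suc n} x"
    proof (cases "x \<le> 2 / Suc n")
      case True
      then have k: "real (Suc n) * x \<le> 2" by (simp add: field_simps)
      have "0 \<le> real (Suc n) * x" using x by simp
      then have "\<bar>pd smooth_step 1 (real (Suc n) * x + -1)\<bar> \<le> B" using k by (intro B) auto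
      then have "\<bar>pd (\<theta> n) 1 x\<bar> \<le> real (Suc n) * B" unfolding \<theta>' abs_mult by (intro mult_mono) auto
      then have "\<bar>z x * pd (\<theta> n) 1 x\<bar> \<le> (L * x) * (real (Suc n) * B)"
        unfolding abs_mult using zl[OF x] L x by (intro mult_mono) auto
      also have "\<dots> = (L * B) * (real (Suc n) * x)" by simp
      also have "\<dots> \<le> (L * B) * 2" using k L B0 by (intro mult_left_mono) auto
      finally have 1: "\<bar>z x * pd (\<theta> n) 1 x\<bar> \<le> L * B * 2" .
      have "\<bar>pd z 1 x * (\<theta> n x - 1)\<bar> \<le> L * 1" unfolding abs_mult using L t1 by (intro mult_mono) auto
      then have "\<bar>pd (d n) 1 x\<bar> \<le> L * 1 + L * B * 2" unfolding pdd using 1 by linarith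
      also have "\<dots> \<le> K" using L by (simp add: K_def)
      finally show ?thesis using True x by simp
    next
      case False
      then have "real (Suc n) * x + -1 > 1" by (simp add: field_simps)
      then show ?thesis using K0 smooth_step_constant[of "real (Suc n) * x + -1"] by (simp add: pdd \<theta>' \<theta>_def smooth_step(3))
    qed
  qed
  have iK: "integrable (leb {0<..}) (\<lambda>x. K\<^sup>2 * indicator {0..2 / Suc n} x)" 
    "(\<integral>x. K\<^sup>2 * indicator {0..2 / Suc n} x \<partial>leb {0<..}) \<le> K\<^sup>2 * (2 / Suc n)" for n
  proof -
    have i: "integrable lborel (\<lambda>x::real. K\<^sup>2 * indicator {0..2 / Suc n} x)" by simp
    then have j: "integrable lborel (\<lambda>x::real. indicator {0<..} x * (K\<^sup>2 * indicator {0..2 / Suc n} x))"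
      by (intro indicator_mult_integrable) auto
    then show "integrable (leb {0<..}) (\<lambda>x. K\<^sup>2 * indicator {0..2 / Suc n} x)"
      by (simp only: restrict_lborel_simps(1)[OF open_greaterThan] real_scaleR_def)
    have "(\<integral>x. K\<^sup>2 * indicator {0..2 / Suc n} x \<partial>leb {0<..}) = (\<integral>x. indicator {0<..} x * (K\<^sup>2 * indicator {0..2 / Suc n} x) \<partial>lborel)"
      by (simp only: restrict_lborel_simps(2)[OF open_greaterThan] real_scaleR_def)
    also have "\<dots> \<le> (\<integral>x. K\<^sup>2 * indicator {0..2 / Suc n} x \<partial>lborel)"
      using i j by (intro integral_mono) (auto simp: indicator_def)
    also have "\<dots> = K\<^sup>2 * (2 / Suc n)" by simp
    finally show "(\<integral>x. K\<^sup>2 * indicator {0..2 / Suc n} x \<partial>leb {0<..}) \<le> K\<^sup>2 * (2 / Suc n)" .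
  qed
  have isq: "(indicator A x :: real)\<^sup>2 = indicator A x" for A and x :: real by (simp add: indicator_def)
  have sqb: "mass w \<le> K\<^sup>2 * (2 / Suc n)" if "w \<in> L2 (leb {0<..})" "\<And>x. 0 < x \<Longrightarrow> \<bar>w x\<bar> \<le> K * indicator {0..2 / Suc n} x" for w n
  proof -
    have "mass w \<le> (\<integral>x. K\<^sup>2 * indicator {0..2 / Suc n} x \<partial>leb {0<..})"
      unfolding L2_norm_power2
    proof (rule integral_mono[OF L2_integrable[OF that(1)] iK(1)])
      fix x :: real assume "x \<in> space (leb {0<..})"
      then have "0 < x" by (simp add: space_restrict_space)
      from power_mono[OF that(2)[OF this], of 2] show "(norm (w x))\<^sup>2 \<le> K\<^sup>2 * indicator {0..2 / Suc n} x"
        unfolding power_mult_distrib isq real_norm_def by simp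
    qed
    then show ?thesis using iK(2)[of n] by linarith
  qed
  have hn: "H1_norm {0<..} (d n) \<le> sqrt (K\<^sup>2 * (2 / Suc n) + K\<^sup>2 * (2 / Suc n))" for n
  proof -
    have g': "grad (d n) = pd (d n) 1" by (auto simp: fun_eq_iff grad_def)
    have "H1_norm {0<..} (d n) = sqrt (mass (d n) + mass (pd (d n) 1))"
      using H1_norm_eq(1)[of "1::real" "grad (d n)" "d n"] real_test_L2[OF dt[of n]] grad_is_weak_gradient[OF open_greaterThan dt[of n], of 0]
      by (simp add: half_space_real g')
    also have "\<dots> \<le> sqrt (K\<^sup>2 * (2 / Suc n) + K\<^sup>2 * (2 / Suc n))"
      by (intro real_sqrt_le_mono add_mono sqb real_test_L2 dt bd)
    finally show ?thesis .
  qed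
  have "(\<lambda>n. sqrt (K\<^sup>2 * (2 * inverse (Suc n)) + K\<^sup>2 * (2 * inverse (Suc n)))) \<longlonglongrightarrow> sqrt (K\<^sup>2 * (2 * 0) + K\<^sup>2 * (2 * 0))"
    by (intro tendsto_intros LIMSEQ_inverse_real_of_nat)
  then have lim: "(\<lambda>n. sqrt (K\<^sup>2 * (2 / Suc n) + K\<^sup>2 * (2 / Suc n))) \<longlonglongrightarrow> 0" by (simp add: divide_inverse)
  have "(\<lambda>n. H1_norm {0<..} (d n)) \<longlonglongrightarrow> 0"
    by (rule Lim_null_comparison[OF always_eventually lim]) (intro allI, simp only: real_norm_def abs_of_nonneg[OF H1_norm_nonneg] hn)
  then have "(\<lambda>n. H1_norm {0<..} (\<lambda>x. \<zeta> n x - z x)) \<longlonglongrightarrow> 0" by (simp add: d_def[abs_def])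
  then show ?thesis unfolding H1_0_def using \<zeta>t test_functions_H1[OF open_greaterThan z, of 0] by blast
qed

section \<open>Continuity of the eigenvalue in the Robin parameter\<close>

lemma robin_weight_large:
  "\<exists>d>0. \<forall>\<rho>. 0 < \<rho> \<and> \<rho> < d \<longrightarrow> K \<le> robin_weight \<rho>"
proof (intro exI conjI allI impI)
  show "0 < 1 / (\<bar>K\<bar> + 1)" by simp
  fix \<rho> :: real assume \<rho>: "0 < \<rho> \<and> \<rho> < 1 / (\<bar>K\<bar> + 1)"
  then have "\<bar>K\<bar> + 1 \<le> 1 / \<rho>" by (simp add: field_simps)
  moreover have "robin_weight \<rho> = 1 / \<rho> - 1" using \<rho> by (simp add: robin_weight_def robin_coeff_def diff_divide_distrib)
  ultimately show "K \<le> robin_weight \<rho>" using abs_ge_self[of K] by linarith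
qed

lemma robin_weight_continuous:
  assumes "0 < r" "0 < \<epsilon>"
  shows "\<exists>d>0. \<forall>\<rho>. \<bar>\<rho> - r\<bar> < d \<longrightarrow> 0 < \<rho> \<and> \<bar>robin_weight \<rho> - robin_weight r\<bar> < \<epsilon>"
proof -
  have "isCont (\<lambda>\<rho>. (1 - \<rho>) / \<rho>) r" using assms by (intro continuous_intros) auto
  then obtain d where d: "d > 0" "\<And>\<rho>. \<bar>\<rho> - r\<bar> < d \<Longrightarrow> \<bar>(1 - \<rho>) / \<rho> - (1 - r) / r\<bar> < \<epsilon>"
    using assms(2) unfolding continuous_at_eps_delta dist_real_def by meson
  show ?thesis
  proof (intro exI[of _ "min d r"] conjI allI impI)
    fix \<rho> assume \<rho>: "\<bar>\<rho> - r\<bar> < min d r"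
    show "0 < \<rho>" using \<rho> by linarith
    then show "\<bar>robin_weight \<rho> - robin_weight r\<bar> < \<epsilon>"
      using d(2)[of \<rho>] \<rho> assms by (simp add: robin_weight_def robin_coeff_def)
  qed (use d assms in auto)
qed

context
  fixes W :: "real \<Rightarrow> real \<Rightarrow> real" and C :: real and \<mu> :: "real \<Rightarrow> real"
  assumes Wm: "\<And>\<rho>. \<rho> \<in> {0..1} \<Longrightarrow> W \<rho> \<in> borel_measurable (leb {0<..})"
    and WC: "\<And>\<rho>. \<rho> \<in> {0..1} \<Longrightarrow> \<forall>x\<in>{0<..}. \<bar>W \<rho> x\<bar> \<le> C"
    and \<mu>: "\<And>\<rho>. \<rho> \<in> {0..1} \<Longrightarrow> \<mu> \<rho> = principal_eigenvalue {0<..} (return borel 0) (W \<rho>) \<rho>"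
begin

lemma bound_nonneg: "0 \<le> C"
  using bspec[OF WC[of 0], of 1] by auto

lemma mu_le: "\<rho> \<in> {0..1} \<Longrightarrow> s \<in> form_core (1::real) \<rho> \<Longrightarrow> \<mu> \<rho> * mass s \<le> test_form (1::real) (W \<rho>) (robin_weight \<rho>) s"
  using one_dim_eigenvalue(1)[OF Wm WC, of \<rho>] \<mu> by auto

lemma mu_ge: 
  assumes \<rho>: "\<rho> \<in> {0..1}" 
    and c: "\<And>s. s \<in> form_core (1::real) \<rho> \<Longrightarrow> c * mass s \<le> test_form (1::real) (W \<rho>) (robin_weight \<rho>) s"
  shows "c \<le> \<mu> \<rho>"
  unfolding \<mu>[OF \<rho>] by (rule one_dim_eigenvalue(2)[OF Wm[OF \<rho>] WC[OF \<rho>] _ _ c]) (use \<rho> in auto)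

text \<open>The form controls the gradient, because the boundary term is nonnegative and the potential bounded.\<close>

lemma gradient_bound: 
  assumes "\<rho> \<in> {0..1}" "s \<in> form_core (1::real) \<rho>"
  shows "mass (pd s 1) \<le> test_form (1::real) (W \<rho>) (robin_weight \<rho>) s + C * mass s"
proof -
  have "0 \<le> robin_weight \<rho> * (s 0)\<^sup>2" using robin_weight_nonneg[of \<rho>] assms(1) by simp
  moreover have "0 \<le> mass (\<lambda>x. sqrt (W \<rho> x + C) * s x)" by simp
  ultimately show ?thesis
    unfolding real_test_form_split(1)[OF Wm[OF assms(1)] WC[OF assms(1)] form_core_test[OF assms(2)]] by linarith
qed

lemma mu_lower: "\<rho> \<in> {0..1} \<Longrightarrow> - C \<le> \<mu> \<rho>"
proof (rule mu_ge)
  fix s :: "real \<Rightarrow> real" assume "\<rho> \<in> {0..1}" "s \<in> form_core 1 \<rho>"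
  from gradient_bound[OF this] zero_le_power2[of "L2_norm (leb {0<..}) (pd s 1)"]
  show "- C * mass s \<le> test_form 1 (W \<rho>) (robin_weight \<rho>) s" by linarith
qed

text \<open>The mollifier vanishes at \<open>0\<close>, so its quotient does not involve the boundary weight and bounds all
eigenvalues at once.\<close>

lemma mu_upper: "\<exists>M\<ge>0. \<forall>\<rho>\<in>{0..1}. \<mu> \<rho> \<le> M"
proof -
  let ?k = "mollifier :: real \<Rightarrow> real"
  have t: "?k \<in> test_functions {0<..}" and n: "mass ?k > 0"
    using mollifier_half_space[of "1::real"] by (simp_all add: half_space_real)
  have k0: "?k 0 = 0" by (rule mollifier_zero) simp
  define M where "M = (mass (pd ?k 1) + 2 * C * mass ?k) / mass ?k"
  have "\<mu> \<rho> \<le> M" if \<rho>: "\<rho> \<in> {0..1}" for \<rho>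
  proof -
    have c: "?k \<in> form_core 1 \<rho>" using t test_functions_mono[OF subset_UNIV t] by (simp add: form_core_def half_space_real)
    note ct = form_core_test[OF c]
    have "L2_norm (leb {0<..}) (\<lambda>x. sqrt (W \<rho> x + C) * ?k x) \<le> sqrt (2 * \<bar>C\<bar>) * L2_norm (leb {0<..}) ?k"
      by (rule form_as_L2_norms(2)[OF Wm[OF \<rho>] WC[OF \<rho>] real_test_L2(1)[OF ct] real_test_L2(2)[OF ct]])
    then have "mass (\<lambda>x. sqrt (W \<rho> x + C) * ?k x) \<le> (sqrt (2 * \<bar>C\<bar>) * L2_norm (leb {0<..}) ?k)\<^sup>2"
      by (rule power_mono) (rule L2_norm_nonneg)
    also have "\<dots> = 2 * C * mass ?k" using bound_nonneg by (simp add: power_mult_distrib)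
    finally have *: "mass (\<lambda>x. sqrt (W \<rho> x + C) * ?k x) \<le> 2 * C * mass ?k" .
    have "0 \<le> C * mass ?k" using bound_nonneg by simp
    then have "\<mu> \<rho> * mass ?k \<le> mass (pd ?k 1) + 2 * C * mass ?k"
      using mu_le[OF \<rho> c] * unfolding real_test_form_split(1)[OF Wm[OF \<rho>] WC[OF \<rho>] ct] k0 by simp
    then show ?thesis unfolding M_def using n by (subst pos_le_divide_eq) auto
  qed
  moreover have "M \<ge> 0" unfolding M_def using bound_nonneg by (intro divide_nonneg_nonneg add_nonneg_nonneg mult_nonneg_nonneg) auto
  ultimately show ?thesis by blast
qed

text \<open>A change of the boundary weight costs a multiple of \<open>(s 0)\<^sup>2\<close>. The trace inequality and the
gradient bound dominate it by the form and the mass. The statement is symmetric in \<open>\<rho>\<close> and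
\<open>r\<close> up to the bound \<open>M\<close>, so it yields both semicontinuities.\<close>

lemma mu_compare:
  assumes \<rho>: "\<rho> \<in> {0<..1}" and r: "r \<in> {0<..1}" and \<delta>: "\<forall>x\<in>{0<..}. \<bar>W \<rho> x - W r x\<bar> \<le> \<delta>"
    and \<kappa>: "4 * \<bar>robin_weight \<rho> - robin_weight r\<bar> \<le> \<kappa>" and M: "\<mu> \<rho> \<le> M" "0 \<le> M"
  shows "\<mu> r \<le> \<mu> \<rho> + \<delta> + \<kappa> * (M + 1 + C)"
proof -
  have \<rho>1: "\<rho> \<in> {0..1}" and r1: "r \<in> {0..1}" using \<rho> r by auto
  have \<kappa>0: "0 \<le> \<kappa>" using \<kappa> by (rule order_trans[rotated]) simp
  have core: "form_core (1::real) \<rho> = test_functions UNIV" "form_core (1::real) r = test_functions UNIV"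
    using \<rho> r by (auto simp: form_core_def)
  have "(\<mu> r - \<delta> - \<kappa> * (1 + C)) / (1 + \<kappa>) \<le> \<mu> \<rho>"
  proof (rule mu_ge[OF \<rho>1])
    fix s :: "real \<Rightarrow> real" assume c: "s \<in> form_core 1 \<rho>"
    note t = form_core_test[OF c]
    have sm: "smooth s" using t by (rule test_functionsE)
    define Q where "Q = test_form (1::real) (W \<rho>) (robin_weight \<rho>) s"
    have "\<mu> r * mass s \<le> test_form (1::real) (W r) (robin_weight r) s" using mu_le[OF r1] c core by simp
    also have "\<dots> \<le> test_form (1::real) (W \<rho>) (robin_weight r) s + \<delta> * mass s"
      by (rule real_test_form_diff[OF Wm[OF \<rho>1] WC[OF \<rho>1] Wm[OF r1] WC[OF r1] \<delta> t])
    also have "test_form (1::real) (W \<rho>) (robin_weight r) s = Q + (robin_weight r - robin_weight \<rho>) * (s 0)\<^sup>2"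
      by (simp add: Q_def real_test_form[OF sm] algebra_simps)
    finally have 1: "\<mu> r * mass s \<le> Q + (robin_weight r - robin_weight \<rho>) * (s 0)\<^sup>2 + \<delta> * mass s" by simp
    have "(robin_weight r - robin_weight \<rho>) * (s 0)\<^sup>2 \<le> (\<kappa> / 4) * (s 0)\<^sup>2"
    proof (rule mult_right_mono)
      have "robin_weight r - robin_weight \<rho> \<le> \<bar>robin_weight \<rho> - robin_weight r\<bar>"
        by (subst abs_minus_commute) (rule abs_ge_self)
      also have "\<dots> \<le> \<kappa> / 4" using \<kappa> by simp
      finally show "robin_weight r - robin_weight \<rho> \<le> \<kappa> / 4" .
    qed simp
    also have "\<dots> \<le> (\<kappa> / 4) * (4 * (mass s + mass (pd s 1)))"
      using \<kappa>0 by (intro mult_left_mono boundary_value_bound t) auto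
    also have "\<dots> \<le> (\<kappa> / 4) * (4 * (mass s + (Q + C * mass s)))"
      using \<kappa>0 gradient_bound[OF \<rho>1 c] by (intro mult_left_mono add_left_mono) (auto simp: Q_def)
    finally have "(\<mu> r - \<delta> - \<kappa> * (1 + C)) * mass s \<le> (1 + \<kappa>) * Q" using 1 by (simp add: algebra_simps)
    then show "(\<mu> r - \<delta> - \<kappa> * (1 + C)) / (1 + \<kappa>) * mass s \<le> test_form 1 (W \<rho>) (robin_weight \<rho>) s"
      unfolding Q_def[symmetric] using \<kappa>0 by (simp add: pos_divide_le_eq mult.commute)
  qed
  then have "\<mu> r - \<delta> - \<kappa> * (1 + C) \<le> \<mu> \<rho> * (1 + \<kappa>)" using \<kappa>0 by (simp add: pos_divide_le_eq)
  moreover have "\<mu> \<rho> * \<kappa> \<le> M * \<kappa>" using M \<kappa>0 by (intro mult_right_mono)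
  ultimately show ?thesis by (simp add: algebra_simps)
qed

text \<open>Functions vanishing near \<open>0\<close> are admissible for every \<open>\<rho>\<close> and do not see the boundary weight.\<close>

lemma mu_dirichlet_upper:
  assumes \<rho>: "\<rho> \<in> {0..1}" and \<delta>: "\<forall>x\<in>{0<..}. \<bar>W \<rho> x - W 0 x\<bar> \<le> \<delta>"
  shows "\<mu> \<rho> - \<delta> \<le> \<mu> 0"
proof (rule mu_ge)
  fix s :: "real \<Rightarrow> real" assume c: "s \<in> form_core 1 0"
  then have t0: "s \<in> test_functions {0<..}" by (simp add: form_core_def half_space_real)
  have t: "s \<in> test_functions UNIV" by (rule form_core_test[OF c])
  have sm: "smooth s" using t by (rule test_functionsE)
  have s0: "s 0 = 0" using t0 by (metis test_functionsE greaterThan_iff less_irrefl subsetD)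
  have c\<rho>: "s \<in> form_core 1 \<rho>" using t t0 by (simp add: form_core_def half_space_real)
  have \<delta>': "\<forall>x\<in>{0<..}. \<bar>W 0 x - W \<rho> x\<bar> \<le> \<delta>" using \<delta> by (simp add: abs_minus_commute)
  have "\<mu> \<rho> * mass s \<le> test_form 1 (W \<rho>) (robin_weight \<rho>) s" by (rule mu_le[OF \<rho> c\<rho>])
  also have "\<dots> \<le> test_form 1 (W 0) (robin_weight \<rho>) s + \<delta> * mass s"
    by (rule real_test_form_diff[OF Wm WC Wm[OF \<rho>] WC[OF \<rho>] \<delta>' t]) auto
  also have "test_form 1 (W 0) (robin_weight \<rho>) s = test_form 1 (W 0) (robin_weight 0) s"
    by (simp add: real_test_form[OF sm] s0)
  finally show "(\<mu> \<rho> - \<delta>) * mass s \<le> test_form 1 (W 0) (robin_weight 0) s" by (simp add: left_diff_distrib)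
qed simp

lemma mu_vanishing:
  assumes t: "z \<in> test_functions (UNIV :: real set)" and z0: "z 0 = 0"
  shows "\<mu> 0 * mass z \<le> test_form 1 (W 0) 0 z"
proof -
  have W0: "W 0 \<in> borel_measurable (leb (half_space (1::real)))" "\<forall>x\<in>half_space (1::real). \<bar>W 0 x\<bar> \<le> C"
    using Wm[of 0] WC[of 0] by (auto simp: half_space_real)
  have "z \<in> form_domain (half_space (1::real)) 0"
    using vanishing_in_H1_0[OF t z0] by (simp add: form_domain_def half_space_real)
  from quad_form_lower[OF _ W0 _ _ this, of "\<mu> 0"] mu_le[of 0]
  show ?thesis unfolding quad_form_test[OF _ W0 t, simplified] by (simp add: half_space_real robin_weight_def)
qed

text \<open>Subtracting \<open>s 0\<close> times the cutoff from \<open>s\<close> gives a function \<open>z\<close> that vanishes at \<open>0\<close>. With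
Young's inequality the form and the mass of \<open>s\<close> and \<open>z\<close> agree up to factors \<open>1 + t\<close> and a multiple of
\<open>(s 0)\<^sup>2\<close>. The constant \<open>K\<close> collects these multiples; a boundary weight above \<open>K\<close> absorbs them.\<close>

lemma mu_dirichlet_lower:
  assumes t: "0 < t"
  shows "\<exists>K. \<forall>\<rho>\<in>{0<..1}. \<forall>\<delta>. (\<forall>x\<in>{0<..}. \<bar>W \<rho> x - W 0 x\<bar> \<le> \<delta>) \<and> K \<le> robin_weight \<rho> \<longrightarrow>
     (\<mu> 0 + C) / (1 + t)\<^sup>2 - C - \<delta> \<le> \<mu> \<rho>"
proof -
  let ?\<theta> = "cutoff :: real \<Rightarrow> real"
  define w where "w x = sqrt (W 0 x + C)" for x
  define M where "M s = mass (pd s 1) + mass (\<lambda>x. w x * s x)" for s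
  have W0: "W 0 \<in> borel_measurable (leb {0<..})" "\<forall>x\<in>{0<..}. \<bar>W 0 x\<bar> \<le> C" using Wm WC by auto
  have form: "test_form (1::real) (W 0) \<beta> s = M s - C * mass s + \<beta> * (s 0)\<^sup>2" if "s \<in> test_functions UNIV" for s \<beta>
    using real_test_form_split(1)[OF W0 that] by (simp add: M_def w_def)
  define \<nu> where "\<nu> = \<mu> 0 + C"
  have \<nu>: "0 \<le> \<nu>" using mu_lower[of 0] by (simp add: \<nu>_def)
  define K where "K = ((1 + t) * (1 + 1 / t) * M ?\<theta> + (1 + 1 / t) * \<nu> * mass ?\<theta>) / (1 + t)\<^sup>2"
  have \<theta>s: "smooth ?\<theta>" using cutoff_test by (rule test_functionsE)
  have young: "mass u \<le> (1 + t) * mass v + (1 + 1 / t) * (b\<^sup>2 * mass h)" 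
    if u: "v \<in> L2 (leb {0<..})" "h \<in> L2 (leb {0<..})" "\<And>x. u x = v x + b * h x" for u v h :: "real \<Rightarrow> real" and b
  proof -
    have m: "(\<lambda>x. b * h x) \<in> borel_measurable (leb {0<..})" using L2_measurable[OF u(2)] by measurable
    have le: "norm (b * h x) \<le> \<bar>b\<bar> * norm (h x)" for x by (simp add: abs_mult)
    have "u = (\<lambda>x. v x + b * h x)" using u(3) by auto
    then have "L2_norm (leb {0<..}) u \<le> L2_norm (leb {0<..}) v + L2_norm (leb {0<..}) (\<lambda>x. b * h x)"
      using L2_add(2)[OF u(1) L2_mono(1)[OF u(2) m le]] by simp
    also have "\<dots> \<le> L2_norm (leb {0<..}) v + \<bar>b\<bar> * L2_norm (leb {0<..}) h"
      using L2_mono(2)[OF u(2) m le] by simp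
    finally have "mass u \<le> (L2_norm (leb {0<..}) v + \<bar>b\<bar> * L2_norm (leb {0<..}) h)\<^sup>2"
      by (rule power_mono) (rule L2_norm_nonneg)
    also have "\<dots> \<le> (1 + t / 1) * mass v + (1 + 1 / t) * (\<bar>b\<bar> * L2_norm (leb {0<..}) h)\<^sup>2"
      by (rule young_square) (use t in auto)
    finally show ?thesis by (simp add: power_mult_distrib)
  qed
  have main: "\<nu> * mass s \<le> (1 + t)\<^sup>2 * (M s + K * (s 0)\<^sup>2)" if s: "s \<in> test_functions UNIV" for s
  proof -
    have sm: "smooth s" using s by (rule test_functionsE)
    define z where "z x = s x - s 0 * ?\<theta> x" for x
    have st: "(\<lambda>x. ?\<theta> x * s 0) \<in> test_functions UNIV" by (rule test_functions_mult[OF cutoff_test smooth_const])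
    have ze: "z = (\<lambda>x. s x - ?\<theta> x * s 0)" by (auto simp: z_def)
    have zt: "z \<in> test_functions UNIV" unfolding ze by (rule test_functions_diff[OF s st])
    have z0: "z 0 = 0" by (simp add: z_def cutoff_0)
    have z': "pd z 1 x = pd s 1 x + (- s 0) * pd ?\<theta> 1 x" for x
      unfolding ze by (subst pd_diff[OF sm smooth_mult[OF \<theta>s smooth_const]], subst pd_mult[OF \<theta>s smooth_const]) simp
    note sl = real_test_L2[OF s] and \<theta>l = real_test_L2[OF cutoff_test] and zl = real_test_L2[OF zt]
    have 1: "mass (pd z 1) \<le> (1 + t) * mass (pd s 1) + (1 + 1 / t) * ((s 0)\<^sup>2 * mass (pd ?\<theta> 1))"
      using young[OF sl(2) \<theta>l(2) z'] by simp
    have 2: "mass (\<lambda>x. w x * z x) \<le> (1 + t) * mass (\<lambda>x. w x * s x) + (1 + 1 / t) * ((s 0)\<^sup>2 * mass (\<lambda>x. w x * ?\<theta> x))"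
      using young[of "\<lambda>x. w x * s x" "\<lambda>x. w x * ?\<theta> x" "\<lambda>x. w x * z x" "- s 0"]
        real_test_form_split(2)[OF W0 s] real_test_form_split(2)[OF W0 cutoff_test]
      by (simp add: w_def z_def algebra_simps)
    have 3: "mass s \<le> (1 + t) * mass z + (1 + 1 / t) * ((s 0)\<^sup>2 * mass ?\<theta>)"
      using young[OF zl(1) \<theta>l(1), of s "s 0"] by (simp add: z_def)
    have "\<nu> * mass z \<le> M z" using mu_vanishing[OF zt z0] form[OF zt, of 0] by (simp add: \<nu>_def distrib_right)
    also have "\<dots> \<le> (1 + t) * M s + (1 + 1 / t) * ((s 0)\<^sup>2 * M ?\<theta>)"
      using 1 2 unfolding M_def by (simp only: distrib_left)
    finally have 4: "(1 + t) * (\<nu> * mass z) \<le> (1 + t) * ((1 + t) * M s + (1 + 1 / t) * ((s 0)\<^sup>2 * M ?\<theta>))"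
      using t by (intro mult_left_mono) auto
    have "\<nu> * mass s \<le> \<nu> * ((1 + t) * mass z + (1 + 1 / t) * ((s 0)\<^sup>2 * mass ?\<theta>))" using 3 \<nu> by (rule mult_left_mono)
    also have "\<dots> = (1 + t) * (\<nu> * mass z) + (1 + 1 / t) * \<nu> * mass ?\<theta> * (s 0)\<^sup>2" by (simp add: algebra_simps)
    also have "\<dots> \<le> (1 + t) * ((1 + t) * M s + (1 + 1 / t) * ((s 0)\<^sup>2 * M ?\<theta>)) + (1 + 1 / t) * \<nu> * mass ?\<theta> * (s 0)\<^sup>2"
      using 4 by simp
    also have "\<dots> = (1 + t)\<^sup>2 * M s + ((1 + t) * (1 + 1 / t) * M ?\<theta> + (1 + 1 / t) * \<nu> * mass ?\<theta>) * (s 0)\<^sup>2"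
      by (simp only: power2_eq_square distrib_left distrib_right ac_simps)
    also have "(1 + t) * (1 + 1 / t) * M ?\<theta> + (1 + 1 / t) * \<nu> * mass ?\<theta> = (1 + t)\<^sup>2 * K"
      using t by (simp add: K_def)
    finally show ?thesis by (simp only: distrib_left mult.assoc)
  qed
  have "\<nu> / (1 + t)\<^sup>2 - C - \<delta> \<le> \<mu> \<rho>" 
    if \<rho>: "\<rho> \<in> {0<..1}" and \<delta>: "\<forall>x\<in>{0<..}. \<bar>W \<rho> x - W 0 x\<bar> \<le> \<delta>" and K: "K \<le> robin_weight \<rho>" for \<rho> \<delta>
  proof -
    have \<rho>1: "\<rho> \<in> {0..1}" using \<rho> by auto
    show ?thesis
    proof (rule mu_ge[OF \<rho>1])
      fix s :: "real \<Rightarrow> real" assume "s \<in> form_core 1 \<rho>"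
      then have s: "s \<in> test_functions UNIV" by (rule form_core_test)
      have "(\<nu> / (1 + t)\<^sup>2) * mass s \<le> M s + K * (s 0)\<^sup>2"
        using main[OF s] t by (simp add: pos_divide_le_eq mult.commute)
      also have "\<dots> \<le> M s + robin_weight \<rho> * (s 0)\<^sup>2" using K by (simp add: mult_right_mono)
      also have "\<dots> = test_form (1::real) (W 0) (robin_weight \<rho>) s + C * mass s" by (simp add: form[OF s])
      also have "test_form (1::real) (W 0) (robin_weight \<rho>) s \<le> test_form (1::real) (W \<rho>) (robin_weight \<rho>) s + \<delta> * mass s"
        by (rule real_test_form_diff[OF Wm[OF \<rho>1] WC[OF \<rho>1] W0 \<delta> s])
      finally show "(\<nu> / (1 + t)\<^sup>2 - C - \<delta>) * mass s \<le> test_form 1 (W \<rho>) (robin_weight \<rho>) s"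
        by (simp add: left_diff_distrib)
    qed
  qed
  then show ?thesis unfolding \<nu>_def by blast
qed

text \<open>For \<open>r > 0\<close> the eigenvalues are compared in both directions by \<open>mu_compare\<close>. At \<open>r = 0\<close> the two
Dirichlet bounds are used, with \<open>t\<close> chosen so that the factor \<open>1 / (1 + t)\<^sup>2 \<ge> 1 - 2 t\<close> costs at most \<open>\<epsilon> / 3\<close>.\<close>

lemma mu_continuous:
  assumes Wc: "\<And>r \<epsilon>. r \<in> {0..1} \<Longrightarrow> 0 < \<epsilon> \<Longrightarrow> \<exists>d>0. \<forall>\<rho>\<in>{0..1}. \<bar>\<rho> - r\<bar> < d \<longrightarrow> (\<forall>x\<in>{0<..}. \<bar>W \<rho> x - W r x\<bar> \<le> \<epsilon>)"
  shows "continuous_on {0..1} \<mu>"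
  unfolding continuous_on_iff dist_real_def
proof (intro ballI allI impI)
  fix r \<epsilon> :: real assume r: "r \<in> {0..1}" and \<epsilon>: "0 < \<epsilon>"
  obtain M where M: "0 \<le> M" "\<And>\<rho>. \<rho> \<in> {0..1} \<Longrightarrow> \<mu> \<rho> \<le> M" using mu_upper by blast
  have e3: "0 < \<epsilon> / 3" using \<epsilon> by simp
  obtain d1 where d1: "d1 > 0" "\<And>\<rho>. \<rho> \<in> {0..1} \<Longrightarrow> \<bar>\<rho> - r\<bar> < d1 \<Longrightarrow> \<forall>x\<in>{0<..}. \<bar>W \<rho> x - W r x\<bar> \<le> \<epsilon> / 3"
    using Wc[OF r e3] by blast
  show "\<exists>d>0. \<forall>\<rho>\<in>{0..1}. \<bar>\<rho> - r\<bar> < d \<longrightarrow> \<bar>\<mu> \<rho> - \<mu> r\<bar> < \<epsilon>"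
  proof (cases "r = 0")
    case False
    define D where "D = M + 1 + C"
    have D: "D > 0" using M bound_nonneg by (simp add: D_def)
    define \<kappa> where "\<kappa> = \<epsilon> / (3 * D)"
    have \<kappa>: "\<kappa> / 4 > 0" using \<epsilon> D by (simp add: \<kappa>_def)
    have kD: "\<kappa> * D = \<epsilon> / 3" using D by (simp add: \<kappa>_def)
    obtain d2 where d2: "d2 > 0" "\<And>\<rho>. \<bar>\<rho> - r\<bar> < d2 \<Longrightarrow> 0 < \<rho>" "\<And>\<rho>. \<bar>\<rho> - r\<bar> < d2 \<Longrightarrow> \<bar>robin_weight \<rho> - robin_weight r\<bar> < \<kappa> / 4"
      using robin_weight_continuous[of r, OF _ \<kappa>] r False by fastforce
    show ?thesis
    proof (intro exI[of _ "min d1 d2"] conjI ballI impI)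
      fix \<rho> assume \<rho>: "\<rho> \<in> {0..1}" "\<bar>\<rho> - r\<bar> < min d1 d2"
      have p: "\<rho> \<in> {0<..1}" "r \<in> {0<..1}" using \<rho> r False d2(2)[of \<rho>] by auto
      have \<delta>: "\<forall>x\<in>{0<..}. \<bar>W \<rho> x - W r x\<bar> \<le> \<epsilon> / 3" using d1(2)[of \<rho>] \<rho> by simp
      then have \<delta>': "\<forall>x\<in>{0<..}. \<bar>W r x - W \<rho> x\<bar> \<le> \<epsilon> / 3" by (simp add: abs_minus_commute)
      have k: "4 * \<bar>robin_weight \<rho> - robin_weight r\<bar> \<le> \<kappa>" using d2(3)[of \<rho>] \<rho> by simp
      then have k': "4 * \<bar>robin_weight r - robin_weight \<rho>\<bar> \<le> \<kappa>" by (simp add: abs_minus_commute)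
      have "\<mu> r \<le> \<mu> \<rho> + \<epsilon> / 3 + \<kappa> * D" unfolding D_def by (rule mu_compare[OF p \<delta> k M(2)[OF \<rho>(1)] M(1)])
      moreover have "\<mu> \<rho> \<le> \<mu> r + \<epsilon> / 3 + \<kappa> * D" unfolding D_def by (rule mu_compare[OF p(2,1) \<delta>' k' M(2)[OF r] M(1)])
      ultimately show "\<bar>\<mu> \<rho> - \<mu> r\<bar> < \<epsilon>" unfolding kD using \<epsilon> by (simp add: abs_less_iff)
    qed (use d1 d2 in auto)
  next
    case True
    define L where "L = \<mu> 0 + C"
    have L: "0 \<le> L" using mu_lower[of 0] by (simp add: L_def)
    \<comment> \<open>Then \<open>2 t L \<le> \<epsilon> / 3\<close>.\<close>
    define t where "t = \<epsilon> / (6 * (L + 1))"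
    have t: "0 < t" using L \<epsilon> by (simp add: t_def)
    have "L * (2 * t) \<le> (L + 1) * (2 * t)" using t by (intro mult_right_mono) auto
    also have "\<dots> = \<epsilon> / 3" using L by (simp add: t_def field_simps)
    finally have Lt: "L * (2 * t) \<le> \<epsilon> / 3" .
    have "1 - 2 * t \<le> 1 / (1 + t)\<^sup>2"
    proof -
      have "0 \<le> t\<^sup>2 * (3 + 2 * t)" using t by simp
      then have "(1 - 2 * t) * (1 + t)\<^sup>2 \<le> 1" by (simp add: power2_eq_square algebra_simps)
      then show ?thesis using t by (subst pos_le_divide_eq) auto
    qed
    then have "L * (1 - 2 * t) \<le> L * (1 / (1 + t)\<^sup>2)" using L by (rule mult_left_mono)
    then have Lb: "L - \<epsilon> / 3 \<le> L / (1 + t)\<^sup>2" using Lt by (simp add: right_diff_distrib)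
    obtain K where K: "\<And>\<rho> \<delta>. \<rho> \<in> {0<..1} \<Longrightarrow> (\<forall>x\<in>{0<..}. \<bar>W \<rho> x - W 0 x\<bar> \<le> \<delta>) \<Longrightarrow> K \<le> robin_weight \<rho> \<Longrightarrow> L / (1 + t)\<^sup>2 - C - \<delta> \<le> \<mu> \<rho>"
      using mu_dirichlet_lower[OF t] unfolding L_def by blast
    obtain d2 where d2: "d2 > 0" "\<And>\<rho>. 0 < \<rho> \<Longrightarrow> \<rho> < d2 \<Longrightarrow> K \<le> robin_weight \<rho>" using robin_weight_large[of K] by blast
    show ?thesis
    proof (intro exI[of _ "min d1 d2"] conjI ballI impI)
      fix \<rho> assume \<rho>: "\<rho> \<in> {0..1}" "\<bar>\<rho> - r\<bar> < min d1 d2"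
      have \<delta>: "\<forall>x\<in>{0<..}. \<bar>W \<rho> x - W 0 x\<bar> \<le> \<epsilon> / 3" using d1(2)[of \<rho>] \<rho> True by simp
      have "\<mu> \<rho> - \<epsilon> / 3 \<le> \<mu> 0" by (rule mu_dirichlet_upper[OF \<rho>(1) \<delta>])
      moreover have "\<mu> 0 - \<epsilon> / 3 - \<epsilon> / 3 \<le> \<mu> \<rho>"
      proof (cases "\<rho> = 0")
        case False
        then have "\<rho> \<in> {0<..1}" "0 < \<rho>" "\<rho> < d2" using \<rho> True by auto
        from K[OF this(1) \<delta> d2(2)[OF this(2,3)]] show ?thesis using Lb unfolding L_def by linarith
      qed (use \<epsilon> in auto)
      ultimately show "\<bar>\<mu> \<rho> - \<mu> r\<bar> < \<epsilon>" using \<epsilon> True by (simp add: abs_less_iff)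
    qed (use d1 d2 in auto)
  qed
qed

end

section \<open>Steady states of a monostable reaction\<close>

text \<open>The part of the steady state equation in which the Robin parameter does not occur.\<close>

definition increasing_profile :: "(real \<Rightarrow> real) \<Rightarrow> (real \<Rightarrow> real) \<Rightarrow> (real \<Rightarrow> real) \<Rightarrow> bool" where
  "increasing_profile f \<phi> \<phi>' \<longleftrightarrow>
     (\<forall>y\<ge>0. (\<phi> has_real_derivative \<phi>' y) (at y within {0..})) \<and> continuous_on {0..} \<phi>' \<and>
     (\<forall>y>0. (\<phi>' has_real_derivative - f (\<phi> y)) (at y)) \<and> (\<phi> \<longlongrightarrow> 1) at_top \<and>
     (\<forall>y\<ge>0. 0 \<le> \<phi> y \<and> \<phi> y < 1) \<and> (\<forall>y\<ge>0. 0 < \<phi>' y)"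

lemma robin_steady_state_profile:
  "robin_steady_state f \<rho> \<phi> \<longleftrightarrow> (\<exists>\<phi>'. increasing_profile f \<phi> \<phi>' \<and> (1 - \<rho>) * \<phi> 0 = \<rho> * \<phi>' 0)"
  unfolding robin_steady_state_def increasing_profile_def by (rule iff_exI) (auto simp: algebra_simps)

text \<open>For an antiderivative \<open>F\<close> of \<open>f\<close> this is the slope at height \<open>u\<close> of a trajectory of
\<open>\<phi>'' = - f(\<phi>)\<close> that tends to \<open>1\<close> with slope tending to \<open>0\<close>.\<close>

definition speed :: "(real \<Rightarrow> real) \<Rightarrow> real \<Rightarrow> real" where
  "speed F u = sqrt (2 * (F 1 - F u))"

lemma mvt_within:
  fixes g g' :: "real \<Rightarrow> real"
  assumes "a < b" "\<And>x. a \<le> x \<Longrightarrow> (g has_real_derivative g' x) (at x within {a..})"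
  shows "\<exists>x. a < x \<and> x < b \<and> g b - g a = g' x * (b - a)"
proof -
  have "(g has_derivative (*) (g' x)) (at x within {a..b})" if "a \<le> x" "x \<le> b" for x
    using DERIV_subset[OF assms(2)[OF that(1)], of "{a..b}"] by (auto simp: has_field_derivative_def)
  from mvt_simple[OF assms(1) this] show ?thesis by auto
qed

locale monostable_reaction =
  fixes f f' :: "real \<Rightarrow> real" and \<gamma> :: real
  assumes \<gamma>: "0 < \<gamma>" and hoelder: "C1_hoelder \<gamma> f f'" and f0: "f 0 = 0" and f1: "f 1 = 0"
    and fpos: "\<And>u. 0 < u \<Longrightarrow> u < 1 \<Longrightarrow> 0 < f u" and f'0: "0 < f' 0" and f'1: "f' 1 < 0"
begin

lemma f_deriv: "0 \<le> u \<Longrightarrow> (f has_real_derivative f' u) (at u within {0..})"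
  using hoelder by (simp add: C1_hoelder_def)

lemma f_deriv_pos: "0 < u \<Longrightarrow> (f has_real_derivative f' u) (at u)"
  using f_deriv[of u] at_within_interior[of u "{0..}"] by (simp add: interior_real_atLeast)

lemma f_cont: "continuous_on {0..} f"
  using f_deriv by (intro DERIV_continuous_on) auto

lemma f'_cont: "continuous_on {0..} f'"
  unfolding continuous_on_def
proof
  fix u :: real assume "u \<in> {0..}"
  then have u: "0 \<le> u" by simp
  then obtain B where B: "\<forall>a\<in>{0..u + 1}. \<forall>b\<in>{0..u + 1}. \<bar>f' a - f' b\<bar> \<le> B * \<bar>a - b\<bar> powr \<gamma>"
    using conjunct2[OF hoelder[unfolded C1_hoelder_def], rule_format, of "u + 1"] by force
  have "((\<lambda>v. \<bar>v - u\<bar>) \<longlongrightarrow> \<bar>u - u\<bar>) (at u within {0..})" by (intro tendsto_intros)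
  then have "((\<lambda>v. \<bar>v - u\<bar> powr \<gamma>) \<longlongrightarrow> 0) (at u within {0..})"
    by (intro tendsto_zero_powrI[OF _ tendsto_const]) (use \<gamma> in auto)
  from tendsto_mult[OF tendsto_const[of B] this]
  have "((\<lambda>v. B * \<bar>v - u\<bar> powr \<gamma>) \<longlongrightarrow> 0) (at u within {0..})" by simp
  moreover have "\<forall>\<^sub>F v in at u within {0..}. norm (f' v - f' u) \<le> B * \<bar>v - u\<bar> powr \<gamma>"
  proof -
    have "\<forall>\<^sub>F v in at u within {0..}. v < u + 1" 
      by (rule order_tendstoD(2)[OF tendsto_ident_at]) simp
    moreover have "\<forall>\<^sub>F v in at u within {0..}. v \<in> {0..}" by (simp add: eventually_at_filter)
    ultimately show ?thesis
    proof eventually_elim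
      fix v assume "v < u + 1" "v \<in> {0..}"
      then show "norm (f' v - f' u) \<le> B * \<bar>v - u\<bar> powr \<gamma>"
        using bspec[OF bspec[OF B, of v], of u] u by simp
    qed
  qed
  ultimately have "((\<lambda>v. f' v - f' u) \<longlongrightarrow> 0) (at u within {0..})"
    by (rule Lim_null_comparison[rotated])
  then show "(f' \<longlongrightarrow> f' u) (at u within {0..})" by (simp add: Lim_null[of f'])
qed

text \<open>\<open>f\<close> vanishes at \<open>1\<close> and has a bounded derivative.\<close>

lemma f_upper: "\<exists>K>0. \<forall>u\<in>{0..1}. f u \<le> K * (1 - u)"
proof -
  have "bounded (f' ` {0..1})"
    by (intro compact_imp_bounded compact_continuous_image continuous_on_subset[OF f'_cont]) auto
  then obtain K where K: "K > 0" "\<forall>u\<in>{0..1}. \<bar>f' u\<bar> \<le> K" by (auto simp: bounded_pos)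
  have "f u \<le> K * (1 - u)" if u: "u \<in> {0..1}" for u
  proof (cases "u = 1")
    case False
    then have "u < 1" using u by auto
    have d: "(f has_real_derivative f' x) (at x within {u..})" if "u \<le> x" for x
      by (rule DERIV_subset[OF f_deriv]) (use that u in auto)
    obtain x where x: "u < x" "x < 1" "f 1 - f u = f' x * (1 - u)"
      using mvt_within[OF \<open>u < 1\<close> d] by auto
    have "x \<in> {0..1}" using x u by auto
    then have "- f' x \<le> K" using K(2) by (auto simp: abs_le_iff)
    then have "- f' x * (1 - u) \<le> K * (1 - u)" using u by (intro mult_right_mono) auto
    then show ?thesis using x(3) f1 by simp
  qed (simp add: f1)
  then show ?thesis using K(1) by blast
qed

text \<open>Near \<open>0\<close> and \<open>1\<close> the signs of \<open>f' 0\<close> and \<open>f' 1\<close> give linear lower bounds; in between \<open>f\<close> attains a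
positive minimum.\<close>

lemma f_lower: "\<exists>k>0. \<forall>u\<in>{0..1}. k * u * (1 - u) \<le> f u"
proof -
  have "((\<lambda>u. (f u - f 0) / (u - 0)) \<longlongrightarrow> f' 0) (at 0 within {0..})"
    using f_deriv[of 0] by (simp add: has_field_derivative_iff)
  then have "\<forall>\<^sub>F u in at 0 within {0..}. f' 0 / 2 < (f u - f 0) / (u - 0)"
    by (rule order_tendstoD) (use f'0 in simp)
  then obtain d where d: "d > 0" "\<And>u. 0 < u \<Longrightarrow> u < d \<Longrightarrow> f' 0 / 2 < f u / u"
    unfolding eventually_at by (auto simp: dist_real_def f0)
  have "((\<lambda>u. (f u - f 1) / (u - 1)) \<longlongrightarrow> f' 1) (at 1)"
    using f_deriv_pos[of 1] by (simp add: has_field_derivative_iff)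
  then have "\<forall>\<^sub>F u in at 1. (f u - f 1) / (u - 1) < f' 1 / 2"
    by (rule order_tendstoD) (use f'1 in simp)
  then obtain d' where d': "d' > 0" "\<And>u. u < 1 \<Longrightarrow> 1 - u < d' \<Longrightarrow> f u / (u - 1) < f' 1 / 2"
    unfolding eventually_at by (auto simp: dist_real_def f1)
  define a b where "a = min d (1/2)" and "b = max (1 - d') (1/2)"
  have ab: "0 < a" "a \<le> b" "b < 1" using d(1) d'(1) by (auto simp: a_def b_def)
  have "\<exists>x\<in>{a..b}. \<forall>y\<in>{a..b}. f x \<le> f y"
    by (rule continuous_attains_inf) (use ab in \<open>auto intro: continuous_on_subset[OF f_cont]\<close>)
  then obtain x where x: "x \<in> {a..b}" "\<And>y. y \<in> {a..b} \<Longrightarrow> f x \<le> f y" by auto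
  have fx: "0 < f x" using x(1) ab by (intro fpos) auto
  \<comment> \<open>As \<open>u\<close>, \<open>1 - u\<close> and \<open>u (1 - u)\<close> are at most \<open>1\<close>, one constant serves all three regions.\<close>
  define k where "k = min (f x) (min (f' 0 / 2) (- f' 1 / 2))"
  have k: "k > 0" "k \<le> f x" "k \<le> f' 0 / 2" "k \<le> - f' 1 / 2" using fx f'0 f'1 by (auto simp: k_def)
  have "k * u * (1 - u) \<le> f u" if u: "u \<in> {0..1}" for u
  proof -
    consider "u = 0" | "u = 1" | "0 < u" "u < a" | "a \<le> u" "u \<le> b" | "b < u" "u < 1" using u by force
    then show ?thesis
    proof cases
      case 3
      have "f' 0 / 2 * u \<le> f u" using d(2)[of u] 3 by (simp add: a_def pos_less_divide_eq)
      moreover have "k * u * (1 - u) \<le> k * u * 1" using u k by (intro mult_left_mono) auto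
      moreover have "k * u \<le> f' 0 / 2 * u" using u k by (intro mult_right_mono) auto
      ultimately show ?thesis by linarith
    next
      case 4
      have "u * (1 - u) \<le> 1" using u by (intro mult_le_one) auto
      then have "k * (u * (1 - u)) \<le> k * 1" using k by (intro mult_left_mono) auto
      moreover have "f x \<le> f u" using 4 by (intro x(2)) auto
      ultimately show ?thesis unfolding mult.assoc using k(2) by linarith
    next
      case 5
      have "f u / (u - 1) < f' 1 / 2" using 5 by (intro d'(2)) (auto simp: b_def)
      then have "f' 1 / 2 * (u - 1) < f u" using 5 by (simp add: neg_divide_less_eq)
      moreover have "- f' 1 / 2 * (1 - u) = f' 1 / 2 * (u - 1)" by (simp add: field_simps)
      ultimately have "- f' 1 / 2 * (1 - u) \<le> f u" by linarith
      moreover have "k * u * (1 - u) \<le> k * 1 * (1 - u)" using u k by (intro mult_left_mono mult_right_mono) auto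
      moreover have "k * (1 - u) \<le> - f' 1 / 2 * (1 - u)" using u k by (intro mult_right_mono) auto
      ultimately show ?thesis by linarith
    qed (simp_all add: f0 f1)
  qed
  then show ?thesis using k(1) by blast
qed

lemma antiderivative: "\<exists>F. \<forall>u\<in>{0..1}. (F has_real_derivative f u) (at u within {0..1})"
  by (rule exI[of _ "\<lambda>u. integral {0..u} f"])
     (auto intro!: integral_has_real_derivative continuous_on_subset[OF f_cont])

context
  fixes F :: "real \<Rightarrow> real"
  assumes F: "\<forall>u\<in>{0..1}. (F has_real_derivative f u) (at u within {0..1})"
begin

lemma F_cont: "continuous_on {0..1} F"
  using F by (intro DERIV_continuous_on) auto

lemma F_deriv: "0 < u \<Longrightarrow> u < 1 \<Longrightarrow> (F has_real_derivative f u) (at u)"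
  using bspec[OF F, of u] at_within_Icc_at[of 0 u 1] by simp

lemma F_less: 
  assumes "0 \<le> u" "u < v" "v \<le> 1" shows "F u < F v"
proof (rule DERIV_pos_imp_increasing_open[OF assms(2)])
  fix x assume "u < x" "x < v"
  then have "DERIV F x :> f x" "0 < f x" using assms by (auto intro: F_deriv fpos)
  then show "\<exists>y. DERIV F x :> y \<and> 0 < y" by blast
qed (rule continuous_on_subset[OF F_cont], use assms in auto)

lemma speed_antimono: "0 \<le> u \<Longrightarrow> u \<le> v \<Longrightarrow> v \<le> 1 \<Longrightarrow> speed F v \<le> speed F u"
  using F_less[of u v] by (cases "u = v") (auto simp: speed_def)

lemma speed_pos: "0 \<le> u \<Longrightarrow> u < 1 \<Longrightarrow> 0 < speed F u"
  using F_less[of u 1] by (simp add: speed_def)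

end

context
  fixes \<phi> \<phi>' :: "real \<Rightarrow> real"
  assumes prof: "increasing_profile f \<phi> \<phi>'"
begin

lemma profile_deriv: "0 \<le> y \<Longrightarrow> (\<phi> has_real_derivative \<phi>' y) (at y within {0..})"
  and profile_slope_continuous: "continuous_on {0..} \<phi>'"
  and profile_slope_deriv: "0 < y \<Longrightarrow> (\<phi>' has_real_derivative - f (\<phi> y)) (at y)"
  and profile_limit: "(\<phi> \<longlongrightarrow> 1) at_top"
  and profile_range: "0 \<le> y \<Longrightarrow> 0 \<le> \<phi> y \<and> \<phi> y < 1"
  and profile_slope_pos: "0 \<le> y \<Longrightarrow> 0 < \<phi>' y"
  using prof by (simp_all add: increasing_profile_def)

lemma phi_deriv: "0 < y \<Longrightarrow> (\<phi> has_real_derivative \<phi>' y) (at y)"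
  using profile_deriv[of y] at_within_interior[of y "{0..}"] by (simp add: interior_real_atLeast)

lemma phi_cont: "continuous_on {0..} \<phi>"
  using profile_deriv by (intro DERIV_continuous_on) auto

lemma phi_less: 
  assumes "0 \<le> a" "a < b" shows "\<phi> a < \<phi> b"
proof (rule DERIV_pos_imp_increasing_open[OF assms(2)])
  fix x assume "a < x" "x < b"
  then have "DERIV \<phi> x :> \<phi>' x" "0 < \<phi>' x" using assms by (auto intro: phi_deriv profile_slope_pos)
  then show "\<exists>y. DERIV \<phi> x :> y \<and> 0 < y" by blast
qed (rule continuous_on_subset[OF phi_cont], use assms in auto)

text \<open>The increments of \<open>\<phi>\<close> over unit intervals tend to \<open>0\<close> and are values of the slope. A sequence along
which the slope vanishes suffices to identify constants of motion at infinity.\<close>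

lemma slope_sequence: "\<exists>\<xi>::nat \<Rightarrow> real. (\<forall>n. real n < \<xi> n) \<and> (\<lambda>n. \<phi>' (\<xi> n)) \<longlonglongrightarrow> 0 \<and> (\<lambda>n. \<phi> (\<xi> n)) \<longlonglongrightarrow> 1"
proof -
  have "\<exists>x. real n < x \<and> \<phi> (real (Suc n)) - \<phi> (real n) = \<phi>' x" for n :: nat
  proof -
    have d: "(\<phi> has_real_derivative \<phi>' x) (at x within {real n..})" if "real n \<le> x" for x
      by (rule DERIV_subset[OF profile_deriv]) (use that in \<open>auto intro: order_trans[OF of_nat_0_le_iff]\<close>)
    show ?thesis using mvt_within[of "real n" "real (Suc n)", OF _ d] by auto
  qed
  then obtain \<xi> where \<xi>: "\<And>n::nat. real n < \<xi> n" "\<And>n. \<phi> (real (Suc n)) - \<phi> (real n) = \<phi>' (\<xi> n)" by metis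
  have top: "filterlim \<xi> at_top sequentially"
    by (rule filterlim_at_top_mono[OF filterlim_real_sequentially]) (use \<xi>(1) in \<open>auto intro!: always_eventually less_imp_le\<close>)
  have "(\<lambda>n. \<phi> (real (Suc n)) - \<phi> (real n)) \<longlonglongrightarrow> 1 - 1"
    by (intro tendsto_diff LIMSEQ_Suc[OF filterlim_compose[OF profile_limit filterlim_real_sequentially]]
        filterlim_compose[OF profile_limit filterlim_real_sequentially])
  then show ?thesis using \<xi> filterlim_compose[OF profile_limit top] by (intro exI[of _ \<xi>]) simp
qed

text \<open>The function \<open>\<phi>'\<^sup>2 - K (1 - \<phi>)\<^sup>2\<close> is increasing, as \<open>f(\<phi>) \<le> K (1 - \<phi>)\<close>, and tends to
\<open>0\<close> along the sequence, hence is nonpositive.\<close>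

lemma slope_le:
  assumes K: "0 < K" "\<forall>u\<in>{0..1}. f u \<le> K * (1 - u)" and y: "0 \<le> y"
  shows "\<phi>' y \<le> sqrt K * (1 - \<phi> y)"
proof -
  obtain \<xi> :: "nat \<Rightarrow> real" where "(\<forall>n. real n < \<xi> n) \<and> (\<lambda>n. \<phi>' (\<xi> n)) \<longlonglongrightarrow> 0 \<and> (\<lambda>n. \<phi> (\<xi> n)) \<longlonglongrightarrow> 1"
    by (rule exE[OF slope_sequence])
  then have \<xi>: "\<And>n. real n < \<xi> n" "(\<lambda>n. \<phi>' (\<xi> n)) \<longlonglongrightarrow> 0" "(\<lambda>n. \<phi> (\<xi> n)) \<longlonglongrightarrow> 1" by simp_all
  define g where "g x = (\<phi>' x)\<^sup>2 - K * (1 - \<phi> x)\<^sup>2" for x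
  have g: "g y \<le> g b" if b: "y \<le> b" for b
  proof (rule DERIV_nonneg_imp_increasing_open[OF b])
    fix x assume x: "y < x" "x < b"
    then have x0: "0 < x" using y by simp
    have "DERIV g x :> 2 * \<phi>' x * (K * (1 - \<phi> x) - f (\<phi> x))"
      unfolding g_def using x0 by (auto intro!: derivative_eq_intros phi_deriv profile_slope_deriv simp: algebra_simps)
    moreover have "0 \<le> 2 * \<phi>' x * (K * (1 - \<phi> x) - f (\<phi> x))"
      using K(2) profile_range[of x] profile_slope_pos[of x] x0 by (intro mult_nonneg_nonneg) (auto simp: less_imp_le)
    ultimately show "\<exists>z. DERIV g x :> z \<and> 0 \<le> z" by blast
  next
    show "continuous_on {y..b} g" unfolding g_def using y
      by (intro continuous_intros continuous_on_subset[OF profile_slope_continuous] continuous_on_subset[OF phi_cont]) auto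
  qed
  have "(\<lambda>n. g (\<xi> n)) \<longlonglongrightarrow> 0\<^sup>2 - K * (1 - 1)\<^sup>2"
    unfolding g_def by (intro tendsto_intros \<xi>)
  then have "(\<lambda>n. g (\<xi> n)) \<longlonglongrightarrow> 0" by simp
  moreover have "\<exists>N. \<forall>n\<ge>N. g y \<le> g (\<xi> n)"
  proof -
    obtain N where N: "y < real N" using reals_Archimedean2 by blast
    have "g y \<le> g (\<xi> n)" if "n \<ge> N" for n
    proof (rule g)
      have "real N \<le> real n" using that by simp
      then show "y \<le> \<xi> n" using N \<xi>(1)[of n] by linarith
    qed
    then show ?thesis by blast
  qed
  ultimately have "g y \<le> 0" by (rule LIMSEQ_le_const)
  then have "(\<phi>' y)\<^sup>2 \<le> (sqrt K * (1 - \<phi> y))\<^sup>2" using K(1) by (simp add: g_def power_mult_distrib)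
  then show ?thesis by (rule power2_le_imp_le) (use K(1) profile_range[OF y] in auto)
qed

text \<open>Conservation of the energy \<open>\<phi>'\<^sup>2 + 2 F(\<phi>)\<close>, whose value is read off at infinity.\<close>

lemma slope_eq_speed:
  assumes F: "\<forall>u\<in>{0..1}. (F has_real_derivative f u) (at u within {0..1})" and y: "0 \<le> y"
  shows "\<phi>' y = speed F (\<phi> y)"
proof -
  obtain \<xi> :: "nat \<Rightarrow> real" where "(\<forall>n. real n < \<xi> n) \<and> (\<lambda>n. \<phi>' (\<xi> n)) \<longlonglongrightarrow> 0 \<and> (\<lambda>n. \<phi> (\<xi> n)) \<longlonglongrightarrow> 1"
    by (rule exE[OF slope_sequence])
  then have \<xi>: "\<And>n. real n < \<xi> n" "(\<lambda>n. \<phi>' (\<xi> n)) \<longlonglongrightarrow> 0" "(\<lambda>n. \<phi> (\<xi> n)) \<longlonglongrightarrow> 1" by simp_all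
  define E where "E x = (\<phi>' x)\<^sup>2 + 2 * F (\<phi> x)" for x
  have r01: "\<phi> ` {0..} \<subseteq> {0..1}" 
  proof (rule image_subsetI)
    fix x :: real assume "x \<in> {0..}"
    then show "\<phi> x \<in> {0..1}" using profile_range[of x] by auto
  qed
  have cE: "continuous_on {0..} E" unfolding E_def
    by (intro continuous_on_add continuous_on_power continuous_on_mult continuous_on_const profile_slope_continuous
        continuous_on_compose2[OF F_cont[OF F] phi_cont r01])
  have dE: "DERIV E x :> 0" if x: "0 < x" for x
  proof -
    have p: "0 < \<phi> x" "\<phi> x < 1" using phi_less[of 0 x] profile_range[of 0] profile_range[of x] x by auto
    have "DERIV (\<lambda>x. F (\<phi> x)) x :> f (\<phi> x) * \<phi>' x"
      by (rule DERIV_chain2[OF F_deriv[OF F p] phi_deriv[OF x]])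
    from DERIV_add[OF DERIV_power[OF profile_slope_deriv[OF x], of 2] DERIV_cmult[OF this, of 2]]
    show ?thesis unfolding E_def by (simp add: algebra_simps)
  qed
  have const: "E x = E 0" if x: "0 \<le> x" for x
  proof (rule DERIV_isconst2[of 0 "x + 1"])
    show "continuous_on {0..x + 1} E" by (rule continuous_on_subset[OF cE]) auto
  qed (use x in \<open>auto intro: dE\<close>)
  have "(\<lambda>n. E (\<xi> n)) \<longlonglongrightarrow> 0\<^sup>2 + 2 * F 1"
    unfolding E_def
  proof (intro tendsto_intros \<xi>)
    have r: "\<phi> (\<xi> n) \<in> {0..1}" for n using profile_range[of "\<xi> n"] \<xi>(1)[of n] of_nat_0_le_iff[of n, where 'a=real] by auto
    show "(\<lambda>n. F (\<phi> (\<xi> n))) \<longlonglongrightarrow> F 1"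
      by (rule continuous_on_tendsto_compose[OF F_cont[OF F] \<xi>(3)]) (use r in auto)
  qed
  moreover have "E (\<xi> n) = E 0" for n
    using \<xi>(1)[of n] of_nat_0_le_iff[of n, where 'a=real] by (intro const) linarith
  ultimately have "E 0 = 2 * F 1" by (simp add: LIMSEQ_const_iff)
  then have "(\<phi>' y)\<^sup>2 = 2 * (F 1 - F (\<phi> y))" using const[OF y] by (simp add: E_def)
  moreover have "\<phi>' y = sqrt ((\<phi>' y)\<^sup>2)" using profile_slope_pos[OF y] by simp
  ultimately show ?thesis by (simp only: speed_def)
qed

text \<open>The logarithmic derivative \<open>p = \<phi>'' / \<phi>'\<close> of the slope. The bound \<open>p \<le> - c \<phi>\<close> combines
\<open>f(\<phi>) \<ge> k \<phi> (1 - \<phi>)\<close> with \<open>\<phi>' \<le> \<surd>K (1 - \<phi>)\<close>, in which the factor \<open>1 - \<phi>\<close> cancels.\<close>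

lemma riccati_solution:
  defines "p \<equiv> \<lambda>y. - f (\<phi> y) / \<phi>' y"
  shows "continuous_on {0..} p" "continuous_on {0..} (\<lambda>y. - f' (\<phi> y) - (p y)\<^sup>2)"
    "\<And>y. 0 < y \<Longrightarrow> (p has_real_derivative - f' (\<phi> y) - (p y)\<^sup>2) (at y)"
    "\<exists>c>0. \<forall>y\<ge>0. p y \<le> - c * \<phi> y"
proof -
  have profile_range': "\<phi> ` {0..} \<subseteq> {0..}" using profile_range by auto
  show cp: "continuous_on {0..} p" unfolding p_def
    by (intro continuous_on_divide continuous_on_minus continuous_on_compose2[OF f_cont phi_cont profile_range'] profile_slope_continuous)
       (auto dest: profile_slope_pos)
  show "continuous_on {0..} (\<lambda>y. - f' (\<phi> y) - (p y)\<^sup>2)"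
    by (intro continuous_intros continuous_on_compose2[OF f'_cont phi_cont profile_range'] cp)
  show "(p has_real_derivative - f' (\<phi> y) - (p y)\<^sup>2) (at y)" if y: "0 < y" for y
  proof -
    have ph: "0 < \<phi> y" using phi_less[of 0 y] profile_range[of 0] y by auto
    have "DERIV (\<lambda>x. f (\<phi> x)) y :> f' (\<phi> y) * \<phi>' y"
      by (rule DERIV_chain2[OF f_deriv_pos[OF ph] phi_deriv[OF y]])
    then have "(p has_real_derivative ((- (f' (\<phi> y) * \<phi>' y)) * \<phi>' y - (- f (\<phi> y)) * (- f (\<phi> y))) / (\<phi>' y * \<phi>' y)) (at y)"
      unfolding p_def using profile_slope_pos[of y] y by (intro DERIV_divide DERIV_minus profile_slope_deriv) auto
    moreover have "((- (f' (\<phi> y) * \<phi>' y)) * \<phi>' y - (- f (\<phi> y)) * (- f (\<phi> y))) / (\<phi>' y * \<phi>' y) = - f' (\<phi> y) - (p y)\<^sup>2"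
      using profile_slope_pos[of y] y by (simp add: p_def diff_divide_distrib power2_eq_square)
    ultimately show ?thesis by simp
  qed
  obtain k where k: "k > 0" "\<forall>u\<in>{0..1}. k * u * (1 - u) \<le> f u" using f_lower by blast
  obtain K where K: "K > 0" "\<forall>u\<in>{0..1}. f u \<le> K * (1 - u)" using f_upper by blast
  have "p y \<le> - (k / sqrt K) * \<phi> y" if y: "0 \<le> y" for y
  proof -
    have u: "0 \<le> \<phi> y" "\<phi> y < 1" using profile_range[OF y] by auto
    have "k / sqrt K * \<phi> y * \<phi>' y \<le> k / sqrt K * \<phi> y * (sqrt K * (1 - \<phi> y))"
      using u k K by (intro mult_left_mono slope_le y) auto
    also have "\<dots> = k * \<phi> y * (1 - \<phi> y)" using K(1) by simp
    also have "\<dots> \<le> f (\<phi> y)" using k(2) u by auto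
    finally have "k / sqrt K * \<phi> y \<le> f (\<phi> y) / \<phi>' y" using profile_slope_pos[OF y] by (simp add: pos_le_divide_eq)
    then show ?thesis by (simp add: p_def)
  qed
  then show "\<exists>c>0. \<forall>y\<ge>0. p y \<le> - c * \<phi> y" using k(1) K(1) by (intro exI[of _ "k / sqrt K"]) auto
qed

end

text \<open>Perturbing the Riccati solution to \<open>p + q\<close> leaves \<open>V - (p + q)' - (p + q)\<^sup>2 = - 2 p q - q' - q\<^sup>2\<close>. For
\<open>\<rho> > 0\<close> the profile is bounded below by \<open>\<phi> 0 > 0\<close>, so \<open>p \<le> - \<delta>\<close> and the constant \<open>q = \<delta>\<close> works. For
\<open>\<rho> = 0\<close> the solution \<open>p\<close> vanishes at \<open>0\<close>; there the positivity comes from \<open>- q'\<close>, and as the test functions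
vanish at \<open>0\<close> no sign of \<open>(p + q) 0\<close> is required.\<close>

lemma potential_positive:
  assumes \<rho>: "0 \<le> \<rho>" "\<rho> < 1" and st: "robin_steady_state f \<rho> \<phi>"
  shows "\<exists>c>0. \<forall>s\<in>form_core (1::real) \<rho>. c * mass s \<le> test_form (1::real) (\<lambda>y. - f' (\<phi> y)) (robin_weight \<rho>) s"
proof -
  obtain \<phi>' where prof: "increasing_profile f \<phi> \<phi>'" and bc: "(1 - \<rho>) * \<phi> 0 = \<rho> * \<phi>' 0"
    using st unfolding robin_steady_state_profile by blast
  note range = profile_range[OF prof] and slope = profile_slope_pos[OF prof]
  define p where "p y = - f (\<phi> y) / \<phi>' y" for y
  note R = riccati_solution[OF prof, folded p_def]
  obtain c where c: "c > 0" "\<And>y. 0 \<le> y \<Longrightarrow> p y \<le> - c * \<phi> y" using R(4) by blast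
  have V: "continuous_on {0..} (\<lambda>y. - f' (\<phi> y))"
    by (intro continuous_intros continuous_on_compose2[OF f'_cont phi_cont[OF prof]]) (use range in auto)
  have less: "\<phi> a < \<phi> b" if "0 \<le> a" "a < b" for a b using phi_less[OF prof that] .
  have le: "\<phi> a \<le> \<phi> b" if "0 \<le> a" "a \<le> b" for a b using less[OF that(1), of b] that by (cases "a = b") auto
  show ?thesis
  proof (cases "\<rho> = 0")
    case False
    define \<delta> where "\<delta> = c * \<phi> 0"
    have "\<phi> 0 > 0"
    proof -
      have "\<rho> * \<phi>' 0 > 0" using False \<rho> slope[of 0] by simp
      then have "(1 - \<rho>) * \<phi> 0 > 0" unfolding bc .
      then show ?thesis using \<rho> by (simp add: zero_less_mult_iff)
    qed
    then have \<delta>: "\<delta> > 0" using c by (simp add: \<delta>_def)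
    have p: "p y \<le> - \<delta>" if "0 \<le> y" for y
    proof -
      have "c * \<phi> 0 \<le> c * \<phi> y" using le[of 0 y] that c(1) by (intro mult_left_mono) auto
      then show ?thesis using c(2)[OF that] by (simp add: \<delta>_def)
    qed
    have "\<delta>\<^sup>2 * mass s \<le> test_form (1::real) (\<lambda>y. - f' (\<phi> y)) (robin_weight \<rho>) s" if s: "s \<in> form_core 1 \<rho>" for s
    proof (rule riccati_bound[OF form_core_test[OF s] V])
      show "continuous_on {0..} (\<lambda>y. p y + \<delta>)" by (intro continuous_intros R(1))
      show "continuous_on {0..} (\<lambda>y. - f' (\<phi> y) - (p y)\<^sup>2)" by (rule R(2))
      show "((\<lambda>y. p y + \<delta>) has_real_derivative - f' (\<phi> y) - (p y)\<^sup>2) (at y)" if "0 < y" for y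
        using R(3)[OF that] by (auto intro!: derivative_eq_intros)
      show "\<delta>\<^sup>2 \<le> - f' (\<phi> y) - (- f' (\<phi> y) - (p y)\<^sup>2) - (p y + \<delta>)\<^sup>2" if "0 < y" for y
      proof -
        have "\<delta> * (2 * p y + \<delta>) \<le> \<delta> * (- \<delta>)" using p[of y] that \<delta> by (intro mult_left_mono) auto
        then show ?thesis by (simp add: power2_eq_square algebra_simps)
      qed
      show "p 0 + \<delta> \<le> robin_weight \<rho> \<or> s 0 = 0" using p[of 0] robin_weight_nonneg[of \<rho>] \<rho> by auto
    qed
    then show ?thesis using \<delta> by (intro exI[of _ "\<delta>\<^sup>2"]) auto
  next
    case True
    define \<delta> where "\<delta> = c * \<phi> 1"
    \<comment> \<open>The term \<open>q\<^sup>2 \<le> 4 \<epsilon>\<^sup>2\<close> must not exceed half of \<open>- 2 p q \<ge> 2 \<delta> \<epsilon>\<close> on \<open>[1, \<infinity>)\<close>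
      and half of \<open>- q' \<ge> \<epsilon> / e\<close> on \<open>(0, 1]\<close>.\<close>
    define \<epsilon> where "\<epsilon> = min (\<delta> / 4) (exp (- 1) / 8)"
    have \<delta>: "\<delta> > 0" using c less[of 0 1] range[of 0] by (simp add: \<delta>_def)
    have \<epsilon>: "\<epsilon> > 0" "4 * \<epsilon> \<le> \<delta>" "4 * \<epsilon> \<le> exp (- 1) / 2" using \<delta> by (auto simp: \<epsilon>_def)
    define q where "q y = \<epsilon> * (1 + exp (- y))" for y :: real
    define m where "m = min (\<epsilon> * \<delta>) (\<epsilon> * (exp (- 1) / 2))"
    have m: "m > 0" using \<epsilon> \<delta> by (simp add: m_def)
    have q: "\<epsilon> \<le> q y" "q y \<le> 2 * \<epsilon>" if "0 \<le> y" for y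
      using that \<epsilon>(1) by (auto simp: q_def algebra_simps)
    have p0: "p y \<le> 0" if "0 \<le> y" for y
      using c(2)[OF that] c(1) range[OF that] mult_nonneg_nonneg[of c "\<phi> y"] by linarith
    have p1: "p y \<le> - \<delta>" if "1 \<le> y" for y
    proof -
      have "c * \<phi> 1 \<le> c * \<phi> y" using le[of 1 y] that c(1) by (intro mult_left_mono) auto
      then show ?thesis using c(2)[of y] that by (simp add: \<delta>_def)
    qed
    have "m * mass s \<le> test_form (1::real) (\<lambda>y. - f' (\<phi> y)) (robin_weight \<rho>) s" if s: "s \<in> form_core 1 \<rho>" for s
    proof (rule riccati_bound[OF form_core_test[OF s] V])
      show "continuous_on {0..} (\<lambda>y. p y + q y)" unfolding q_def by (intro continuous_intros R(1))
      show "continuous_on {0..} (\<lambda>y. - f' (\<phi> y) - (p y)\<^sup>2 - \<epsilon> * exp (- y))" by (intro continuous_intros R(2))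
      show "((\<lambda>y. p y + q y) has_real_derivative - f' (\<phi> y) - (p y)\<^sup>2 - \<epsilon> * exp (- y)) (at y)" if "0 < y" for y
        unfolding q_def using R(3)[OF that] by (auto intro!: derivative_eq_intros)
      show "m \<le> - f' (\<phi> y) - (- f' (\<phi> y) - (p y)\<^sup>2 - \<epsilon> * exp (- y)) - (p y + q y)\<^sup>2" if y: "0 < y" for y
      proof -
        have eq: "- f' (\<phi> y) - (- f' (\<phi> y) - (p y)\<^sup>2 - \<epsilon> * exp (- y)) - (p y + q y)\<^sup>2 = 2 * (q y * (- p y)) + \<epsilon> * exp (- y) - (q y)\<^sup>2"
          by (simp add: power2_eq_square algebra_simps)
        have "(q y)\<^sup>2 \<le> (2 * \<epsilon>)\<^sup>2" using q[of y] y \<epsilon>(1) by (intro power_mono) auto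
        then have q2: "(q y)\<^sup>2 \<le> \<epsilon> * (4 * \<epsilon>)" by (simp add: power2_eq_square)
        show ?thesis
        proof (cases "1 \<le> y")
          case True
          have "\<epsilon> * \<delta> \<le> q y * (- p y)" using p1[OF True] q(1)[of y] y \<delta> \<epsilon> by (intro mult_mono) auto
          moreover have "0 \<le> \<epsilon> * exp (- y)" using \<epsilon> by simp
          moreover have "\<epsilon> * (4 * \<epsilon>) \<le> \<epsilon> * \<delta>" using \<epsilon> by (intro mult_left_mono) auto
          ultimately have "\<epsilon> * \<delta> \<le> 2 * (q y * (- p y)) + \<epsilon> * exp (- y) - (q y)\<^sup>2" using q2 by linarith
          then show ?thesis unfolding eq m_def by simp
        next
          case False
          have "0 \<le> q y * (- p y)" using p0[of y] q(1)[of y] y \<epsilon> by (intro mult_nonneg_nonneg) auto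
          moreover have "\<epsilon> * exp (- 1) \<le> \<epsilon> * exp (- y)" using False \<epsilon> by (intro mult_left_mono) auto
          moreover have "\<epsilon> * (4 * \<epsilon>) \<le> \<epsilon> * (exp (- 1) / 2)" using \<epsilon> by (intro mult_left_mono) auto
          ultimately have "\<epsilon> * (exp (- 1) / 2) \<le> 2 * (q y * (- p y)) + \<epsilon> * exp (- y) - (q y)\<^sup>2" using q2 by linarith
          then show ?thesis unfolding eq m_def by simp
        qed
      qed
      have "s \<in> test_functions {0<..}" using s True by (simp add: form_core_def half_space_real)
      then show "p 0 + q 0 \<le> robin_weight \<rho> \<or> s 0 = 0" by (metis test_functionsE greaterThan_iff less_irrefl subsetD)
    qed
    then show ?thesis using m by blast
  qed
qed

end

section \<open>Dependence of the steady state on the Robin parameter\<close>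

context monostable_reaction
begin

text \<open>Both profiles solve \<open>\<phi>' = h(\<phi>)\<close> with the decreasing function \<open>h\<close> = \<open>speed F\<close>, so the squared difference
decreases.\<close>

lemma profile_contraction:
  assumes \<phi>: "increasing_profile f \<phi> \<phi>'" and \<psi>: "increasing_profile f \<psi> \<psi>'" and y: "0 \<le> y"
  shows "\<bar>\<phi> y - \<psi> y\<bar> \<le> \<bar>\<phi> 0 - \<psi> 0\<bar>"
proof -
  obtain F where F: "\<forall>u\<in>{0..1}. (F has_real_derivative f u) (at u within {0..1})" using antiderivative by blast
  define D where "D x = - (\<phi> x - \<psi> x)\<^sup>2" for x
  have "D 0 \<le> D y"
  proof (rule DERIV_nonneg_imp_increasing_open[OF y])
    fix x assume x: "0 < x" "x < y"
    have r: "0 \<le> \<phi> x" "\<phi> x \<le> 1" "0 \<le> \<psi> x" "\<psi> x \<le> 1" using profile_range[OF \<phi>, of x] profile_range[OF \<psi>, of x] x by auto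
    have "DERIV D x :> - (2 * ((\<phi>' x - \<psi>' x) * (\<phi> x - \<psi> x)))"
      unfolding D_def
      using DERIV_minus[OF DERIV_power[OF DERIV_diff[OF phi_deriv[OF \<phi> x(1)] phi_deriv[OF \<psi> x(1)]], of 2]] by simp
    moreover have "(\<phi>' x - \<psi>' x) * (\<phi> x - \<psi> x) \<le> 0"
    proof (cases "\<phi> x \<le> \<psi> x")
      case True
      then have "\<psi>' x \<le> \<phi>' x"
        using speed_antimono[OF F r(1) True r(4)] x slope_eq_speed[OF \<phi> F, of x] slope_eq_speed[OF \<psi> F, of x] by simp
      then show ?thesis using True by (intro mult_nonneg_nonpos) auto
    next
      case False
      then have "\<phi>' x \<le> \<psi>' x"
        using speed_antimono[OF F r(3) _ r(2)] x slope_eq_speed[OF \<phi> F, of x] slope_eq_speed[OF \<psi> F, of x] by simp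
      then show ?thesis using False by (intro mult_nonpos_nonneg) auto
    qed
    then have "0 \<le> - (2 * ((\<phi>' x - \<psi>' x) * (\<phi> x - \<psi> x)))" by linarith
    ultimately show "\<exists>z. DERIV D x :> z \<and> 0 \<le> z" by blast
  next
    show "continuous_on {0..y} D" unfolding D_def
      by (intro continuous_on_minus continuous_on_power continuous_on_diff
          continuous_on_subset[OF phi_cont[OF \<phi>]] continuous_on_subset[OF phi_cont[OF \<psi>]]) auto
  qed
  then show ?thesis by (simp add: D_def abs_le_square_iff)
qed

text \<open>The initial values solve \<open>(1 - \<rho>) u = \<rho> h(u)\<close> with the decreasing function \<open>h\<close> = \<open>speed F\<close>. Subtracting
the two equations, the larger initial value has the smaller slope, so the terms with \<open>h\<close> have the favourable sign.\<close>

lemma boundary_value_step: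
  assumes F: "\<forall>u\<in>{0..1}. (F has_real_derivative f u) (at u within {0..1})"
    and \<phi>: "increasing_profile f \<phi> \<phi>'" "(1 - \<rho>) * \<phi> 0 = \<rho> * \<phi>' 0" and \<rho>: "0 \<le> \<rho>"
    and \<psi>: "increasing_profile f \<psi> \<psi>'" "(1 - r) * \<psi> 0 = r * \<psi>' 0"
    and le: "\<psi> 0 \<le> \<phi> 0"
  shows "(1 - \<rho>) * \<bar>\<phi> 0 - \<psi> 0\<bar> \<le> \<bar>\<rho> - r\<bar> * (1 + speed F 0)"
proof -
  have r: "0 \<le> \<phi> 0" "\<phi> 0 \<le> 1" "0 \<le> \<psi> 0" "\<psi> 0 \<le> 1" using profile_range[OF \<phi>(1), of 0] profile_range[OF \<psi>(1), of 0] by auto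
  have eq: "\<phi>' 0 = speed F (\<phi> 0)" "\<psi>' 0 = speed F (\<psi> 0)"
    using slope_eq_speed[OF \<phi>(1) F, of 0] slope_eq_speed[OF \<psi>(1) F, of 0] by auto
  have h: "\<phi>' 0 \<le> \<psi>' 0" "\<psi>' 0 \<le> speed F 0" "0 \<le> \<psi>' 0"
    unfolding eq using speed_antimono[OF F r(3) le r(2)] speed_antimono[OF F _ r(3) r(4)] profile_slope_pos[OF \<psi>(1), of 0] eq(2) by auto
  have "\<rho> * \<phi>' 0 \<le> \<rho> * \<psi>' 0" using h(1) \<rho> by (rule mult_left_mono)
  moreover have "(1 - \<rho>) * (\<phi> 0 - \<psi> 0) = \<rho> * \<phi>' 0 - r * \<psi>' 0 + (\<rho> - r) * \<psi> 0"
    using \<phi>(2) \<psi>(2) by (simp add: algebra_simps)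
  ultimately have "(1 - \<rho>) * (\<phi> 0 - \<psi> 0) \<le> (\<rho> - r) * (\<psi>' 0 + \<psi> 0)" by (simp add: algebra_simps)
  also have "\<dots> \<le> \<bar>\<rho> - r\<bar> * (1 + speed F 0)" using h r by (intro mult_mono) auto
  finally show ?thesis using le by simp
qed

text \<open>As \<open>\<rho> \<rightarrow> 1\<close> the boundary condition forces the initial slope to \<open>0\<close>, and the slope is bounded away from
\<open>0\<close> at all heights below \<open>1 - \<eta>\<close>.\<close>

lemma boundary_value_limit:
  assumes \<epsilon>: "0 < \<epsilon>"
  shows "\<exists>d>0. \<forall>\<rho> \<phi> \<phi>'. increasing_profile f \<phi> \<phi>' \<and> (1 - \<rho>) * \<phi> 0 = \<rho> * \<phi>' 0 \<and> \<rho> < 1 \<and> 1 - \<rho> < d \<longrightarrow> 1 - \<phi> 0 < \<epsilon>"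
proof -
  obtain F where F: "\<forall>u\<in>{0..1}. (F has_real_derivative f u) (at u within {0..1})" using antiderivative by blast
  \<comment> \<open>The height \<open>1 - \<eta>\<close> has to be nonnegative.\<close>
  define \<eta> where "\<eta> = min \<epsilon> (1/2)"
  have \<eta>: "0 < \<eta>" "\<eta> < 1" "\<eta> \<le> \<epsilon>" using \<epsilon> by (auto simp: \<eta>_def)
  define h where "h = speed F (1 - \<eta>)"
  have h: "0 < h" unfolding h_def by (rule speed_pos[OF F]) (use \<eta> in auto)
  have "1 - \<phi> 0 < \<epsilon>" if \<phi>: "increasing_profile f \<phi> \<phi>'" "(1 - \<rho>) * \<phi> 0 = \<rho> * \<phi>' 0" and \<rho>: "\<rho> < 1" "1 - \<rho> < min (1/2) (h/2)" for \<rho> \<phi> \<phi>'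
  proof (rule ccontr)
    assume "\<not> 1 - \<phi> 0 < \<epsilon>"
    then have le: "\<phi> 0 \<le> 1 - \<eta>" using \<eta> by linarith
    have r: "0 \<le> \<phi> 0" "\<phi> 0 \<le> 1" using profile_range[OF \<phi>(1), of 0] by auto
    have "h \<le> \<phi>' 0" unfolding h_def using slope_eq_speed[OF \<phi>(1) F, of 0] speed_antimono[OF F r(1) le] \<eta> by simp
    then have "1/2 * h \<le> \<rho> * \<phi>' 0" using \<rho> h by (intro mult_mono) auto
    also have "\<dots> \<le> (1 - \<rho>) * 1" unfolding \<phi>(2)[symmetric] using \<rho> r by (intro mult_left_mono) auto
    finally show False using \<rho> by simp
  qed
  then show ?thesis using h by (intro exI[of _ "min (1/2) (h/2)"]) auto
qed

text \<open>By uniform continuity of \<open>f'\<close> on \<open>[0, 1]\<close> it suffices that the profiles are uniformly close. Away from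
\<open>\<rho> = 1\<close> this is the contraction together with the bound on initial values; at \<open>\<rho> = 1\<close> the profile lies between its
initial value and \<open>1\<close>.\<close>

lemma potential_continuous:
  assumes st: "\<And>\<rho>. 0 \<le> \<rho> \<Longrightarrow> \<rho> < 1 \<Longrightarrow> robin_steady_state f \<rho> (\<phi> \<rho>)" and \<phi>1: "\<And>y. 0 \<le> y \<Longrightarrow> \<phi> 1 y = 1"
    and r: "r \<in> {0..1}" and \<epsilon>: "0 < \<epsilon>"
  shows "\<exists>d>0. \<forall>\<rho>\<in>{0..1}. \<bar>\<rho> - r\<bar> < d \<longrightarrow> (\<forall>y\<in>{0<..}. \<bar>- f' (\<phi> \<rho> y) - - f' (\<phi> r y)\<bar> \<le> \<epsilon>)"
proof -
  have "uniformly_continuous_on {0..1} f'"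
    by (intro compact_uniformly_continuous continuous_on_subset[OF f'_cont]) auto
  then obtain \<eta> where \<eta>: "\<eta> > 0" "\<And>u v. u \<in> {0..1} \<Longrightarrow> v \<in> {0..1} \<Longrightarrow> \<bar>v - u\<bar> < \<eta> \<Longrightarrow> \<bar>f' v - f' u\<bar> < \<epsilon>"
    unfolding uniformly_continuous_on_def dist_real_def using \<epsilon> by metis
  have prof: "\<exists>\<phi>'. increasing_profile f (\<phi> \<rho>) \<phi>' \<and> (1 - \<rho>) * \<phi> \<rho> 0 = \<rho> * \<phi>' 0" if "0 \<le> \<rho>" "\<rho> < 1" for \<rho>
    using st[OF that] by (simp add: robin_steady_state_profile)
  have range: "\<phi> \<rho> y \<in> {0..1}" if "\<rho> \<in> {0..1}" "0 \<le> y" for \<rho> y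
  proof (cases "\<rho> = 1")
    case False
    then show ?thesis using prof[of \<rho>] that profile_range[of "\<phi> \<rho>" _ y] by force
  qed (use \<phi>1 that in simp)
  have close: "\<bar>- f' (\<phi> \<rho> y) - - f' (\<phi> r y)\<bar> \<le> \<epsilon>" if "\<rho> \<in> {0..1}" "0 < y" "\<bar>\<phi> \<rho> y - \<phi> r y\<bar> < \<eta>" for \<rho> y
    using \<eta>(2)[OF range[OF r, of y] range[OF that(1), of y]] that by (simp add: abs_minus_commute)
  show ?thesis
  proof (cases "r = 1")
    case True
    obtain d where d: "d > 0" "\<And>\<rho> \<phi> \<phi>'. increasing_profile f \<phi> \<phi>' \<Longrightarrow> (1 - \<rho>) * \<phi> 0 = \<rho> * \<phi>' 0 \<Longrightarrow> \<rho> < 1 \<Longrightarrow> 1 - \<rho> < d \<Longrightarrow> 1 - \<phi> 0 < \<eta>"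
      using boundary_value_limit[OF \<eta>(1)] by blast
    show ?thesis
    proof (intro exI[of _ d] conjI ballI impI d)
      fix \<rho> y :: real assume \<rho>: "\<rho> \<in> {0..1}" "\<bar>\<rho> - r\<bar> < d" and y: "y \<in> {0<..}"
      have "\<bar>\<phi> \<rho> y - 1\<bar> < \<eta>"
      proof (cases "\<rho> = 1")
        case False
        then obtain \<phi>' where p: "increasing_profile f (\<phi> \<rho>) \<phi>'" "(1 - \<rho>) * \<phi> \<rho> 0 = \<rho> * \<phi>' 0"
          using prof[of \<rho>] \<rho> by auto
        have "1 - \<phi> \<rho> 0 < \<eta>" by (rule d(2)[OF p]) (use \<rho> True False in auto)
        moreover have "\<phi> \<rho> 0 < \<phi> \<rho> y" by (rule phi_less[OF p(1)]) (use y in auto)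
        moreover have "\<phi> \<rho> y < 1" using profile_range[OF p(1), of y] y by auto
        ultimately show ?thesis by (simp add: abs_less_iff)
      qed (use \<phi>1 y \<eta> in simp)
      then show "\<bar>- f' (\<phi> \<rho> y) - - f' (\<phi> r y)\<bar> \<le> \<epsilon>" using close[OF \<rho>(1), of y] \<phi>1[of y] y True by simp
    qed
  next
    case False
    then have r1: "0 \<le> r" "r < 1" using r by auto
    obtain \<psi>' where p: "increasing_profile f (\<phi> r) \<psi>'" "(1 - r) * \<phi> r 0 = r * \<psi>' 0" using prof[OF r1] by blast
    obtain F where F: "\<forall>u\<in>{0..1}. (F has_real_derivative f u) (at u within {0..1})" using antiderivative by blast
    define A where "A = 1 + speed F 0"
    have A: "A > 0" using speed_pos[OF F, of 0] by (simp add: A_def)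
    define d where "d = min ((1 - r) / 2) (\<eta> * ((1 - r) / 2) / A)"
    have d: "d > 0" using r1 \<eta>(1) A by (simp add: d_def)
    show ?thesis
    proof (intro exI[of _ d] conjI ballI impI d)
      fix \<rho> y :: real assume \<rho>: "\<rho> \<in> {0..1}" "\<bar>\<rho> - r\<bar> < d" and y: "y \<in> {0<..}"
      have dd: "\<bar>\<rho> - r\<bar> < (1 - r) / 2" "\<bar>\<rho> - r\<bar> * A < \<eta> * ((1 - r) / 2)"
        using \<rho>(2) A by (auto simp: d_def pos_less_divide_eq)
      have "\<rho> - r < (1 - r) / 2" using dd(1) abs_ge_self[of "\<rho> - r"] by linarith
      then have \<rho>1: "0 \<le> \<rho>" "\<rho> < 1" "(1 - r) / 2 \<le> 1 - \<rho>" "(1 - r) / 2 \<le> 1 - r" using \<rho> r1 by auto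
      obtain \<phi>' where q: "increasing_profile f (\<phi> \<rho>) \<phi>'" "(1 - \<rho>) * \<phi> \<rho> 0 = \<rho> * \<phi>' 0" using prof[OF \<rho>1(1,2)] by blast
      have "(1 - r) / 2 * \<bar>\<phi> \<rho> 0 - \<phi> r 0\<bar> \<le> \<bar>\<rho> - r\<bar> * A"
      proof (cases "\<phi> r 0 \<le> \<phi> \<rho> 0")
        case True
        have "(1 - r) / 2 * \<bar>\<phi> \<rho> 0 - \<phi> r 0\<bar> \<le> (1 - \<rho>) * \<bar>\<phi> \<rho> 0 - \<phi> r 0\<bar>" using \<rho>1 by (intro mult_right_mono) auto
        also have "\<dots> \<le> \<bar>\<rho> - r\<bar> * A" unfolding A_def by (rule boundary_value_step[OF F q \<rho>1(1) p True])
        finally show ?thesis .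
      next
        case False
        have "(1 - r) / 2 * \<bar>\<phi> r 0 - \<phi> \<rho> 0\<bar> \<le> (1 - r) * \<bar>\<phi> r 0 - \<phi> \<rho> 0\<bar>" using \<rho>1 by (intro mult_right_mono) auto
        also have "\<dots> \<le> \<bar>r - \<rho>\<bar> * A" unfolding A_def by (rule boundary_value_step[OF F p r1(1) q]) (use False in auto)
        finally show ?thesis by (simp add: abs_minus_commute)
      qed
      also have "\<dots> < (1 - r) / 2 * \<eta>" using dd(2) by (simp add: mult.commute)
      finally have "\<bar>\<phi> \<rho> 0 - \<phi> r 0\<bar> < \<eta>" using r1 by simp
      then have "\<bar>\<phi> \<rho> y - \<phi> r y\<bar> < \<eta>" using profile_contraction[OF q(1) p(1), of y] y by simp
      then show "\<bar>- f' (\<phi> \<rho> y) - - f' (\<phi> r y)\<bar> \<le> \<epsilon>" using close[OF \<rho>(1), of y] y by simp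
    qed
  qed
qed

lemma potential_regular:
  assumes st: "\<And>\<rho>. 0 \<le> \<rho> \<Longrightarrow> \<rho> < 1 \<Longrightarrow> robin_steady_state f \<rho> (\<phi> \<rho>)" and \<phi>1: "\<And>y. 0 \<le> y \<Longrightarrow> \<phi> 1 y = 1"
  shows "\<exists>C. \<forall>\<rho>\<in>{0..1}. (\<lambda>y. - f' (\<phi> \<rho> y)) \<in> borel_measurable (leb {0<..}) \<and> (\<forall>y\<in>{0<..}. \<bar>- f' (\<phi> \<rho> y)\<bar> \<le> C)"
proof -
  have "bounded (f' ` {0..1})"
    by (intro compact_imp_bounded compact_continuous_image continuous_on_subset[OF f'_cont]) auto
  then obtain C where C: "\<forall>u\<in>{0..1}. \<bar>f' u\<bar> \<le> C" by (auto simp: bounded_iff)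
  have "continuous_on {0<..} (\<lambda>y. - f' (\<phi> \<rho> y)) \<and> (\<forall>y\<in>{0<..}. \<bar>- f' (\<phi> \<rho> y)\<bar> \<le> C)" if \<rho>: "\<rho> \<in> {0..1}" for \<rho>
  proof (cases "\<rho> = 1")
    case True
    have "continuous_on {0<..} (\<lambda>y. - f' (\<phi> \<rho> y)) \<longleftrightarrow> continuous_on {0<..} (\<lambda>y::real. - f' 1)"
      by (rule continuous_on_cong) (use True \<phi>1 in auto)
    then show ?thesis using True \<phi>1 C by auto
  next
    case False
    then have "0 \<le> \<rho>" "\<rho> < 1" using \<rho> by auto
    from st[OF this] obtain \<phi>' where p: "increasing_profile f (\<phi> \<rho>) \<phi>'" by (auto simp: robin_steady_state_profile)
    have rg: "\<phi> \<rho> y \<in> {0..1}" if "0 < y" for y using profile_range[OF p, of y] that by auto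
    have "continuous_on {0<..} (\<lambda>y. - f' (\<phi> \<rho> y))"
      by (intro continuous_on_minus continuous_on_compose2[OF f'_cont continuous_on_subset[OF phi_cont[OF p]]])
         (use rg in auto)
    then show ?thesis using C rg by auto
  qed
  moreover have "g \<in> borel_measurable (leb {0<..})" if "continuous_on {0<..} g" for g :: "real \<Rightarrow> real"
    using borel_measurable_continuous_on_restrict[OF that] by (simp add: measurable_cong_sets[OF sets_restrict_space_cong[OF sets_lborel] refl])
  ultimately show ?thesis by blast
qed

end

section \<open>Continuity and positive minimum of the principal eigenvalue\<close>

theorem proposition3p4:
  fixes f f' :: "real \<Rightarrow> real" and \<gamma> :: real
    and \<phi> :: "real \<Rightarrow> real \<Rightarrow> real" and \<mu> :: "real \<Rightarrow> real"
    and e :: "'a::euclidean_space"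
  assumes "0 < \<gamma>" "\<gamma> \<le> 1"
    and "C1_hoelder \<gamma> f f'"
    and "f 0 = 0" "f 1 = 0"
    and "\<And>u. 0 < u \<Longrightarrow> u < 1 \<Longrightarrow> f u > 0"
    and "f' 0 > 0" "f' 1 < 0"
    and "\<And>u. 1 < u \<Longrightarrow> f u < 0"
    and "\<And>\<rho>. 0 \<le> \<rho> \<Longrightarrow> \<rho> < 1 \<Longrightarrow> robin_steady_state f \<rho> (\<phi> \<rho>)"
    and "\<And>y. 0 \<le> y \<Longrightarrow> \<phi> 1 y = 1"
    and "\<And>\<rho>. \<rho> \<in> {0..1} \<Longrightarrow>
           \<mu> \<rho> = principal_eigenvalue {0<..} (return borel 0) (\<lambda>y. - f' (\<phi> \<rho> y)) \<rho>"
    and "e \<in> Basis"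
  shows "continuous_on {0..1} \<mu> \<and>
    (\<exists>m. m \<in> \<mu> ` {0..1} \<and> (\<forall>\<rho>\<in>{0..1}. m \<le> \<mu> \<rho>) \<and> m > 0 \<and>
       (\<forall>\<rho>\<in>{0..1}. m \<le> principal_eigenvalue (half_space e) (hyperplane_measure e)
                              (\<lambda>x. - f' (\<phi> \<rho> (x \<bullet> e))) \<rho>))"
proof -
  note st = assms(10) and \<phi>1 = assms(11) and \<mu> = assms(12) and e = assms(13)
  interpret monostable_reaction f f' \<gamma> by unfold_locales (use assms in auto)
  define W where "W \<rho> y = - f' (\<phi> \<rho> y)" for \<rho> y
  obtain C where "\<forall>\<rho>\<in>{0..1}. W \<rho> \<in> borel_measurable (leb {0<..}) \<and> (\<forall>y\<in>{0<..}. \<bar>W \<rho> y\<bar> \<le> C)"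
    using potential_regular[OF st \<phi>1] unfolding W_def[abs_def] by blast
  then have W: "\<And>\<rho>. \<rho> \<in> {0..1} \<Longrightarrow> W \<rho> \<in> borel_measurable (leb {0<..})"
    "\<And>\<rho>. \<rho> \<in> {0..1} \<Longrightarrow> \<forall>y\<in>{0<..}. \<bar>W \<rho> y\<bar> \<le> C" by auto
  have \<mu>W: "\<mu> \<rho> = principal_eigenvalue {0<..} (return borel 0) (W \<rho>) \<rho>" if "\<rho> \<in> {0..1}" for \<rho>
    using \<mu>[OF that] by (simp add: W_def[abs_def])
  have cont: "continuous_on {0..1} \<mu>"
  proof (rule mu_continuous[of W C \<mu>])
    show "\<exists>d>0. \<forall>\<rho>\<in>{0..1}. \<bar>\<rho> - r\<bar> < d \<longrightarrow> (\<forall>x\<in>{0<..}. \<bar>W \<rho> x - W r x\<bar> \<le> \<epsilon>)" if "r \<in> {0..1}" "0 < \<epsilon>" for r \<epsilon>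
      unfolding W_def by (rule potential_continuous[OF st \<phi>1 that])
  qed (use W \<mu>W in auto)
  have pos: "0 < \<mu> \<rho>" if \<rho>: "\<rho> \<in> {0..1}" for \<rho>
  proof -
    have "\<exists>c>0. \<forall>s\<in>form_core (1::real) \<rho>. c * mass s \<le> test_form (1::real) (W \<rho>) (robin_weight \<rho>) s"
    proof (cases "\<rho> = 1")
      case True
      have "- f' 1 * mass s \<le> test_form (1::real) (W \<rho>) (robin_weight \<rho>) s" if s: "s \<in> form_core 1 \<rho>" for s
      proof (rule riccati_bound[OF form_core_test[OF s], where p = "\<lambda>_. 0" and p' = "\<lambda>_. 0"])
        have "continuous_on {0..} (W \<rho>) \<longleftrightarrow> continuous_on {0..} (\<lambda>y::real. - f' 1)"
          by (rule continuous_on_cong) (use True \<phi>1 in \<open>auto simp: W_def\<close>)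
        then show "continuous_on {0..} (W \<rho>)" by simp
        show "- f' 1 \<le> W \<rho> y - 0 - 0\<^sup>2" if "0 < y" for y using that True \<phi>1[of y] by (simp add: W_def)
        show "0 \<le> robin_weight \<rho> \<or> s 0 = 0" using robin_weight_nonneg[of \<rho>] \<rho> by simp
      qed auto
      then show ?thesis using assms(8) by (intro exI[of _ "- f' 1"]) auto
    next
      case False
      then have "0 \<le> \<rho>" "\<rho> < 1" using \<rho> by auto
      from potential_positive[OF this st[OF this]] show ?thesis by (simp add: W_def[abs_def])
    qed
    then obtain c where c: "c > 0" "\<And>s. s \<in> form_core (1::real) \<rho> \<Longrightarrow> c * mass s \<le> test_form (1::real) (W \<rho>) (robin_weight \<rho>) s" by blast
    have "c \<le> \<mu> \<rho>" unfolding \<mu>W[OF \<rho>]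
      by (rule one_dim_eigenvalue(2)[OF W(1)[OF \<rho>] W(2)[OF \<rho>] _ _ c(2)]) (use \<rho> in auto)
    then show ?thesis using c(1) by linarith
  qed
  obtain \<rho>0 where \<rho>0: "\<rho>0 \<in> {0..1}" "\<And>\<rho>. \<rho> \<in> {0..1} \<Longrightarrow> \<mu> \<rho>0 \<le> \<mu> \<rho>"
    using continuous_attains_inf[of "{0..1}" \<mu>] cont by auto
  have half: "\<mu> \<rho>0 \<le> principal_eigenvalue (half_space e) (hyperplane_measure e) (\<lambda>x. - f' (\<phi> \<rho> (x \<bullet> e))) \<rho>"
    if \<rho>: "\<rho> \<in> {0..1}" for \<rho>
  proof -
    have "\<mu> \<rho>0 \<le> principal_eigenvalue {0<..} (return borel 0) (W \<rho>) \<rho>" using \<rho>0(2)[OF \<rho>] \<mu>W[OF \<rho>] by simp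
    then have "\<mu> \<rho>0 \<le> principal_eigenvalue (half_space e) (hyperplane_measure e) (\<lambda>x. W \<rho> (x \<bullet> e)) \<rho>"
      by (rule principal_eigenvalue_half_space_ge[OF e W(1)[OF \<rho>] W(2)[OF \<rho>], rotated 3])
         (use \<rho> pos[OF \<rho>0(1)] in auto)
    then show ?thesis by (simp add: W_def)
  qed
  show ?thesis
    using cont \<rho>0 pos[OF \<rho>0(1)] half by (intro conjI exI[of _ "\<mu> \<rho>0"]) auto
qed

end
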